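(* In the setting below, let $0\le r<R$, $1\le k\le M_r$, and let $\tau^{r,\varepsilon}_k$ be a positive function with $\tau^{r,\varepsilon}_k\sim\sum_{i:S_i\subseteq S^r_k}\tau^\varepsilon_i\,\mathbb E(N^\varepsilon(x,i,r))$ uniformly in $x\in S^r_k$. Then there are $C,\varepsilon_0>0$ such that $\mathbb E\big(T^{r,\varepsilon}(x,S^r_l)\big)^2\le C(\tau^{r,\varepsilon}_k)^2$ for each $x\in S^r_k$, $1\le l\le M_r$ with $P^{r,\varepsilon}_{kl}\not\equiv0$, and $\varepsilon\le\varepsilon_0$.
   Context: Setting: a Markov renewal process on a metric space $S=S_1\cup\dots\cup S_M$ (disjoint Borel sets), embedded chain $(\mathbf X^{x,\varepsilon}_n,\mathbf T^{x,\varepsilon}_n)$ started at $(x,0)$ with transition kernels $Q^\varepsilon(y,\cdot)$ on $S\times[0,\infty)$ depending only on the spatial state; $P^\varepsilon(x,B)=Q^\varepsilon(x,B\times[0,\infty))$; $T^\varepsilon(x,B)$ has law $Q^\varepsilon(x,B\times\cdot)/P^\varepsilon(x,B)$. It satisfies: (a) $P^\varepsilon(x,S_i)=0$ for $x\in S_i$; for $i\ne j$, $P^\varepsilon(x,S_j)$ is $0$ for all $x\in S_i,\varepsilon$ ($P^\varepsilon_{ij}:\equiv0$) or positive with positive $P^\varepsilon_{ij}$, $P^\varepsilon(x,S_j)/P^\varepsilon_{ij}\to1$ uniformly in $x\in S_i$, $\sum_jP^\varepsilon_{ij}=1$, indices communicate through positive $P^\varepsilon$; (b) positive $\tau^\varepsilon_i$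 with $\mathbb ET^\varepsilon(x,S_j)/\tau^\varepsilon_i\to1$ uniformly in $x\in S_i$ when $P^\varepsilon_{ij}\not\equiv0$; (c) $\mathrm{Var}\,T^\varepsilon(x,S_j)\le C(\tau^\varepsilon_i)^2$ for $\varepsilon\le\varepsilon_0$, $x\in S_i$, $P^\varepsilon_{ij}\not\equiv0$; (f) $\lim_{\varepsilon\downarrow0}\prod_{k=1}^n\frac{P^\varepsilon_{a_kb_k}}{P^\varepsilon_{a_kd_k}}\frac{\tau^\varepsilon_a}{\tau^\varepsilon_c}\in[0,\infty]$ whenever defined. Hierarchy: $S^0_i=S_i$, $M_0=M$, $P^{0,\varepsilon}=P^\varepsilon$; $\pi^r$ maps a point or subset to its rank-$r$ cluster; $\theta_0^{x,\varepsilon}(r)=0$, $\theta_n^{x,\varepsilon}(r)=\min\{m>\theta_{n-1}(r):\pi^r(\mathbf X_m)\ne\pi^r(\mathbf X_{\theta_{n-1}(r)})\}$; if $M_r>1$, partition $\{1,\dots,M_r\}$ into ergodic classes of $P^{r,0}_{ij}=\lim P^{r,\varepsilon}_{ij}$ and transient singletons $E_1,\dots,E_{M_{r+1}}$; $S^{r+1}_k=\bigcup_{i\in E_k}S^r_i$; $\lambda^r_k$ the invariant probability on $E_k$ (unit mass for a transient singleton); $P^{r+1,\varepsilon}_{kl}=\sum_{i\in E_k,\,S^r_j\subseteq S^{r+1}_l}\lambda^r_k(i)P^{r,\varepsilon}_{ij}\big/\sum_{i\in E_k,\,S^r_j\not\subseteq S^{r+1}_k}\lambda^r_k(i)P^{r,\varepsilon}_{ij}$;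 $R$ is the first rank with $M_R=1$. For $0\le r<R$: $\mathbf X^{x,r,\varepsilon}_n=\mathbf X^{x,\varepsilon}_{\theta_n(r)}$, $\mathbf T^{x,r,\varepsilon}_n=\sum_{m=\theta_{n-1}(r)+1}^{\theta_n(r)}\mathbf T^{x,\varepsilon}_m$ ($n\ge1$); $T^{r,\varepsilon}(x,S^r_j)$ has the law of $\mathbf T^{x,r,\varepsilon}_1$ conditioned on $\mathbf X^{x,r,\varepsilon}_1\in S^r_j$. $N^\varepsilon(x,i,r)=\sum_{n=0}^{\theta^{x,\varepsilon}_1(r)}\chi_{S_i}(\mathbf X^{x,\varepsilon}_n)$ for $x\in\pi^r(S_i)$. *)

theory Defs
  imports "HOL-Probability.Probability"
begin

definition MT :: "('a::metric_space \<times> real) measure" where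
  "MT = (borel :: 'a measure) \<Otimes>\<^sub>M (borel :: real measure)"

text \<open>A Markov renewal kernel: y maps to the joint law of (next state, holding time),
  a probability measure on S x [0,inf) depending measurably on the spatial state y.\<close>
definition renewal_kernel :: "('a::metric_space \<Rightarrow> ('a \<times> real) measure) \<Rightarrow> bool" where
  "renewal_kernel Q \<longleftrightarrow> Q \<in> borel \<rightarrow>\<^sub>M prob_algebra MT \<and>
     (\<forall>y. measure (Q y) (UNIV \<times> {0..}) = 1)"

definition Pk :: "('a::metric_space \<times> real) measure \<Rightarrow> 'a set \<Rightarrow> real" where
  "Pk N B = measure N (B \<times> {0..})"

text \<open>k-th moment of the holding time T(x,B), whose law is Q(x, B x .)/P(x,B).\<close>
definition cmom :: "('a::metric_space \<times> real) measure \<Rightarrow> 'a set \<Rightarrow> nat \<Rightarrow> ennreal" where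
  "cmom N B k = (\<integral>\<^sup>+ z. indicator (B \<times> {0..}) z * ennreal (snd z ^ k) \<partial>N) / emeasure N (B \<times> {0..})"

text \<open>(X,T) is the embedded chain of the Markov renewal process with kernel Q started at (x,0):
  the conditional law of (X_(n+1),T_(n+1)) given the history up to n is Q(X_n, .).\<close>
definition markov_renewal ::
  "('a::metric_space \<Rightarrow> ('a \<times> real) measure) \<Rightarrow> 'a \<Rightarrow> 'w measure \<Rightarrow>
   (nat \<Rightarrow> 'w \<Rightarrow> 'a) \<Rightarrow> (nat \<Rightarrow> 'w \<Rightarrow> real) \<Rightarrow> bool" where
  "markov_renewal Q x \<Omega> X T \<longleftrightarrow> prob_space \<Omega> \<and>
     (\<forall>n. X n \<in> \<Omega> \<rightarrow>\<^sub>M borel \<and> T n \<in> \<Omega> \<rightarrow>\<^sub>M borel) \<and>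
     (\<forall>\<omega>\<in>space \<Omega>. X 0 \<omega> = x \<and> T 0 \<omega> = 0) \<and>
     (\<forall>n. \<forall>A \<in> sets (PiM {..n} (\<lambda>_. MT)). \<forall>B \<in> sets MT.
        measure \<Omega> {\<omega>\<in>space \<Omega>. (\<lambda>m\<in>{..n}. (X m \<omega>, T m \<omega>)) \<in> A \<and> (X (Suc n) \<omega>, T (Suc n) \<omega>) \<in> B}
        = (\<integral>\<omega>. indicator A (\<lambda>m\<in>{..n}. (X m \<omega>, T m \<omega>)) * measure (Q (X n \<omega>)) B \<partial>\<Omega>))"

text \<open>A rank-r cluster is represented by the set of base indices i with S_i contained in it.
  A rank-r transition matrix is a function eps -> cluster -> cluster -> real.\<close>

definition lim0 :: "(real \<Rightarrow> real) \<Rightarrow> real" where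
  "lim0 f = Lim (at_right 0) f"

definition reach :: "nat set set \<Rightarrow> (nat set \<Rightarrow> nat set \<Rightarrow> real) \<Rightarrow> nat set \<Rightarrow> nat set \<Rightarrow> bool" where
  "reach C P0 K L \<longleftrightarrow> (K, L) \<in> {(K, L). K \<in> C \<and> L \<in> C \<and> P0 K L > 0}\<^sup>*"

definition ergodic_class :: "nat set set \<Rightarrow> (nat set \<Rightarrow> nat set \<Rightarrow> real) \<Rightarrow> nat set set \<Rightarrow> bool" where
  "ergodic_class C P0 E \<longleftrightarrow>
     (\<exists>K\<in>C. E = {L\<in>C. reach C P0 K L} \<and> (\<forall>L\<in>E. reach C P0 L K))"

definition transient_state :: "nat set set \<Rightarrow> (nat set \<Rightarrow> nat set \<Rightarrow> real) \<Rightarrow> nat set \<Rightarrow> bool" where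
  "transient_state C P0 K \<longleftrightarrow> K \<in> C \<and> \<not> (\<forall>L. reach C P0 K L \<longrightarrow> reach C P0 L K)"

definition blocks :: "nat set set \<Rightarrow> (nat set \<Rightarrow> nat set \<Rightarrow> real) \<Rightarrow> nat set set set" where
  "blocks C P0 = {E. ergodic_class C P0 E} \<union> {{K} | K. transient_state C P0 K}"

definition inv_prob :: "nat set set \<Rightarrow> (nat set \<Rightarrow> nat set \<Rightarrow> real) \<Rightarrow> nat set set \<Rightarrow> nat set \<Rightarrow> real" where
  "inv_prob C P0 E =
     (if ergodic_class C P0 E then
        (THE lam. (\<forall>K. K \<notin> E \<longrightarrow> lam K = 0) \<and> (\<forall>K\<in>E. 0 \<le> lam K) \<and> sum lam E = 1 \<and>
                  (\<forall>L\<in>E. (\<Sum>K\<in>E. lam K * P0 K L) = lam L))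
      else (\<lambda>K. if K \<in> E then 1 else 0))"

definition next_level ::
  "nat set set \<times> (real \<Rightarrow> nat set \<Rightarrow> nat set \<Rightarrow> real) \<Rightarrow>
   nat set set \<times> (real \<Rightarrow> nat set \<Rightarrow> nat set \<Rightarrow> real)" where
  "next_level = (\<lambda>(C, P).
     let P0 = (\<lambda>K L. lim0 (\<lambda>\<epsilon>. P \<epsilon> K L));
         lam = (\<lambda>K'. inv_prob C P0 {K\<in>C. K \<subseteq> K'})
     in ((\<lambda>E. \<Union>E) ` blocks C P0,
         \<lambda>\<epsilon> K' L'. if K' = L' then 0 else
            (\<Sum>K\<in>{K\<in>C. K \<subseteq> K'}. \<Sum>L\<in>{L\<in>C. L \<subseteq> L'}. lam K' K * P \<epsilon> K L) /
            (\<Sum>K\<in>{K\<in>C. K \<subseteq> K'}. \<Sum>L\<in>{L\<in>C. \<not> L \<subseteq> K'}. lam K' K * P \<epsilon> K L)))"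

definition level :: "nat \<Rightarrow> (real \<Rightarrow> nat \<Rightarrow> nat \<Rightarrow> real) \<Rightarrow> nat \<Rightarrow>
     nat set set \<times> (real \<Rightarrow> nat set \<Rightarrow> nat set \<Rightarrow> real)" where
  "level M Pm r = (next_level ^^ r)
     ((\<lambda>i. {i}) ` {..<M},
      \<lambda>\<epsilon> K L. if K = L then 0 else Pm \<epsilon> (the_elem K) (the_elem L))"

definition clusters :: "nat \<Rightarrow> (real \<Rightarrow> nat \<Rightarrow> nat \<Rightarrow> real) \<Rightarrow> nat \<Rightarrow> nat set set" where
  "clusters M Pm r = fst (level M Pm r)"

definition Prank :: "nat \<Rightarrow> (real \<Rightarrow> nat \<Rightarrow> nat \<Rightarrow> real) \<Rightarrow> nat \<Rightarrow> real \<Rightarrow> nat set \<Rightarrow> nat set \<Rightarrow> real" where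
  "Prank M Pm r = snd (level M Pm r)"

definition cset :: "(nat \<Rightarrow> 'a set) \<Rightarrow> nat set \<Rightarrow> 'a set" where
  "cset S K = (\<Union>i\<in>K. S i)"

text \<open>n = theta_1, the first exit time from A (X_0 in A).\<close>
definition exit_at :: "'a set \<Rightarrow> (nat \<Rightarrow> 'w \<Rightarrow> 'a) \<Rightarrow> nat \<Rightarrow> 'w \<Rightarrow> bool" where
  "exit_at A X n \<omega> \<longleftrightarrow> 0 < n \<and> X n \<omega> \<notin> A \<and> (\<forall>m. 0 < m \<and> m < n \<longrightarrow> X m \<omega> \<in> A)"

text \<open>N = number of n in {0..theta_1} with X_n in Bset (infinite if theta_1 is infinite).\<close>
definition visits :: "'a set \<Rightarrow> 'a set \<Rightarrow> (nat \<Rightarrow> 'w \<Rightarrow> 'a) \<Rightarrow> 'w \<Rightarrow> ennreal" where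
  "visits A Bset X \<omega> = (\<Sum>n. if (\<forall>m. 0 < m \<and> m < n \<longrightarrow> X m \<omega> \<in> A)
                            then ennreal (indicator Bset (X n \<omega>)) else 0)"

text \<open>Second moment of T^(r,eps)(x,B): the law of sum_(m=1..theta_1) T_m conditioned on X_(theta_1) in B.\<close>
definition exit_mom2 :: "'a set \<Rightarrow> 'a set \<Rightarrow> 'w measure \<Rightarrow> (nat \<Rightarrow> 'w \<Rightarrow> 'a) \<Rightarrow> (nat \<Rightarrow> 'w \<Rightarrow> real) \<Rightarrow> ennreal" where
  "exit_mom2 A B \<Omega> X T =
     (\<integral>\<^sup>+ \<omega>. (\<Sum>n. if exit_at A X n \<omega> \<and> X n \<omega> \<in> B
                    then ennreal ((\<Sum>m\<in>{1..n}. T m \<omega>) ^ 2) else 0) \<partial>\<Omega>) /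
     emeasure \<Omega> {\<omega>\<in>space \<Omega>. \<exists>n. exit_at A X n \<omega> \<and> X n \<omega> \<in> B}"

end

theory Submission
  imports Defs
begin

text \<open>
  Write \<open>h\<close> for the probability of leaving \<open>A = S\<^sup>r\<^sub>k\<close> into \<open>S\<^sup>r\<^sub>l\<close>, as a function of the starting point. The
  heart of the matter is that \<open>h\<close> is comparable to \<open>P\<^sup>r\<^sub>k\<^sub>l\<close>, uniformly in the starting point and
  in \<open>\<epsilon>\<close>. This is proved by induction on the rank and constants suffice throughout, no sharp
  asymptotics are needed: inside a cluster of rank \<open>r + 1\<close> the chain of rank-\<open>r\<close> exits visits each
  rank-\<open>r\<close> cluster within a bounded number of steps with probability bounded below, which bounds \<open>h\<close>
  above and below by the ratio of total exit rates. The limits \<open>P\<^sup>r\<^sup>,\<^sup>0\<close> that define the hierarchy exist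
  because all \<open>P\<^sup>r\<^sup>,\<^sup>\<epsilon>\<close> lie in a family of functions, closed under sums, products and quotients, that
  are asymptotic to products of ratios as in (f).

  Given \<open>h \<le> H\<close> on \<open>A\<close> and \<open>\<Gamma> y = \<Sum>\<^sub>i \<tau>\<^sub>i E N(y, i)\<close>, the function
  \<open>s\<^sup>2 h(y) + 2 s a \<Gamma>(y) + d \<Gamma>(y)\<close>, with \<open>a\<close> of order \<open>H\<close> and \<open>d\<close> of order \<open>H \<tau>\<^sup>r\<close>, is a supersolution
  of the recursion for the second moment of \<open>s\<close> plus the exit time, restricted to exits into
  \<open>S\<^sup>r\<^sub>l\<close>. Evaluating at \<open>s = 0\<close> and dividing by \<open>h\<close> gives the claim.
\<close>

section \<open>Regularly behaved functions of the parameter\<close>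

text \<open>The second moment is conditioned on an exit whose probability may tend to 0, so a bound
  on the numerator must carry the same small factor as the denominator. This forces two-sided
  control of \<open>h\<close>, and it is why \<open>a\<close> and \<open>d\<close> are proportional
  to \<open>H\<close>. The supersolution imitates E((s + T)^2; exit to l) = s^2 h + 2 s E(T; exit to
  l) + E(T^2; exit to l): time spent at a point of \<open>A\<close> is followed by an exit to l with
  probability at most \<open>H\<close>, and \<open>\<Gamma>\<close> solves the first-step equation
  of the total expected time, with each holding time replaced by its order of magnitude.
  Comparability concerns ratios of fluxes out of a block, and up to constants these ignore the
  invariant weights, which lie between two positive bounds. Sure exit from every cluster travels
  along in the same induction, since it justifies restarting the process at the exit from a smaller
  cluster. Functions take values in \<open>ennreal\<close>, so arguments that would subtract a
  survival probability become additive inequalities followed by a cancellation.\<close>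

lemmas at_right_pos = eventually_at_right_less[of "0::real"]

text \<open>A group of orders of magnitude: by \<open>G_lim\<close> applied to quotients, any two
  members are comparable near 0, their ratio having a limit in [0, \<infinity>]. Hypothesis (f)
  enters the proof only through this interface.\<close>

locale limit_group =
  fixes G :: "(real \<Rightarrow> real) set"
  assumes G_pos: "\<And>m t. m \<in> G \<Longrightarrow> 0 < t \<Longrightarrow> 0 < m t"
    and G_mult: "\<And>m m'. m \<in> G \<Longrightarrow> m' \<in> G \<Longrightarrow> (\<lambda>t. m t * m' t) \<in> G"
    and G_inverse: "\<And>m. m \<in> G \<Longrightarrow> (\<lambda>t. inverse (m t)) \<in> G"
    and G_one: "(\<lambda>_. 1) \<in> G"
    and G_lim: "\<And>m. m \<in> G \<Longrightarrow> \<exists>l. ((\<lambda>t. ereal (m t)) \<longlongrightarrow> l) (at_right 0)"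
begin

text \<open>Positivity is demanded at every t > 0 and not only near 0, because the row sums and
  quotients of the hierarchy are formed at every parameter.\<close>

definition regular :: "(real \<Rightarrow> real) \<Rightarrow> bool" where
  "regular f \<longleftrightarrow> (\<forall>t>0. 0 < f t) \<and>
     (\<exists>m\<in>G. \<exists>c>0. ((\<lambda>t. f t / m t) \<longlongrightarrow> c) (at_right 0))"

lemma regularI:
  assumes "\<And>t. 0 < t \<Longrightarrow> 0 < f t" "m \<in> G" "0 < c"
    "((\<lambda>t. f t / m t) \<longlongrightarrow> c) (at_right 0)"
  shows "regular f"
  using assms unfolding regular_def by blast

lemma regularE:
  assumes "regular f"
  obtains m c where "m \<in> G" "0 < c" "((\<lambda>t. f t / m t) \<longlongrightarrow> c) (at_right 0)"
  using assms unfolding regular_def by blast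

lemma regular_pos: "regular f \<Longrightarrow> 0 < t \<Longrightarrow> 0 < f t"
  unfolding regular_def by blast

lemma regular_cong:
  assumes f: "regular f" and eq: "\<And>t. 0 < t \<Longrightarrow> f t = g t"
  shows "regular g"
proof -
  obtain m c where m: "m \<in> G" "0 < c" "((\<lambda>t. f t / m t) \<longlongrightarrow> c) (at_right 0)"
    using f by (rule regularE)
  have "((\<lambda>t. g t / m t) \<longlongrightarrow> c) (at_right 0)"
    using m(3)
  proof (rule Lim_transform_eventually)
    show "\<forall>\<^sub>F t in at_right 0. f t / m t = g t / m t"
      using at_right_pos by eventually_elim (simp add: eq)
  qed
  moreover have "0 < g t" if "0 < t" for t
    using regular_pos[OF f that] eq[OF that] by simp
  ultimately show ?thesis using m by (auto intro: regularI)
qed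

lemma G_regular: "m \<in> G \<Longrightarrow> regular m"
proof (rule regularI)
  assume m: "m \<in> G"
  show "((\<lambda>t. m t / m t) \<longlongrightarrow> 1) (at_right 0)"
    by (rule tendsto_eventually) (use at_right_pos G_pos[OF m] in \<open>force elim: eventually_mono\<close>)
qed (auto intro: G_pos)

lemma regular_const: "0 < c \<Longrightarrow> regular (\<lambda>_. c)"
  by (rule regularI[OF _ G_one]) auto

lemma regular_mult:
  assumes "regular f" "regular g"
  shows "regular (\<lambda>t. f t * g t)"
proof -
  obtain m c where m: "m \<in> G" "0 < c" "((\<lambda>t. f t / m t) \<longlongrightarrow> c) (at_right 0)"
    using assms(1) by (rule regularE)
  obtain m' c' where m': "m' \<in> G" "0 < c'" "((\<lambda>t. g t / m' t) \<longlongrightarrow> c') (at_right 0)"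
    using assms(2) by (rule regularE)
  show ?thesis
  proof (rule regularI)
    show "((\<lambda>t. f t * g t / (m t * m' t)) \<longlongrightarrow> c * c') (at_right 0)"
      using tendsto_mult[OF m(3) m'(3)] by (simp add: field_simps)
  qed (use assms m m' G_mult regular_pos in auto)
qed

lemma regular_inverse:
  assumes "regular f"
  shows "regular (\<lambda>t. inverse (f t))"
proof -
  obtain m c where m: "m \<in> G" "0 < c" "((\<lambda>t. f t / m t) \<longlongrightarrow> c) (at_right 0)"
    using assms(1) by (rule regularE)
  show ?thesis
  proof (rule regularI)
    show "((\<lambda>t. inverse (f t) / inverse (m t)) \<longlongrightarrow> inverse c) (at_right 0)"
      using tendsto_inverse[OF m(3)] m(2) by (simp add: field_simps)
  qed (use assms m G_inverse regular_pos in auto)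
qed

lemma regular_divide: "regular f \<Longrightarrow> regular g \<Longrightarrow> regular (\<lambda>t. f t / g t)"
  using regular_mult[OF _ regular_inverse] by (simp add: divide_inverse)

text \<open>When m / m' tends to a finite l, the sum is asymptotic to (c l + c') m'. Nothing cancels
  among positive functions, and c' > 0 keeps the constant positive even if l = 0.\<close>

lemma regular_add_finite:
  assumes f: "regular f" and g: "regular g"
    and m: "m \<in> G" "0 < c" "((\<lambda>t. f t / m t) \<longlongrightarrow> c) (at_right 0)"
    and m': "m' \<in> G" "0 < c'" "((\<lambda>t. g t / m' t) \<longlongrightarrow> c') (at_right 0)"
    and l: "((\<lambda>t. m t / m' t) \<longlongrightarrow> l) (at_right 0)"
  shows "regular (\<lambda>t. f t + g t)"
proof (rule regularI)
  have l0: "0 \<le> l"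
  proof (rule tendsto_lowerbound[OF l])
    show "\<forall>\<^sub>F t in at_right 0. 0 \<le> m t / m' t"
      using at_right_pos by eventually_elim (simp add: G_pos[OF m(1)] G_pos[OF m'(1)] less_imp_le)
  qed simp
  show "0 < c * l + c'" using l0 m(2) m'(2) by (simp add: add_nonneg_pos)
  have "((\<lambda>t. f t / m t * (m t / m' t) + g t / m' t) \<longlongrightarrow> c * l + c') (at_right 0)"
    by (intro tendsto_intros m l m')
  moreover have "\<forall>\<^sub>F t in at_right 0. f t / m t * (m t / m' t) + g t / m' t = (f t + g t) / m' t"
    using at_right_pos
  proof eventually_elim
    case (elim t)
    then show ?case using G_pos[OF m(1), of t] G_pos[OF m'(1), of t] by (simp add: field_simps)
  qed
  ultimately show "((\<lambda>t. (f t + g t) / m' t) \<longlongrightarrow> c * l + c') (at_right 0)"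
    by (rule Lim_transform_eventually)
qed (use f g m' regular_pos in \<open>auto simp: add_pos_pos\<close>)

lemma G_lim_cases:
  assumes "m \<in> G"
  obtains l where "(m \<longlongrightarrow> l) (at_right 0)" "0 \<le> l"
  | "filterlim m at_top (at_right 0)"
proof -
  obtain l where l: "((\<lambda>t. ereal (m t)) \<longlongrightarrow> l) (at_right 0)" using G_lim assms by blast
  have l0: "0 \<le> l"
  proof (rule tendsto_lowerbound[OF l])
    show "\<forall>\<^sub>F t in at_right 0. 0 \<le> ereal (m t)"
      using at_right_pos by eventually_elim (simp add: G_pos[OF assms] less_imp_le)
  qed simp
  show thesis
  proof (cases l)
    case (real x)
    then show ?thesis using l l0 that(1)[of x] by simp
  next
    case PInf
    have "filterlim m at_top (at_right 0)"
      using l PInf by (simp add: tendsto_PInfty_eq_at_top)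
    then show ?thesis by (rule that(2))
  next
    case MInf
    then show ?thesis using l0 by simp
  qed
qed

text \<open>The ratio m / m' has a limit. If it is infinite, its reciprocal tends to 0 and the two
  summands exchange roles.\<close>

lemma regular_add:
  assumes f: "regular f" and g: "regular g"
  shows "regular (\<lambda>t. f t + g t)"
proof -
  obtain m c where m: "m \<in> G" "0 < c" "((\<lambda>t. f t / m t) \<longlongrightarrow> c) (at_right 0)"
    using f by (rule regularE)
  obtain m' c' where m': "m' \<in> G" "0 < c'" "((\<lambda>t. g t / m' t) \<longlongrightarrow> c') (at_right 0)"
    using g by (rule regularE)
  have "(\<lambda>t. m t / m' t) \<in> G"
    using G_mult[OF m(1) G_inverse[OF m'(1)]] by (simp add: divide_inverse)
  then show ?thesis
  proof (cases rule: G_lim_cases)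
    case (1 l)
    then show ?thesis using regular_add_finite[OF f g m m'] by blast
  next
    case 2
    then have "((\<lambda>t. inverse (m t / m' t)) \<longlongrightarrow> 0) (at_right 0)"
      by (rule tendsto_inverse_0_at_top)
    then have "((\<lambda>t. m' t / m t) \<longlongrightarrow> 0) (at_right 0)" by simp
    from regular_add_finite[OF g f m' m this] show ?thesis by (simp add: add.commute)
  qed
qed

lemma regular_sum:
  assumes "finite I" "\<And>i. i \<in> I \<Longrightarrow> regular (f i) \<or> (\<forall>t>0. f i t = 0)" "i \<in> I" "regular (f i)"
  shows "regular (\<lambda>t. \<Sum>i\<in>I. f i t)"
proof -
  define J where "J = {i\<in>I. regular (f i)}"
  have J: "finite J" "J \<noteq> {}" using assms by (auto simp: J_def)
  from J have "\<forall>i\<in>J. regular (f i) \<Longrightarrow> regular (\<lambda>t. \<Sum>i\<in>J. f i t)"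
    by (induction J rule: finite_ne_induct) (auto intro: regular_add)
  then have J_reg: "regular (\<lambda>t. \<Sum>i\<in>J. f i t)" by (simp add: J_def)
  have eq: "(\<Sum>i\<in>I. f i t) = (\<Sum>i\<in>J. f i t)" if "0 < t" for t
    using assms that by (intro sum.mono_neutral_right) (auto simp: J_def)
  from J_reg show ?thesis by (rule regular_cong) (simp add: eq)
qed

text \<open>The order of magnitude \<open>m\<close> has a limit in [0, \<infinity>]; infinity is
  excluded, since \<open>f\<close> would then exceed 1.\<close>

lemma regular_bounded_lim:
  assumes f: "regular f" and le: "\<And>t. 0 < t \<Longrightarrow> f t \<le> 1"
  shows "\<exists>l\<ge>0. (f \<longlongrightarrow> l) (at_right 0)"
proof -
  obtain m c where m: "m \<in> G" "0 < c" "((\<lambda>t. f t / m t) \<longlongrightarrow> c) (at_right 0)"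
    using f by (rule regularE)
  have ev: "\<forall>\<^sub>F t in at_right 0. f t / m t * m t = f t"
    using at_right_pos by eventually_elim (use G_pos[OF m(1)] in force)
  show ?thesis
    using m(1)
  proof (cases rule: G_lim_cases)
    case (1 l)
    have "(f \<longlongrightarrow> c * l) (at_right 0)"
      using tendsto_mult[OF m(3) 1(1)] ev by (rule Lim_transform_eventually)
    then show ?thesis using 1(2) m(2) by (intro exI[of _ "c * l"]) simp
  next
    case 2
    have "filterlim (\<lambda>t. f t / m t * m t) at_top (at_right 0)"
      by (rule filterlim_tendsto_pos_mult_at_top[OF m(3,2) 2])
    then have "\<forall>\<^sub>F t in at_right 0. 2 \<le> f t / m t * m t"
      by (simp add: filterlim_at_top)
    with ev at_right_pos have "\<forall>\<^sub>F t in at_right (0::real). False"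
    proof eventually_elim
      case (elim t)
      then show ?case using le[of t] by simp
    qed
    then show ?thesis by simp
  qed
qed

end

section \<open>Invariant probabilities of finite irreducible chains\<close>

text \<open>Induction on the number of states: one state is removed by watching the chain only off
  it, and an invariant measure of the watched chain is extended back to that state.\<close>

lemma invariant_measure_exists:
  fixes p :: "'b \<Rightarrow> 'b \<Rightarrow> real"
  assumes "finite E" "E \<noteq> {}" "\<And>i j. i \<in> E \<Longrightarrow> j \<in> E \<Longrightarrow> 0 \<le> p i j"
    "\<And>i. i \<in> E \<Longrightarrow> (\<Sum>j\<in>E. p i j) = 1"
  shows "\<exists>lam. (\<forall>i\<in>E. 0 \<le> lam i) \<and> (\<Sum>i\<in>E. lam i) > 0 \<and> (\<forall>j\<in>E. (\<Sum>i\<in>E. lam i * p i j) = lam j)"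
  using assms
proof (induction E arbitrary: p rule: finite_ne_induct)
  case (singleton s)
  then show ?case by (intro exI[of _ "\<lambda>_. 1"]) auto
next
  case (insert s E)
  have nonneg: "\<And>i j. i \<in> insert s E \<Longrightarrow> j \<in> insert s E \<Longrightarrow> 0 \<le> p i j"
    and row: "\<And>i. i \<in> insert s E \<Longrightarrow> p i s + (\<Sum>j\<in>E. p i j) = 1"
    using insert by auto
  show ?case
  proof (cases "p s s = 1")
    \<comment> \<open>An absorbing \<open>s\<close> cannot be removed in this way, but then the unit
      mass at \<open>s\<close> is itself invariant.\<close>
    case True
    then have "(\<Sum>j\<in>E. p s j) = 0" using row[of s] by simp
    then have zero: "\<forall>j\<in>E. p s j = 0"
      using nonneg insert by (subst (asm) sum_nonneg_eq_0_iff) auto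
    show ?thesis
      using insert(1,3) zero True
      by (intro exI[of _ "\<lambda>i. if i = s then 1 else 0"])
        (auto intro!: sum.neutral)
  next
    case False
    have sum_s: "(\<Sum>j\<in>E. p s j) = 1 - p s s" using row[of s] by simp
    moreover have "0 \<le> (\<Sum>j\<in>E. p s j)" using nonneg by (intro sum_nonneg) auto
    ultimately have pos: "0 < 1 - p s s" using False by simp
    \<comment> \<open>the chain watched only while it is off \<open>s\<close>\<close>
    define p' where "p' i j = p i j + p i s * p s j / (1 - p s s)" for i j
    have "\<exists>lam. (\<forall>i\<in>E. 0 \<le> lam i) \<and> (\<Sum>i\<in>E. lam i) > 0 \<and> (\<forall>j\<in>E. (\<Sum>i\<in>E. lam i * p' i j) = lam j)"
    proof (rule insert.IH)
      show "0 \<le> p' i j" if "i \<in> E" "j \<in> E" for i j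
        unfolding p'_def using that pos nonneg by (intro add_nonneg_nonneg divide_nonneg_pos mult_nonneg_nonneg) auto
      show "(\<Sum>j\<in>E. p' i j) = 1" if "i \<in> E" for i
        using row[of i] that pos sum_s
        by (simp add: p'_def sum.distrib flip: sum_distrib_left sum_divide_distrib)
    qed
    then obtain lam where lam: "\<forall>i\<in>E. 0 \<le> lam i" "(\<Sum>i\<in>E. lam i) > 0"
      "\<And>j. j \<in> E \<Longrightarrow> (\<Sum>i\<in>E. lam i * p' i j) = lam j" by auto
    \<comment> \<open>The mass of \<open>s\<close> is dictated by balance at \<open>s\<close>: a = a
      * p s s + inflow from \<open>E\<close>.\<close>
    define a where "a = (\<Sum>i\<in>E. lam i * p i s) / (1 - p s s)"
    have a0: "0 \<le> a" unfolding a_def using lam nonneg pos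
      by (intro divide_nonneg_pos sum_nonneg mult_nonneg_nonneg) auto
    define mu where "mu = lam(s := a)"
    have mu_sum: "(\<Sum>i\<in>E. mu i * f i) = (\<Sum>i\<in>E. lam i * f i)" for f
      using insert(3) by (intro sum.cong) (auto simp: mu_def)
    have mu_s: "mu s = a" by (simp add: mu_def)
    have 1: "(\<Sum>i\<in>insert s E. mu i * p i s) = mu s"
    proof -
      have "(\<Sum>i\<in>insert s E. mu i * p i s) = a * p s s + a * (1 - p s s)"
        using insert(1,3) pos by (simp add: mu_sum mu_s a_def)
      then show ?thesis by (simp add: mu_s algebra_simps)
    qed
    have 2: "(\<Sum>i\<in>insert s E. mu i * p i j) = mu j" if "j \<in> E" for j
    proof -
      have "lam j = (\<Sum>i\<in>E. lam i * p i j) + (\<Sum>i\<in>E. lam i * p i s * (p s j / (1 - p s s)))"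
        using lam(3)[OF that] by (simp add: p'_def ring_distribs sum.distrib mult.assoc)
      also have "(\<Sum>i\<in>E. lam i * p i s * (p s j / (1 - p s s))) = a * p s j"
        by (simp only: a_def flip: sum_distrib_right) simp
      finally have "lam j = (\<Sum>i\<in>E. lam i * p i j) + a * p s j" .
      moreover have "mu j = lam j" using that insert(3) by (auto simp: mu_def)
      ultimately show ?thesis using insert(1,3) by (simp add: mu_sum mu_s)
    qed
    have "(\<Sum>i\<in>insert s E. mu i) > 0"
      using lam(2) a0 insert(1,3) mu_sum[of "\<lambda>_. 1"] by (simp add: mu_s)
    moreover have "\<forall>i\<in>insert s E. 0 \<le> mu i" using lam a0 by (auto simp: mu_def)
    ultimately show ?thesis using 1 2 by blast
  qed
qed

text \<open>A state without mass receives nothing, so its predecessors have no mass either: zeros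
  spread backwards along paths.\<close>

lemma invariant_measure_zero:
  fixes p :: "'b \<Rightarrow> 'b \<Rightarrow> real"
  assumes fin: "finite E" and p: "\<And>i j. i \<in> E \<Longrightarrow> j \<in> E \<Longrightarrow> 0 \<le> p i j"
    and lam: "\<And>i. i \<in> E \<Longrightarrow> 0 \<le> lam i" "\<And>j. j \<in> E \<Longrightarrow> (\<Sum>i\<in>E. lam i * p i j) = lam j"
    and path: "(k, l) \<in> {(i, j). i \<in> E \<and> j \<in> E \<and> 0 < p i j}\<^sup>*" and z: "lam l = 0"
  shows "lam k = 0"
  using path z
proof (induction rule: converse_rtrancl_induct)
  case (step i j)
  then have ij: "i \<in> E" "j \<in> E" "0 < p i j" "lam j = 0" by auto
  have "(\<Sum>i\<in>E. lam i * p i j) = 0" using lam(2) ij by simp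
  then have "lam i * p i j = 0"
    using fin ij lam p by (subst (asm) sum_nonneg_eq_0_iff) auto
  then show ?case using ij by simp
qed

text \<open>\<open>Inv\<close> is literally the predicate under the \<open>THE\<close> of
  \<open>inv_prob\<close>, so that the result can be transferred by \<open>theI'\<close>.\<close>

lemma invariant_probability_ex1_pos:
  fixes p :: "'b \<Rightarrow> 'b \<Rightarrow> real"
  assumes fin: "finite E" "E \<noteq> {}" and p: "\<And>i j. i \<in> E \<Longrightarrow> j \<in> E \<Longrightarrow> 0 \<le> p i j"
    and row: "\<And>i. i \<in> E \<Longrightarrow> (\<Sum>j\<in>E. p i j) = 1"
    and conn: "\<And>k l. k \<in> E \<Longrightarrow> l \<in> E \<Longrightarrow> (k, l) \<in> {(i, j). i \<in> E \<and> j \<in> E \<and> 0 < p i j}\<^sup>*"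
  defines "Inv \<equiv> \<lambda>lam. (\<forall>K. K \<notin> E \<longrightarrow> lam K = 0) \<and> (\<forall>K\<in>E. 0 \<le> lam K) \<and> sum lam E = 1 \<and>
                  (\<forall>L\<in>E. (\<Sum>K\<in>E. lam K * p K L) = lam L)"
  shows "\<exists>!lam. Inv lam" and "Inv lam \<Longrightarrow> i \<in> E \<Longrightarrow> 0 < lam i"
proof -
  have pos: "0 < lam i" if "Inv lam" "i \<in> E" for lam i
  proof (rule ccontr)
    assume "\<not> 0 < lam i"
    then have z: "lam i = 0" using that by (force simp: Inv_def)
    have "lam k = 0" if "k \<in> E" for k
      by (rule invariant_measure_zero[where E=E and p=p and l=i])
        (use \<open>Inv lam\<close> \<open>i \<in> E\<close> that z fin p conn in \<open>auto simp: Inv_def\<close>)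
    then have "sum lam E = 0" by simp
    then show False using that by (simp add: Inv_def)
  qed
  show "Inv lam \<Longrightarrow> i \<in> E \<Longrightarrow> 0 < lam i" by (rule pos)
  obtain lam where lam: "\<forall>i\<in>E. 0 \<le> lam i" "(\<Sum>i\<in>E. lam i) > 0" "\<forall>j\<in>E. (\<Sum>i\<in>E. lam i * p i j) = lam j"
    using invariant_measure_exists[OF fin, of p] p row by blast
  define nu where "nu i = (if i \<in> E then lam i / sum lam E else 0)" for i
  have nu: "Inv nu"
    unfolding Inv_def
  proof (intro conjI ballI allI impI)
    show "sum nu E = 1" using lam(2) by (simp add: nu_def flip: sum_divide_distrib)
    show "(\<Sum>K\<in>E. nu K * p K L) = nu L" if "L \<in> E" for L
      using lam(2,3) that by (simp add: nu_def flip: sum_divide_distrib)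
  qed (use lam in \<open>auto simp: nu_def\<close>)
  have "mu = nu" if mu: "Inv mu" for mu
  proof -
    \<comment> \<open>The largest multiple of \<open>nu\<close> that can be subtracted from
      \<open>mu\<close> without losing nonnegativity. The difference \<open>d\<close> is invariant
      and zero at the minimizing state, hence zero everywhere, and comparing total masses gives t =
      1.\<close>
    define t where "t = Min ((\<lambda>i. mu i / nu i) ` E)"
    have "t \<in> (\<lambda>i. mu i / nu i) ` E" unfolding t_def using fin by (intro Min_in) auto
    then obtain l where l: "l \<in> E" "t = mu l / nu l" by auto
    have le: "t \<le> mu i / nu i" if "i \<in> E" for i using that fin by (simp add: t_def)
    define d where "d i = mu i - t * nu i" for i
    have d_zero: "d k = 0" if "k \<in> E" for k
    proof (rule invariant_measure_zero[where E=E and p=p and l=l])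
      show "0 \<le> d i" if "i \<in> E" for i
        using le[OF that] pos[OF nu that] by (simp add: d_def field_simps)
      show "(\<Sum>i\<in>E. d i * p i j) = d j" if "j \<in> E" for j
      proof -
        have "(\<Sum>i\<in>E. d i * p i j) = (\<Sum>i\<in>E. mu i * p i j) - t * (\<Sum>i\<in>E. nu i * p i j)"
          by (simp add: d_def left_diff_distrib sum_subtractf sum_distrib_left mult.assoc)
        then show ?thesis using that mu nu by (simp add: Inv_def d_def)
      qed
      show "d l = 0" using pos[OF nu l(1)] by (simp add: d_def l(2))
    qed (use l that conn fin p in auto)
    have "0 = sum d E" using d_zero by simp
    also have "\<dots> = 1 - t" using mu nu
      by (simp add: d_def[abs_def] sum_subtractf Inv_def flip: sum_distrib_left)
    finally have t1: "t = 1" by simp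
    show "mu = nu"
    proof
      fix i show "mu i = nu i"
        using d_zero[of i] t1 mu nu by (cases "i \<in> E") (auto simp: d_def Inv_def)
    qed
  qed
  with nu show "\<exists>!lam. Inv lam" by blast
qed

section \<open>Harnack inequalities for positive operators\<close>

text \<open>Taking the infimum over \<open>y\<close> puts inf u on both sides, where it cancels; the
  bound at the single point \<open>x\<close> makes it finite.\<close>

lemma add_INF_cancel:
  fixes u :: "'a \<Rightarrow> ennreal"
  assumes le: "\<And>y. y \<in> A \<Longrightarrow> a + (INF x\<in>A. u x) \<le> u y + c" and x: "x \<in> A" "u x \<le> 1" and a: "a \<noteq> \<top>"
  shows "a \<le> c"
proof -
  define m where "m = (INF x\<in>A. u x)"
  have "m \<le> 1" using INF_lower[OF x(1), of u] x(2) by (simp add: m_def)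
  then have m1: "m \<noteq> \<top>" by (auto simp: top_unique)
  have "a + m - c \<le> (INF x\<in>A. u x)"
    using le a m1 by (intro INF_greatest) (auto simp: ennreal_minus_le_iff add.commute m_def[symmetric])
  then have "m + a \<le> m + c"
    by (simp add: ennreal_minus_le_iff add_ac m_def[symmetric])
  then show ?thesis using m1 by (simp add: ennreal_add_left_cancel_le)
qed

text \<open>A kernel killed off \<open>A\<close>: by \<open>T_mono\<close>, \<open>T f\<close>
  depends only on \<open>f\<close> restricted to \<open>A\<close>, while functions remain defined on
  the whole space so that measurability is plain Borel measurability.\<close>

locale positive_operator =
  fixes T :: "('a::metric_space \<Rightarrow> ennreal) \<Rightarrow> 'a \<Rightarrow> ennreal" and A :: "'a set"
  assumes T_meas: "\<And>f. f \<in> borel_measurable borel \<Longrightarrow> T f \<in> borel_measurable borel"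
    and T_add: "\<And>f g x. f \<in> borel_measurable borel \<Longrightarrow> g \<in> borel_measurable borel \<Longrightarrow>
                  T (\<lambda>x. f x + g x) x = T f x + T g x"
    and T_cmult: "\<And>f c x. f \<in> borel_measurable borel \<Longrightarrow> T (\<lambda>x. c * f x) x = c * T f x"
    and T_mono: "\<And>f g x. (\<And>y. y \<in> A \<Longrightarrow> f y \<le> g y) \<Longrightarrow> T f x \<le> T g x"
begin

lemma T_cong: "(\<And>y. y \<in> A \<Longrightarrow> f y = g y) \<Longrightarrow> T f = T g"
  by (intro ext antisym T_mono) auto

lemma iter_meas: "f \<in> borel_measurable borel \<Longrightarrow> (T ^^ n) f \<in> borel_measurable borel"
  by (induction n) (auto intro: T_meas)

lemma T_sum:
  assumes "finite I" "\<And>i. i \<in> I \<Longrightarrow> f i \<in> borel_measurable borel"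
  shows "T (\<lambda>x. \<Sum>i\<in>I. c i * f i x) x = (\<Sum>i\<in>I. c i * T (f i) x)"
  using assms
proof (induction I rule: finite_induct)
  case empty
  then show ?case using T_cmult[of "\<lambda>_. 0" 0 x] by simp
next
  case (insert i I)
  then show ?case by (simp add: T_add T_cmult borel_measurable_sum)
qed

lemma iter_mono: "x \<in> A \<Longrightarrow> (\<And>y. y \<in> A \<Longrightarrow> f y \<le> g y) \<Longrightarrow> (T ^^ n) f x \<le> (T ^^ n) g x"
  by (induction n arbitrary: x) (auto intro: T_mono)

lemma iter_cong: "x \<in> A \<Longrightarrow> (\<And>y. y \<in> A \<Longrightarrow> f y = g y) \<Longrightarrow> (T ^^ n) f x = (T ^^ n) g x"
  by (intro antisym iter_mono) auto

lemma iter_add: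
  "f \<in> borel_measurable borel \<Longrightarrow> g \<in> borel_measurable borel \<Longrightarrow>
    (T ^^ n) (\<lambda>x. f x + g x) = (\<lambda>x. (T ^^ n) f x + (T ^^ n) g x)"
proof (induction n)
  case (Suc n)
  then show ?case by (auto simp: T_add iter_meas)
qed simp

lemma iter_cmult:
  "f \<in> borel_measurable borel \<Longrightarrow> (T ^^ n) (\<lambda>x. c * f x) = (\<lambda>x. c * (T ^^ n) f x)"
proof (induction n)
  case (Suc n)
  then show ?case by (auto simp: T_cmult iter_meas)
qed simp

text \<open>A finite Neumann expansion; keeping the remainder \<open>(T ^^ n) u\<close> avoids
  questions of convergence.\<close>

lemma resolvent_iterate:
  assumes [measurable]: "u \<in> borel_measurable borel" "g \<in> borel_measurable borel"
    and eq: "\<And>x. x \<in> A \<Longrightarrow> u x = g x + T u x" and x: "x \<in> A"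
  shows "u x = (\<Sum>j<n. (T ^^ j) g x) + (T ^^ n) u x"
proof (induction n)
  case (Suc n)
  have "(T ^^ n) u x = (T ^^ n) (\<lambda>x. g x + T u x) x"
    by (rule iter_cong[OF x eq])
  also have "\<dots> = (T ^^ n) g x + (T ^^ Suc n) u x"
    by (simp add: iter_add T_meas funpow_swap1)
  finally show ?case using Suc by (simp add: add_ac)
qed simp

text \<open>\<open>v\<close> bounds below the expected number of visits to \<open>W\<close> in the
  first n steps, and each visit collects at least \<open>q\<close>.\<close>

lemma visit_lower:
  assumes [measurable]: "W \<in> sets borel"
    and g: "\<And>x. x \<in> A \<Longrightarrow> q * indicator W x \<le> g x"
    and visit: "v \<le> (\<Sum>j<n. (T ^^ j) (indicator W) y)" and y: "y \<in> A"
  shows "q * v \<le> (\<Sum>j<n. (T ^^ j) g y)"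
proof -
  have "q * v \<le> q * (\<Sum>j<n. (T ^^ j) (indicator W) y)"
    using visit by (rule mult_left_mono) simp
  also have "\<dots> = (\<Sum>j<n. (T ^^ j) (\<lambda>x. q * indicator W x) y)"
    by (simp add: sum_distrib_left iter_cmult)
  also have "\<dots> \<le> (\<Sum>j<n. (T ^^ j) g y)"
    by (intro sum_mono iter_mono y g)
  finally show ?thesis .
qed

end

locale sub_markov_operator = positive_operator +
  assumes T_one: "\<And>x. x \<in> A \<Longrightarrow> T (\<lambda>_. 1) x \<le> 1"
begin

lemma iter_const_le: "x \<in> A \<Longrightarrow> (T ^^ n) (\<lambda>_. c) x \<le> c"
proof (induction n arbitrary: x)
  case (Suc n)
  have "(T ^^ Suc n) (\<lambda>_. c) x \<le> T (\<lambda>_. c * 1) x" using Suc by (auto intro: T_mono)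
  also have "\<dots> = c * T (\<lambda>_. 1) x" by (subst T_cmult) auto
  also have "\<dots> \<le> c * 1" using T_one Suc by (intro mult_left_mono) auto
  finally show ?case by simp
qed simp

lemma iter_le: "x \<in> A \<Longrightarrow> (\<And>y. y \<in> A \<Longrightarrow> f y \<le> c) \<Longrightarrow> (T ^^ n) f x \<le> c"
  using iter_mono[of x f "\<lambda>_. c" n] iter_const_le[of x n c] by (auto intro: order_trans)

text \<open>Each step loses mass at most \<open>e\<close>, applied to a mass that is at most 1, so
  the losses add up to at most n e.\<close>

lemma iter_one_lower:
  assumes e: "\<And>x. x \<in> A \<Longrightarrow> 1 \<le> T (\<lambda>_. 1) x + e" and x: "x \<in> A"
  shows "1 \<le> (T ^^ n) (\<lambda>_. 1) x + of_nat n * e"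
  using x
proof (induction n arbitrary: x)
  case (Suc n)
  have "1 \<le> T (\<lambda>_. 1) x + e" using e Suc by auto
  also have "\<dots> \<le> T (\<lambda>x. (T ^^ n) (\<lambda>_. 1) x + of_nat n * e * 1) x + e"
    using Suc.IH by (intro add_mono T_mono) auto
  also have "\<dots> = (T ^^ Suc n) (\<lambda>_. 1) x + of_nat n * e * T (\<lambda>_. 1) x + e"
    by (subst T_add; (subst T_cmult)?) (auto simp: iter_meas)
  also have "\<dots> \<le> (T ^^ Suc n) (\<lambda>_. 1) x + of_nat n * e * 1 + e"
    using T_one Suc by (intro add_mono mult_left_mono) auto
  finally show ?case by (simp add: ring_distribs add_ac)
qed simp

text \<open>With \<open>m = inf u\<close>, iterating \<open>u = g + T u\<close> gives \<open>u + m n e \<ge> q v + m\<close>; the term \<open>m\<close> cancels.\<close>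
lemma harnack_lower:
  assumes [measurable]: "u \<in> borel_measurable borel" "g \<in> borel_measurable borel" "W \<in> sets borel"
    and eq: "\<And>x. x \<in> A \<Longrightarrow> u x = g x + T u x"
    and u1: "\<And>x. x \<in> A \<Longrightarrow> u x \<le> 1"
    and e: "\<And>x. x \<in> A \<Longrightarrow> 1 \<le> T (\<lambda>_. 1) x + e"
    and g: "\<And>x. x \<in> A \<Longrightarrow> q * indicator W x \<le> g x"
    and visit: "\<And>x. x \<in> A \<Longrightarrow> v \<le> (\<Sum>j<n. (T ^^ j) (indicator W) x)"
    and qv: "q * v \<noteq> \<top>"
    and x: "x \<in> A"
  shows "q * v \<le> u x * (of_nat n * e)"
proof -
  define m where "m = (INF x\<in>A. u x)"
  have m_le: "m \<le> u y" if "y \<in> A" for y unfolding m_def using that by (rule INF_lower)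
  have m1: "m \<le> 1" using m_le[OF x] u1[OF x] by simp
  have "q * v + m \<le> u y + m * (of_nat n * e)" if y: "y \<in> A" for y
  proof -
    have 1: "q * v \<le> (\<Sum>j<n. (T ^^ j) g y)"
      by (rule visit_lower[OF _ g visit[OF y] y]) auto
    have "m * (T ^^ n) (\<lambda>_. 1) y = (T ^^ n) (\<lambda>_. m * 1) y" by (subst iter_cmult) auto
    also have "\<dots> \<le> (T ^^ n) u y" using m_le by (intro iter_mono y) auto
    finally have 2: "m * (T ^^ n) (\<lambda>_. 1) y \<le> (T ^^ n) u y" .
    have "m * 1 \<le> m * ((T ^^ n) (\<lambda>_. 1) y + of_nat n * e)"
      by (intro mult_left_mono iter_one_lower e y) auto
    also have "\<dots> \<le> (T ^^ n) u y + m * (of_nat n * e)"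
      using 2 by (simp add: ring_distribs add_mono)
    finally have "q * v + m \<le> (\<Sum>j<n. (T ^^ j) g y) + ((T ^^ n) u y + m * (of_nat n * e))"
      using 1 by (intro add_mono) auto
    also have "\<dots> = u y + m * (of_nat n * e)"
      using resolvent_iterate[OF _ _ eq y, of n] by (simp add: add_ac)
    finally show ?thesis .
  qed
  then have "q * v \<le> m * (of_nat n * e)"
    using add_INF_cancel[where u=u and a="q * v", OF _ x u1[OF x] qv] by (simp add: m_def)
  also have "\<dots> \<le> u x * (of_nat n * e)" by (intro mult_right_mono m_le x) auto
  finally show ?thesis .
qed

text \<open>Dual to the lower bound, with m = sup u: mass at least e v is killed within n steps, so
  the remainder \<open>(T ^^ n) u\<close> is at most m (1 - e v), while the sum contributes at most
  n q. Passing to the supremum, m cancels again.\<close>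

lemma harnack_upper:
  assumes [measurable]: "u \<in> borel_measurable borel" "g \<in> borel_measurable borel" "W \<in> sets borel"
      "d \<in> borel_measurable borel"
    and eq: "\<And>x. x \<in> A \<Longrightarrow> u x = g x + T u x"
    and u1: "\<And>x. x \<in> A \<Longrightarrow> u x \<le> 1"
    and d: "\<And>x. x \<in> A \<Longrightarrow> d x + T (\<lambda>_. 1) x = 1"
    and d_ge: "\<And>x. x \<in> A \<Longrightarrow> e * indicator W x \<le> d x"
    and g: "\<And>x. x \<in> A \<Longrightarrow> g x \<le> q"
    and visit: "\<And>x. x \<in> A \<Longrightarrow> v \<le> (\<Sum>j<n. (T ^^ j) (indicator W) x)"
    and x: "x \<in> A"
  shows "u x * (e * v) \<le> of_nat n * q"
proof -
  define m where "m = (SUP x\<in>A. u x)"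
  have m_ge: "u y \<le> m" if "y \<in> A" for y unfolding m_def using that by (rule SUP_upper)
  have m1: "m \<le> 1" unfolding m_def using u1 by (rule SUP_least)
  have "u y + m * (e * v) \<le> of_nat n * q + m" if y: "y \<in> A" for y
  proof -
    have "e * v \<le> (\<Sum>j<n. (T ^^ j) d y)"
      by (rule visit_lower[OF _ d_ge visit[OF y] y]) auto
    then have "e * v + (T ^^ n) (\<lambda>_. 1) y \<le> (\<Sum>j<n. (T ^^ j) d y) + (T ^^ n) (\<lambda>_. 1) y"
      by (rule add_right_mono)
    also have "\<dots> = 1" using resolvent_iterate[OF _ _ d[symmetric] y, of n] by simp
    finally have "e * v + (T ^^ n) (\<lambda>_. 1) y \<le> 1" .
    then have 1: "m * (e * v) + m * (T ^^ n) (\<lambda>_. 1) y \<le> m"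
      using mult_left_mono[of _ 1 m] by (fastforce simp: ring_distribs)
    have "(T ^^ n) u y \<le> (T ^^ n) (\<lambda>_. m * 1) y"
      using m_ge by (intro iter_mono y) auto
    also have "\<dots> = m * (T ^^ n) (\<lambda>_. 1) y" by (subst iter_cmult) auto
    finally have 2: "(T ^^ n) u y \<le> m * (T ^^ n) (\<lambda>_. 1) y" .
    have 3: "(\<Sum>j<n. (T ^^ j) g y) \<le> of_nat n * q"
      using sum_bounded_above[of "{..<n}" "\<lambda>j. (T ^^ j) g y" q] iter_le[OF y g] by simp
    have "u y + m * (e * v) = (\<Sum>j<n. (T ^^ j) g y) + ((T ^^ n) u y + m * (e * v))"
      using resolvent_iterate[OF _ _ eq y, of n] by (simp add: add_ac)
    also have "\<dots> \<le> of_nat n * q + (m * (T ^^ n) (\<lambda>_. 1) y + m * (e * v))"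
      using 2 3 by (intro add_mono) auto
    also have "\<dots> \<le> of_nat n * q + m" using 1 by (simp add: add.commute add_left_mono)
    finally show ?thesis .
  qed
  then have "(SUP y\<in>A. u y + m * (e * v)) \<le> of_nat n * q + m" by (rule SUP_least)
  then have "m + m * (e * v) \<le> m + of_nat n * q"
    using x by (subst (asm) ennreal_SUP_add_left) (auto simp: m_def add.commute)
  then have "m * (e * v) \<le> of_nat n * q"
    using m1 by (auto simp: ennreal_add_left_cancel_le top_unique)
  then show ?thesis using mult_right_mono[OF m_ge[OF x], of "e * v"] by (auto intro: order_trans)
qed

text \<open>The function 1 - u has no source and is contracted by the factor 1 - e v over n steps,
  hence vanishes. With m = inf u this becomes the subtraction-free inequality e v + m \<le> u + m e
  v.\<close>

lemma exit_sure:
  assumes [measurable]: "u \<in> borel_measurable borel" "W \<in> sets borel" "d \<in> borel_measurable borel"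
    and eq: "\<And>x. x \<in> A \<Longrightarrow> u x = d x + T u x"
    and u1: "\<And>x. x \<in> A \<Longrightarrow> u x \<le> 1"
    and d: "\<And>x. x \<in> A \<Longrightarrow> d x + T (\<lambda>_. 1) x = 1"
    and d_ge: "\<And>x. x \<in> A \<Longrightarrow> e * indicator W x \<le> d x"
    and visit: "\<And>x. x \<in> A \<Longrightarrow> v \<le> (\<Sum>j<n. (T ^^ j) (indicator W) x)"
    and ev: "e * v \<noteq> 0" "e * v \<noteq> \<top>"
    and x: "x \<in> A"
  shows "u x = 1"
proof -
  define m where "m = (INF x\<in>A. u x)"
  have m_le: "m \<le> u y" if "y \<in> A" for y unfolding m_def using that by (rule INF_lower)
  have m1: "m \<le> 1" using m_le[OF x] u1[OF x] by simp
  have "e * v + m \<le> u y + m * (e * v)" if y: "y \<in> A" for y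
  proof -
    define s where "s = (\<Sum>j<n. (T ^^ j) d y)"
    define t where "t = (T ^^ n) (\<lambda>_. 1) y"
    have "e * v \<le> s" unfolding s_def
      by (rule visit_lower[OF _ d_ge visit[OF y] y]) auto
    then obtain s' where s': "s = e * v + s'" using le_iff_add by blast
    have st: "s + t = 1" unfolding s_def t_def using resolvent_iterate[OF _ _ d[symmetric] y, of n] by simp
    have "m * t = (T ^^ n) (\<lambda>_. m * 1) y" unfolding t_def by (subst iter_cmult) auto
    also have "\<dots> \<le> (T ^^ n) u y" using m_le by (intro iter_mono y) auto
    finally have "s + m * t \<le> u y"
      using resolvent_iterate[OF _ _ eq y, of n] by (simp add: s_def add_left_mono)
    \<comment> \<open>The unit mass splits into killed parts e v and s' and a surviving part t. Of
      its product with m, only m s' is enlarged, to s'.\<close>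
    have "e * v + m = e * v + m * (e * v + s' + t)" using st s' by simp
    also have "\<dots> \<le> e * v + (m * (e * v) + s' + m * t)"
      using mult_right_mono[OF m1, of s'] by (auto simp: ring_distribs intro!: add_mono)
    also have "\<dots> = s + m * t + m * (e * v)" by (simp add: s' add_ac)
    also have "\<dots> \<le> u y + m * (e * v)" by (intro add_right_mono) fact
    finally show ?thesis .
  qed
  then have "e * v \<le> m * (e * v)"
    using add_INF_cancel[where u=u and a="e * v", OF _ x u1[OF x] ev(2)] by (simp add: m_def)
  then have "1 * (e * v) \<le> m * (e * v)" by simp
  then have "1 \<le> m" using ev
    by (metis ennreal_mult_le_mult_iff mult.commute)
  then show ?thesis using m_le[OF x] u1[OF x] by simp
qed

end

section \<open>Exit operators of a kernel\<close>

definition step :: "('a::metric_space \<Rightarrow> ('a \<times> real) measure) \<Rightarrow> ('a \<Rightarrow> ennreal) \<Rightarrow> 'a \<Rightarrow> ennreal" where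
  "step q f y = (\<integral>\<^sup>+ z. f (fst z) \<partial>q y)"

definition killed :: "('a::metric_space \<Rightarrow> ('a \<times> real) measure) \<Rightarrow> 'a set \<Rightarrow> ('a \<Rightarrow> ennreal) \<Rightarrow> 'a \<Rightarrow> ennreal" where
  "killed q A f = step q (\<lambda>z. indicator A z * f z)"

text \<open>The expectation of \<open>f\<close> at the first time n \<ge> 1 outside
  \<open>A\<close>, split according to n. Paths that never leave contribute 0, so
  \<open>exit_op q A (\<lambda>_. 1)\<close> is the probability of leaving at all.\<close>

definition exit_op :: "('a::metric_space \<Rightarrow> ('a \<times> real) measure) \<Rightarrow> 'a set \<Rightarrow> ('a \<Rightarrow> ennreal) \<Rightarrow> 'a \<Rightarrow> ennreal" where
  "exit_op q A f x = (\<Sum>n. (killed q A ^^ n) (step q (\<lambda>z. indicator (- A) z * f z)) x)"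

lemma space_MT: "space MT = UNIV"
  by (simp add: MT_def space_pair_measure)

locale step_kernel =
  fixes q :: "'a::metric_space \<Rightarrow> ('a \<times> real) measure"
  assumes q_meas: "q \<in> borel \<rightarrow>\<^sub>M prob_algebra MT"
begin

lemma q_subprob [measurable]: "q \<in> borel \<rightarrow>\<^sub>M subprob_algebra MT"
  by (rule measurable_prob_algebraD[OF q_meas])

lemma prob_q: "prob_space (q y)" and sets_q [measurable_cong]: "sets (q y) = sets MT"
  using measurable_space[OF q_meas, of y] by (auto simp: space_prob_algebra)

lemma space_q: "space (q y) = UNIV"
  using sets_eq_imp_space_eq[OF sets_q] by (simp add: space_MT)

lemma fst_MT [measurable]: "fst \<in> MT \<rightarrow>\<^sub>M borel" and snd_MT [measurable]: "snd \<in> MT \<rightarrow>\<^sub>M borel"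
  unfolding MT_def by measurable

lemma nn_integral_q_meas:
  "F \<in> borel_measurable MT \<Longrightarrow> (\<lambda>y. \<integral>\<^sup>+ z. F z \<partial>q y) \<in> borel_measurable borel"
  by (rule measurable_compose[OF q_subprob nn_integral_measurable_subprob_algebra])

lemma step_meas [measurable]:
  assumes [measurable]: "f \<in> borel_measurable borel"
  shows "step q f \<in> borel_measurable borel"
proof -
  have "(\<lambda>y. \<integral>\<^sup>+ z. f (fst z) \<partial>q y) \<in> borel_measurable borel"
    by (rule nn_integral_q_meas) measurable
  then show ?thesis by (simp add: step_def[abs_def])
qed

lemma step_mono: "(\<And>z. f z \<le> g z) \<Longrightarrow> step q f x \<le> step q g x"
  unfolding step_def by (intro nn_integral_mono) auto

lemma step_add:
  "f \<in> borel_measurable borel \<Longrightarrow> g \<in> borel_measurable borel \<Longrightarrow>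
    step q (\<lambda>z. f z + g z) x = step q f x + step q g x"
  unfolding step_def by (intro nn_integral_add) auto

lemma step_cmult: "f \<in> borel_measurable borel \<Longrightarrow> step q (\<lambda>z. c * f z) x = c * step q f x"
  unfolding step_def by (intro nn_integral_cmult) auto

lemma step_suminf:
  "(\<And>n. f n \<in> borel_measurable borel) \<Longrightarrow> step q (\<lambda>z. \<Sum>n. f n z) x = (\<Sum>n. step q (f n) x)"
  unfolding step_def by (intro nn_integral_suminf) auto

lemma step_const: "step q (\<lambda>_. c) x = c"
  unfolding step_def using prob_space.emeasure_space_1[OF prob_q] by simp

context
  fixes A :: "'a set"
  assumes A_borel [measurable]: "A \<in> sets borel"
begin

lemma killed_positive: "positive_operator (killed q A) A"
proof
  fix f g :: "'a \<Rightarrow> ennreal" and x c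
  show "f \<in> borel_measurable borel \<Longrightarrow> killed q A f \<in> borel_measurable borel"
    unfolding killed_def by measurable
  show "killed q A (\<lambda>x. f x + g x) x = killed q A f x + killed q A g x"
    if "f \<in> borel_measurable borel" "g \<in> borel_measurable borel"
    using that unfolding killed_def by (subst step_add[symmetric]) (auto simp: ring_distribs)
  show "killed q A (\<lambda>x. c * f x) x = c * killed q A f x" if "f \<in> borel_measurable borel"
    using that unfolding killed_def by (subst step_cmult[symmetric]) (auto simp: mult_ac)
  show "killed q A f x \<le> killed q A g x" if "\<And>y. y \<in> A \<Longrightarrow> f y \<le> g y"
    unfolding killed_def by (intro step_mono) (use that in \<open>auto split: split_indicator\<close>)
qed

text \<open>With the whole space as domain, iterates can be compared at arbitrary starting points
  and not only at those in \<open>A\<close>.\<close>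

lemma killed_positive_UNIV: "positive_operator (killed q A) UNIV"
proof -
  interpret positive_operator "killed q A" A by (rule killed_positive)
  show ?thesis by unfold_locales (auto intro: T_meas T_add T_cmult T_mono)
qed

interpretation K: positive_operator "killed q A" UNIV by (rule killed_positive_UNIV)

lemma exit_op_meas [measurable]:
  assumes [measurable]: "f \<in> borel_measurable borel"
  shows "exit_op q A f \<in> borel_measurable borel"
proof -
  have [measurable]: "(killed q A ^^ n) (step q (\<lambda>z. indicator (- A) z * f z)) \<in> borel_measurable borel" for n
    by (rule K.iter_meas) measurable
  show ?thesis unfolding exit_op_def[abs_def] by measurable
qed

lemma exit_op_mono:
  assumes "\<And>z. z \<notin> A \<Longrightarrow> f z \<le> g z"
  shows "exit_op q A f x \<le> exit_op q A g x"
  unfolding exit_op_def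
  by (intro suminf_le allI K.iter_mono step_mono summableI)
    (use assms in \<open>auto split: split_indicator\<close>)

lemma exit_op_add:
  assumes [measurable]: "f \<in> borel_measurable borel" "g \<in> borel_measurable borel"
  shows "exit_op q A (\<lambda>z. f z + g z) x = exit_op q A f x + exit_op q A g x"
proof -
  have "step q (\<lambda>z. indicator (- A) z * (f z + g z)) =
      (\<lambda>x. step q (\<lambda>z. indicator (- A) z * f z) x + step q (\<lambda>z. indicator (- A) z * g z) x)"
    by (auto simp: ring_distribs step_add)
  then show ?thesis unfolding exit_op_def
    by (simp add: K.iter_add suminf_add[symmetric] summableI)
qed

lemma exit_op_cmult:
  assumes [measurable]: "f \<in> borel_measurable borel"
  shows "exit_op q A (\<lambda>z. c * f z) x = c * exit_op q A f x"
proof -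
  have "step q (\<lambda>z. indicator (- A) z * (c * f z)) =
      (\<lambda>x. c * step q (\<lambda>z. indicator (- A) z * f z) x)"
    by (subst step_cmult[symmetric]) (auto simp: mult_ac)
  then show ?thesis unfolding exit_op_def by (simp add: K.iter_cmult)
qed

lemma step_split:
  assumes [measurable]: "f \<in> borel_measurable borel"
  shows "step q f x = step q (\<lambda>z. indicator (- A) z * f z) x + killed q A f x"
proof -
  have "f = (\<lambda>z. indicator (- A) z * f z + indicator A z * f z)"
    by (auto simp: fun_eq_iff split: split_indicator)
  then have "step q f x = step q (\<lambda>z. indicator (- A) z * f z + indicator A z * f z) x"
    by (rule arg_cong)
  then show ?thesis by (simp add: killed_def step_add)
qed

text \<open>The first-step equation of the Green function of the killed chain; it serves for exit
  probabilities and for expected visit counts alike.\<close>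

lemma green_eq:
  assumes [measurable]: "g \<in> borel_measurable borel"
  shows "(\<Sum>n. (killed q A ^^ n) g x) = g x + killed q A (\<lambda>x. \<Sum>n. (killed q A ^^ n) g x) x"
proof -
  have [measurable]: "(killed q A ^^ n) g \<in> borel_measurable borel" for n
    by (rule K.iter_meas) measurable
  have suminf: "killed q A (\<lambda>x. \<Sum>n. f n x) x = (\<Sum>n. killed q A (f n) x)"
    if [measurable]: "\<And>n. f n \<in> borel_measurable borel" for f :: "nat \<Rightarrow> 'a \<Rightarrow> ennreal"
  proof -
    have "(\<lambda>z. indicator A z * (\<Sum>n. f n z)) = (\<lambda>z. \<Sum>n. indicator A z * f n z)"
      by (simp add: ennreal_suminf_cmult)
    then show ?thesis unfolding killed_def by (simp only:) (rule step_suminf, measurable)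
  qed
  have "killed q A (\<lambda>x. \<Sum>n. (killed q A ^^ n) g x) x = (\<Sum>n. killed q A ((killed q A ^^ n) g) x)"
    by (rule suminf) measurable
  then show ?thesis
    using suminf_offset[of "\<lambda>n. (killed q A ^^ n) g x" 1] by (simp add: summableI add.commute)
qed

lemma exit_op_first_step:
  assumes [measurable]: "f \<in> borel_measurable borel"
  shows "exit_op q A f x = step q (\<lambda>z. indicator (- A) z * f z) x + killed q A (exit_op q A f) x"
  unfolding exit_op_def[abs_def] by (rule green_eq) measurable

text \<open>The unit mass splits into exits within n steps and survival for n steps.\<close>

lemma exit_op_partial:
  "1 = (\<Sum>j<n. (killed q A ^^ j) (step q (\<lambda>z. indicator (- A) z * 1)) x) + (killed q A ^^ n) (\<lambda>_. 1) x"
proof (rule K.resolvent_iterate[of "\<lambda>_. 1"])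
  fix y show "1 = step q (\<lambda>z. indicator (- A) z * 1) y + killed q A (\<lambda>_. 1) y"
    using step_split[of "\<lambda>_. 1" y] by (simp only: step_const borel_measurable_const)
qed auto

lemma exit_op_le_1:
  assumes "\<And>z. z \<notin> A \<Longrightarrow> f z \<le> 1"
  shows "exit_op q A f x \<le> 1"
proof -
  have "exit_op q A f x \<le> exit_op q A (\<lambda>_. 1) x" by (rule exit_op_mono) (use assms in auto)
  also have "\<dots> \<le> 1" unfolding exit_op_def
  proof (rule suminf_le_const[OF summableI])
    fix n show "(\<Sum>j<n. (killed q A ^^ j) (step q (\<lambda>z. indicator (- A) z * 1)) x) \<le> 1"
      by (subst (2) exit_op_partial[where n=n and x=x]) simp
  qed
  finally show ?thesis .
qed

lemma survival_tendsto_0: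
  assumes "exit_op q A (\<lambda>_. 1) x = 1"
  shows "(\<lambda>n. (killed q A ^^ n) (\<lambda>_. 1) x) \<longlonglongrightarrow> 0"
proof -
  define s where "s n = (\<Sum>j<n. (killed q A ^^ j) (step q (\<lambda>z. indicator (- A) z * 1)) x)" for n
  have "s \<longlonglongrightarrow> 1"
    using summable_LIMSEQ[OF summableI, of "\<lambda>j. (killed q A ^^ j) (step q (\<lambda>z. indicator (- A) z * 1)) x"] assms
    unfolding s_def[abs_def] exit_op_def by simp
  then have "(\<lambda>n. 1 - s n) \<longlonglongrightarrow> 1 - 1" by (intro tendsto_diff_ennreal tendsto_const) auto
  moreover have "1 - s n = (killed q A ^^ n) (\<lambda>_. 1) x" for n
  proof -
    have e: "1 = s n + (killed q A ^^ n) (\<lambda>_. 1) x" unfolding s_def by (rule exit_op_partial)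
    then have "s n \<noteq> \<top>" by (intro notI) simp
    then show ?thesis by (subst e) simp
  qed
  ultimately show ?thesis by simp
qed

end

text \<open>Leaving \<open>A'\<close> requires leaving \<open>A\<close> first, and from a point of
  \<open>A'\<close> reached then the exit from \<open>A'\<close> starts afresh. Analytically,
  \<open>exit_op q A' f\<close> solves the first-step equation of \<open>A\<close> with boundary
  values \<open>\<phi>\<close>; the remainder of its iteration is dominated by the survival
  probability, which tends to 0 because exit from \<open>A\<close> is sure.\<close>

lemma exit_op_strong_markov:
  assumes [measurable]: "A \<in> sets borel" "A' \<in> sets borel" "f \<in> borel_measurable borel" and sub: "A \<subseteq> A'"
    and f1: "\<And>z. f z \<le> 1"
    and sure: "exit_op q A (\<lambda>_. 1) x = 1"
  shows "exit_op q A' f x = exit_op q A (\<lambda>z. indicator (- A') z * f z) x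
    + exit_op q A (\<lambda>z. indicator A' z * exit_op q A' f z) x"
proof -
  interpret K: positive_operator "killed q A" UNIV by (rule killed_positive_UNIV) measurable
  define u where "u = exit_op q A' f"
  have [measurable]: "u \<in> borel_measurable borel" unfolding u_def by measurable
  have u1: "u z \<le> 1" for z unfolding u_def by (rule exit_op_le_1) (auto intro: f1)
  define \<phi> where "\<phi> z = indicator (- A') z * f z + indicator A' z * u z" for z
  have [measurable]: "\<phi> \<in> borel_measurable borel" unfolding \<phi>_def[abs_def] by measurable
  define g where "g = step q (\<lambda>z. indicator (- A) z * \<phi> z)"
  have [measurable]: "g \<in> borel_measurable borel" unfolding g_def by measurable
  have first: "u y = g y + killed q A u y" for y
  proof -
    have "u y = step q \<phi> y"
      unfolding u_def by (subst exit_op_first_step) (auto simp: \<phi>_def[abs_def] step_add killed_def u_def)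
    also have "\<dots> = g y + killed q A \<phi> y" unfolding g_def by (rule step_split) measurable
    also have "killed q A \<phi> = killed q A u"
    proof -
      interpret K': positive_operator "killed q A" A by (rule killed_positive) measurable
      show ?thesis by (rule K'.T_cong) (use sub in \<open>auto simp: \<phi>_def\<close>)
    qed
    finally show ?thesis .
  qed
  have it: "u x = (\<Sum>j<n. (killed q A ^^ j) g x) + (killed q A ^^ n) u x" for n
    by (rule K.resolvent_iterate) (measurable, rule first, simp)
  have exit: "exit_op q A \<phi> x = (\<Sum>j. (killed q A ^^ j) g x)" by (simp add: exit_op_def g_def)
  have "(\<lambda>n. (\<Sum>j<n. (killed q A ^^ j) g x) + (killed q A ^^ n) u x) \<longlonglongrightarrow> exit_op q A \<phi> x + 0"
  proof (rule tendsto_add)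
    show "(\<lambda>n. \<Sum>j<n. (killed q A ^^ j) g x) \<longlonglongrightarrow> exit_op q A \<phi> x"
      unfolding exit by (intro summable_LIMSEQ summableI)
    have surv: "(\<lambda>n. (killed q A ^^ n) (\<lambda>_. 1) x) \<longlonglongrightarrow> 0" by (rule survival_tendsto_0) (use sure in auto)
    show "(\<lambda>n. (killed q A ^^ n) u x) \<longlonglongrightarrow> 0"
      by (rule tendsto_sandwich[OF _ _ tendsto_const surv])
        (auto intro!: always_eventually K.iter_mono u1)
  qed
  then have "exit_op q A \<phi> x = u x"
    unfolding it[symmetric] by (simp add: LIMSEQ_const_iff)
  then show ?thesis
    unfolding \<phi>_def[abs_def] by (subst (asm) exit_op_add) (auto simp: u_def)
qed

end

section \<open>Merging cells\<close>

lemma indicator_ennreal_le_1: "(indicator S x :: ennreal) \<le> 1"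
  by (simp split: split_indicator)

text \<open>The state space is cut into cells \<open>D K\<close>, and \<open>p K L\<close> is, up to constant factors, the probability
  that the process leaves \<open>D K\<close> into \<open>D L\<close>. The cells in \<open>E\<close> are merged; they communicate through
  transitions in \<open>F\<close>, whose probabilities are bounded below.\<close>
locale merge_cells = step_kernel q for q :: "'a::metric_space \<Rightarrow> ('a \<times> real) measure" +
  fixes C :: "'i set" and D :: "'i \<Rightarrow> 'a set" and p :: "'i \<Rightarrow> 'i \<Rightarrow> ennreal"
    and c c' \<delta> :: ennreal and E :: "'i set" and F :: "('i \<times> 'i) set" and n :: nat
  assumes C_fin: "finite C"
    and D_borel: "\<And>K. K \<in> C \<Longrightarrow> D K \<in> sets borel"
    and D_disj: "\<And>K L. K \<in> C \<Longrightarrow> L \<in> C \<Longrightarrow> K \<noteq> L \<Longrightarrow> D K \<inter> D L = {}"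
    and D_cover: "(\<Union>K\<in>C. D K) = UNIV"
    and exits: "\<And>K x. K \<in> C \<Longrightarrow> x \<in> D K \<Longrightarrow> exit_op q (D K) (\<lambda>_. 1) x = 1"
    and lower: "\<And>K L x. K \<in> C \<Longrightarrow> L \<in> C \<Longrightarrow> K \<noteq> L \<Longrightarrow> x \<in> D K \<Longrightarrow>
                  c * p K L \<le> exit_op q (D K) (indicator (D L)) x"
    and upper: "\<And>K L x. K \<in> C \<Longrightarrow> L \<in> C \<Longrightarrow> K \<noteq> L \<Longrightarrow> x \<in> D K \<Longrightarrow>
                  exit_op q (D K) (indicator (D L)) x \<le> c' * p K L"
    and E_sub: "E \<subseteq> C"
    and F: "\<And>K L. (K, L) \<in> F \<Longrightarrow> K \<in> E \<and> L \<in> E \<and> K \<noteq> L \<and> \<delta> \<le> p K L"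
    and path: "\<And>K L. K \<in> E \<Longrightarrow> L \<in> E \<Longrightarrow> \<exists>j<n. (K, L) \<in> F ^^ j"
    and c_le: "c \<le> 1" and \<delta>_le: "\<delta> \<le> 1"
    and p_fin: "\<And>K L. K \<in> C \<Longrightarrow> L \<in> C \<Longrightarrow> p K L \<noteq> \<top>"
begin

abbreviation (input) "A \<equiv> \<Union>K\<in>E. D K"

lemma E_fin: "finite E" using C_fin E_sub finite_subset by blast

lemma DE_borel [measurable]: "K \<in> E \<Longrightarrow> D K \<in> sets borel" using D_borel E_sub by blast

lemma UN_borel [measurable]: "E' \<subseteq> C \<Longrightarrow> (\<Union>K\<in>E'. D K) \<in> sets borel"
  using D_borel finite_subset[OF _ C_fin] by (intro sets.finite_UN) auto

lemma A_borel [measurable]: "A \<in> sets borel" using E_sub by (rule UN_borel)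

lemma D_unique: "K \<in> C \<Longrightarrow> L \<in> C \<Longrightarrow> x \<in> D K \<Longrightarrow> x \<in> D L \<longleftrightarrow> L = K"
  using D_disj by blast

text \<open>One step of the chain observed only when it changes cells, started in \<open>A\<close>.
  The sum over cells keeps it measurable in the starting point.\<close>

definition R :: "('a \<Rightarrow> ennreal) \<Rightarrow> 'a \<Rightarrow> ennreal" where
  "R f x = (\<Sum>K\<in>E. indicator (D K) x * exit_op q (D K) f x)"

definition T :: "('a \<Rightarrow> ennreal) \<Rightarrow> 'a \<Rightarrow> ennreal" where
  "T f = R (\<lambda>z. indicator A z * f z)"

lemma R_eq: "K \<in> E \<Longrightarrow> x \<in> D K \<Longrightarrow> R f x = exit_op q (D K) f x"
proof -
  assume K: "K \<in> E" "x \<in> D K"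
  have "R f x = (\<Sum>L\<in>E. if L = K then exit_op q (D K) f x else 0)"
    unfolding R_def using K D_unique[of K _ x] E_sub
    by (intro sum.cong) (auto split: split_indicator)
  then show ?thesis using K E_fin by simp
qed

lemma R_meas [measurable]:
  assumes [measurable]: "f \<in> borel_measurable borel"
  shows "R f \<in> borel_measurable borel"
proof -
  have "(\<lambda>x. indicator (D K) x * exit_op q (D K) f x) \<in> borel_measurable borel" if "K \<in> E" for K
  proof -
    have [measurable]: "D K \<in> sets borel" using that by (rule DE_borel)
    show ?thesis by measurable
  qed
  then show ?thesis unfolding R_def[abs_def] by (rule borel_measurable_sum)
qed

lemma R_add:
  assumes [measurable]: "f \<in> borel_measurable borel" "g \<in> borel_measurable borel"
  shows "R (\<lambda>z. f z + g z) x = R f x + R g x"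
  unfolding R_def sum.distrib[symmetric]
  by (intro sum.cong refl) (simp add: exit_op_add DE_borel ring_distribs)

lemma R_cmult:
  assumes [measurable]: "f \<in> borel_measurable borel"
  shows "R (\<lambda>z. k * f z) x = k * R f x"
  unfolding R_def sum_distrib_left
  by (intro sum.cong refl) (subst exit_op_cmult, auto simp: mult_ac)

lemma R_mono: "(\<And>z. f z \<le> g z) \<Longrightarrow> R f x \<le> R g x"
  unfolding R_def by (intro sum_mono mult_left_mono exit_op_mono DE_borel) auto

lemma R_sum:
  assumes "finite I" "\<And>i. i \<in> I \<Longrightarrow> f i \<in> borel_measurable borel"
  shows "R (\<lambda>z. \<Sum>i\<in>I. f i z) x = (\<Sum>i\<in>I. R (f i) x)"
  using assms
proof (induction I rule: finite_induct)
  case empty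
  then show ?case using R_cmult[of "\<lambda>_. 0" 0 x] by simp
next
  case (insert i I)
  then show ?case by (simp add: R_add borel_measurable_sum)
qed

lemma R_UN:
  assumes "E' \<subseteq> C"
  shows "R (indicator (\<Union>L\<in>E'. D L)) x = (\<Sum>L\<in>E'. R (indicator (D L)) x)"
proof -
  have fin: "finite E'" using assms C_fin finite_subset by blast
  have "indicator (\<Union>L\<in>E'. D L) = (\<lambda>z. \<Sum>L\<in>E'. indicator (D L) z :: ennreal)"
    using assms D_disj by (intro ext indicator_UN_disjoint[OF fin]) (auto simp: disjoint_family_on_def)
  then have "R (indicator (\<Union>L\<in>E'. D L)) x = R (\<lambda>z. \<Sum>L\<in>E'. indicator (D L) z) x"
    by (rule arg_cong)
  also have "\<dots> = (\<Sum>L\<in>E'. R (indicator (D L)) x)"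
    using D_borel assms by (intro R_sum[OF fin] borel_measurable_indicator) auto
  finally show ?thesis .
qed

lemma R_one: "x \<in> A \<Longrightarrow> R (\<lambda>_. 1) x = 1"
proof -
  assume "x \<in> A"
  then obtain K where K: "K \<in> E" "x \<in> D K" by auto
  then show ?thesis using exits[of K x] E_sub by (auto simp: R_eq[OF K])
qed

text \<open>The Harnack inequalities are applied to the chain of cell exits and not to the original
  kernel, because it is between cells that transition probabilities have lower bounds.\<close>

sublocale sub_markov_operator T A
proof
  fix f g :: "'a \<Rightarrow> ennreal" and x k
  show "T f \<in> borel_measurable borel" if [measurable]: "f \<in> borel_measurable borel"
    unfolding T_def by measurable
  show "T (\<lambda>x. f x + g x) x = T f x + T g x"
    if [measurable]: "f \<in> borel_measurable borel" "g \<in> borel_measurable borel"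
    unfolding T_def by (simp add: ring_distribs R_add)
  show "T (\<lambda>x. k * f x) x = k * T f x" if [measurable]: "f \<in> borel_measurable borel"
    unfolding T_def by (subst R_cmult[symmetric]) (auto simp: mult_ac)
  show "T f x \<le> T g x" if "\<And>y. y \<in> A \<Longrightarrow> f y \<le> g y"
    unfolding T_def by (intro R_mono) (use that in \<open>auto split: split_indicator\<close>)
  show "T (\<lambda>_. 1) x \<le> 1" if "x \<in> A"
  proof -
    have "T (\<lambda>_. 1) x \<le> R (\<lambda>_. 1) x"
      unfolding T_def by (intro R_mono) (auto split: split_indicator)
    then show ?thesis using R_one[OF that] by simp
  qed
qed

text \<open>Multiply along the path: each of its j transitions has probability at least
  \<open>c * \<delta>\<close>, from whatever point of the cell it starts.\<close>

lemma visit_iter: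
  assumes "(K, L) \<in> F ^^ j" "K \<in> E" "x \<in> D K"
  shows "(c * \<delta>) ^ j \<le> (T ^^ j) (indicator (D L)) x"
  using assms
proof (induction j arbitrary: K x)
  case 0
  then show ?case by simp
next
  case (Suc j)
  then obtain K1 where K1: "(K, K1) \<in> F" "(K1, L) \<in> F ^^ j" by (meson relpow_Suc_D2)
  note F1 = F[OF K1(1)]
  have [measurable]: "D K1 \<in> sets borel" using F1 by auto
  have "(c * \<delta>) ^ Suc j \<le> (c * \<delta>) ^ j * (c * p K K1)"
    unfolding power_Suc2 using F1 by (intro mult_left_mono) auto
  also have "\<dots> \<le> (c * \<delta>) ^ j * exit_op q (D K) (indicator (D K1)) x"
    using F1 Suc.prems E_sub by (intro mult_left_mono lower) auto
  also have "\<dots> = R (\<lambda>z. (c * \<delta>) ^ j * indicator (D K1) z) x"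
    by (simp add: R_cmult R_eq[OF Suc.prems(2,3), symmetric])
  also have "\<dots> \<le> T ((T ^^ j) (indicator (D L))) x"
    unfolding T_def[of "(T ^^ j) _"] using Suc.IH[OF K1(2)] F1
    by (intro R_mono) (auto split: split_indicator)
  finally show ?case by simp
qed

lemma visit:
  assumes "L \<in> E" "x \<in> A"
  shows "(c * \<delta>) ^ n \<le> (\<Sum>j<n. (T ^^ j) (indicator (D L)) x)"
proof -
  obtain K where K: "K \<in> E" "x \<in> D K" using assms by auto
  obtain j where j: "j < n" "(K, L) \<in> F ^^ j" using path K assms by blast
  have "c * \<delta> \<le> 1" using mult_mono[OF c_le \<delta>_le] by simp
  \<comment> \<open>The exponent is weakened from the length of the path to \<open>n\<close>, common
    to all pairs of cells.\<close>
  then have "(c * \<delta>) ^ n \<le> (c * \<delta>) ^ j" using j by (intro power_decreasing) auto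
  also have "\<dots> \<le> (T ^^ j) (indicator (D L)) x" using visit_iter[OF j(2) K] .
  also have "\<dots> \<le> (\<Sum>j<n. (T ^^ j) (indicator (D L)) x)"
    using j by (intro member_le_sum) auto
  finally show ?thesis .
qed

lemma visit_const_finite: "(c * \<delta>) ^ n \<noteq> \<top>"
proof -
  have "c * \<delta> \<le> 1" using mult_mono[OF c_le \<delta>_le] by simp
  then have "(c * \<delta>) ^ n \<le> 1" by (rule power_le_one[rotated]) simp
  then show ?thesis by (auto simp: top_unique)
qed

lemma R_bounds:
  assumes "E' \<subseteq> C" "E' \<inter> E = {}" "K \<in> E" "x \<in> D K"
  shows "c * (\<Sum>L\<in>E'. p K L) \<le> R (indicator (\<Union>L\<in>E'. D L)) x"
    and "R (indicator (\<Union>L\<in>E'. D L)) x \<le> c' * (\<Sum>L\<in>E'. p K L)"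
proof -
  have "K \<in> C" using assms E_sub by auto
  moreover have "K \<noteq> L" if "L \<in> E'" for L using that assms by auto
  moreover have "R (indicator (\<Union>L\<in>E'. D L)) x = (\<Sum>L\<in>E'. exit_op q (D K) (indicator (D L)) x)"
    unfolding R_eq[OF assms(3,4), symmetric] by (rule R_UN[OF assms(1)])
  ultimately show "c * (\<Sum>L\<in>E'. p K L) \<le> R (indicator (\<Union>L\<in>E'. D L)) x"
    "R (indicator (\<Union>L\<in>E'. D L)) x \<le> c' * (\<Sum>L\<in>E'. p K L)"
    using assms by (auto simp: sum_distrib_left intro!: sum_mono lower upper)
qed

text \<open>The strong Markov property at the first exit from the cell that contains
  \<open>x\<close>.\<close>

lemma exit_eq:
  assumes [measurable]: "f \<in> borel_measurable borel" and f1: "\<And>z. f z \<le> 1" and x: "x \<in> A"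
  shows "exit_op q A f x = R (\<lambda>z. indicator (- A) z * f z) x + T (exit_op q A f) x"
proof -
  obtain K where K: "K \<in> E" "x \<in> D K" using x by auto
  have "exit_op q (D K) (\<lambda>_. 1) x = 1" using exits K E_sub by auto
  then have "exit_op q A f x = exit_op q (D K) (\<lambda>z. indicator (- A) z * f z) x
      + exit_op q (D K) (\<lambda>z. indicator A z * exit_op q A f z) x"
    using K by (intro exit_op_strong_markov f1) auto
  then show ?thesis unfolding T_def using R_eq[OF K] by simp
qed

text \<open>The escape flux of the merged cells without invariant weights; weighting changes it only
  by bounded factors.\<close>

definition esc :: ennreal where "esc = (\<Sum>K\<in>E. \<Sum>L\<in>C - E. p K L)"

lemma R_split: "x \<in> A \<Longrightarrow> R (indicator (\<Union>L\<in>C - E. D L)) x + T (\<lambda>_. 1) x = 1"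
proof -
  assume x: "x \<in> A"
  have [measurable]: "(\<Union>L\<in>C - E. D L) \<in> sets borel" by (rule UN_borel) auto
  have "(\<lambda>_. 1 :: ennreal) = (\<lambda>z. indicator (\<Union>L\<in>C - E. D L) z + indicator A z * 1)"
  proof
    fix z
    obtain K where "K \<in> C" "z \<in> D K" using D_cover by blast
    then show "1 = indicator (\<Union>L\<in>C - E. D L) z + indicator A z * (1::ennreal)"
      using D_unique[of K _ z] E_sub by (cases "K \<in> E") (auto split: split_indicator)
  qed
  then have "R (\<lambda>_. 1) x = R (\<lambda>z. indicator (\<Union>L\<in>C - E. D L) z + indicator A z * 1) x"
    by (rule arg_cong)
  then show ?thesis unfolding T_def using R_one[OF x] by (simp add: R_add)
qed

lemma outside: "(\<Union>L\<in>C - E. D L) = - A"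
proof (intro set_eqI)
  fix z
  obtain K where "K \<in> C" "z \<in> D K" using D_cover by blast
  then show "z \<in> (\<Union>L\<in>C - E. D L) \<longleftrightarrow> z \<in> - A"
    using D_unique[of K _ z] E_sub by (cases "K \<in> E") auto
qed

text \<open>One cell with a positive escape rate suffices, because \<open>visit\<close> brings every
  starting point to it.\<close>

lemma exits_merged:
  assumes K: "K \<in> E" and pos: "c * (\<Sum>L\<in>C - E. p K L) * (c * \<delta>) ^ n \<noteq> 0" and x: "x \<in> A"
  shows "exit_op q A (\<lambda>_. 1) x = 1"
proof (rule exit_sure[where W="D K" and d="R (indicator (\<Union>L\<in>C - E. D L))" and e="c * (\<Sum>L\<in>C - E. p K L)"
      and v="(c * \<delta>) ^ n" and n=n])
  have [measurable]: "(\<Union>L\<in>C - E. D L) \<in> sets borel" by (rule UN_borel) auto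
  show "R (indicator (\<Union>L\<in>C - E. D L)) \<in> borel_measurable borel" by measurable
  show "exit_op q A (\<lambda>_. 1) y = R (indicator (\<Union>L\<in>C - E. D L)) y + T (exit_op q A (\<lambda>_. 1)) y" if "y \<in> A" for y
    using exit_eq[of "\<lambda>_. 1" y] that unfolding outside by simp
  show "c * (\<Sum>L\<in>C - E. p K L) * indicator (D K) y \<le> R (indicator (\<Union>L\<in>C - E. D L)) y" for y
    using R_bounds(1)[of "C - E" K y] K by (auto split: split_indicator)
  have "(\<Sum>L\<in>C - E. p K L) \<noteq> \<top>" using p_fin K E_sub C_fin by auto
  then show "c * (\<Sum>L\<in>C - E. p K L) * (c * \<delta>) ^ n \<noteq> \<top>"
    using c_le visit_const_finite by (auto simp: ennreal_mult_eq_top_iff top_unique)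
qed (rule visit[OF K] R_split x pos exit_op_le_1 DE_borel[OF K] A_borel order_refl exit_op_meas borel_measurable_const | assumption)+

text \<open>Each Harnack inequality is run once per cell \<open>K\<close>, with
  \<open>W = D K\<close> and counting only the flux that \<open>K\<close> itself sends to
  \<open>E'\<close> or out of \<open>E\<close>. Adding over \<open>K\<close> yields total fluxes and
  the factor \<open>card E\<close>. Together the bounds say that u is, up to constants, the flux to
  \<open>E'\<close> over the escape flux, written without division.\<close>

lemma merged_bounds:
  assumes E': "E' \<subseteq> C" "E' \<inter> E = {}" and x: "x \<in> A"
  defines "u \<equiv> exit_op q A (indicator (\<Union>L\<in>E'. D L)) x"
  shows "c * (\<Sum>K\<in>E. \<Sum>L\<in>E'. p K L) * (c * \<delta>) ^ n \<le> of_nat (card E * n) * c' * (u * esc)"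
    and "c * (u * esc) * (c * \<delta>) ^ n \<le> of_nat (card E * n) * c' * (\<Sum>K\<in>E. \<Sum>L\<in>E'. p K L)"
proof -
  have B [measurable]: "(\<Union>L\<in>E'. D L) \<in> sets borel" using E'(1) by (rule UN_borel)
  have BC [measurable]: "(\<Union>L\<in>C - E. D L) \<in> sets borel" by (rule UN_borel) auto
  define U where "U = exit_op q A (indicator (\<Union>L\<in>E'. D L))"
  define g where "g = R (indicator (\<Union>L\<in>E'. D L))"
  have Ug: "U \<in> borel_measurable borel" "g \<in> borel_measurable borel"
    unfolding U_def g_def by measurable
  have sub: "(\<Union>L\<in>E'. D L) \<subseteq> - A" unfolding outside[symmetric] using E' by auto
  have eq: "U y = g y + T U y" if "y \<in> A" for y
  proof -
    have "(\<lambda>z. indicator (- A) z * indicator (\<Union>L\<in>E'. D L) z :: ennreal) = indicator (\<Union>L\<in>E'. D L)"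
      using sub by (intro ext) (auto split: split_indicator)
    then show ?thesis
      using exit_eq[of "indicator (\<Union>L\<in>E'. D L)" y] that unfolding U_def g_def by (simp only: B borel_measurable_indicator indicator_ennreal_le_1)
  qed
  have U1: "U y \<le> 1" for y unfolding U_def by (rule exit_op_le_1) (auto simp: indicator_ennreal_le_1)
  have esc_ge: "(\<Sum>L\<in>C - E. p K L) \<le> esc" if "K \<in> E" for K
    unfolding esc_def using that E_fin by (intro member_le_sum) auto
  define qs where "qs = (\<Sum>K\<in>E. \<Sum>L\<in>E'. p K L)"
  have qs_ge: "(\<Sum>L\<in>E'. p K L) \<le> qs" if "K \<in> E" for K
    unfolding qs_def using that E_fin by (intro member_le_sum) auto
  have low: "c * (\<Sum>L\<in>E'. p K L) * (c * \<delta>) ^ n \<le> u * (of_nat n * (c' * esc))" if K: "K \<in> E" for K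
    unfolding u_def U_def[symmetric]
  proof (rule harnack_lower[where u=U and g=g and W="D K"])
    \<comment> \<open>Mass is lost only by leaving the merged set, which has probability at most
      \<open>c' * esc\<close> from any of its cells.\<close>
    show "1 \<le> T (\<lambda>_. 1) y + c' * esc" if y: "y \<in> A" for y
    proof -
      obtain K' where K': "K' \<in> E" "y \<in> D K'" using y by auto
      have "R (indicator (\<Union>L\<in>C - E. D L)) y \<le> c' * (\<Sum>L\<in>C - E. p K' L)"
        using K' by (intro R_bounds) auto
      also have "\<dots> \<le> c' * esc" using esc_ge[OF K'(1)] by (rule mult_left_mono) simp
      finally show ?thesis by (subst R_split[OF y, symmetric]) (simp add: add.commute add_mono)
    qed
    show "c * (\<Sum>L\<in>E'. p K L) * indicator (D K) y \<le> g y" for y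
      unfolding g_def using R_bounds(1)[OF E' K, of y] by (auto split: split_indicator)
    have "(\<Sum>L\<in>E'. p K L) \<noteq> \<top>"
      using p_fin K E_sub E'(1) finite_subset[OF E'(1) C_fin] by auto
    then show "c * (\<Sum>L\<in>E'. p K L) * (c * \<delta>) ^ n \<noteq> \<top>"
      using c_le visit_const_finite by (auto simp: ennreal_mult_eq_top_iff top_unique)
  qed (rule visit[OF K] eq U1 x DE_borel[OF K] Ug | assumption)+
  have up: "u * (c * (\<Sum>L\<in>C - E. p K L) * (c * \<delta>) ^ n) \<le> of_nat n * (c' * qs)" if K: "K \<in> E" for K
    unfolding u_def U_def[symmetric]
  proof (rule harnack_upper[where u=U and g=g and W="D K" and d="R (indicator (\<Union>L\<in>C - E. D L))"])
    show "R (indicator (\<Union>L\<in>C - E. D L)) \<in> borel_measurable borel" by measurable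
    show "c * (\<Sum>L\<in>C - E. p K L) * indicator (D K) y \<le> R (indicator (\<Union>L\<in>C - E. D L)) y" for y
      using R_bounds(1)[of "C - E" K y] K by (auto split: split_indicator)
    show "g y \<le> c' * qs" if y: "y \<in> A" for y
    proof -
      obtain K' where K': "K' \<in> E" "y \<in> D K'" using y by auto
      have "g y \<le> c' * (\<Sum>L\<in>E'. p K' L)"
        unfolding g_def using K' E' by (intro R_bounds) auto
      also have "\<dots> \<le> c' * qs" using qs_ge[OF K'(1)] by (rule mult_left_mono) simp
      finally show ?thesis .
    qed
  qed (rule visit[OF K] eq U1 x DE_borel[OF K] Ug R_split | assumption)+
  have "(\<Sum>K\<in>E. c * (\<Sum>L\<in>E'. p K L) * (c * \<delta>) ^ n) \<le> of_nat (card E) * (u * (of_nat n * (c' * esc)))"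
    using low by (intro sum_bounded_above) auto
  then show "c * (\<Sum>K\<in>E. \<Sum>L\<in>E'. p K L) * (c * \<delta>) ^ n \<le> of_nat (card E * n) * c' * (u * esc)"
    by (simp add: sum_distrib_left sum_distrib_right mult_ac)
  have "(\<Sum>K\<in>E. u * (c * (\<Sum>L\<in>C - E. p K L) * (c * \<delta>) ^ n)) \<le> of_nat (card E) * (of_nat n * (c' * qs))"
    using up by (intro sum_bounded_above) auto
  then show "c * (u * esc) * (c * \<delta>) ^ n \<le> of_nat (card E * n) * c' * (\<Sum>K\<in>E. \<Sum>L\<in>E'. p K L)"
    by (simp add: esc_def qs_def sum_distrib_left sum_distrib_right mult_ac)
qed

end

section \<open>The hierarchy of clusters\<close>

locale renewal_hierarchy =
  fixes M :: nat
    and S :: "nat \<Rightarrow> 'a::metric_space set"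
    and Q :: "real \<Rightarrow> 'a \<Rightarrow> ('a \<times> real) measure"
    and Pm :: "real \<Rightarrow> nat \<Rightarrow> nat \<Rightarrow> real"
    and tau :: "real \<Rightarrow> nat \<Rightarrow> real"
  assumes M_pos: "0 < M"
    and S_borel: "\<forall>i<M. S i \<in> sets borel"
    and S_disj: "\<forall>i<M. \<forall>j<M. i \<noteq> j \<longrightarrow> S i \<inter> S j = {}"
    and S_cover: "(\<Union>i<M. S i) = UNIV"
    and kernel: "\<forall>\<epsilon>>0. renewal_kernel (Q \<epsilon>)"
    and a_diag: "\<forall>\<epsilon>>0. \<forall>i<M. \<forall>x\<in>S i. Pk (Q \<epsilon> x) (S i) = 0"
    and a_offdiag: "\<forall>i<M. \<forall>j<M. i \<noteq> j \<longrightarrow>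
        ((\<forall>\<epsilon>>0. Pm \<epsilon> i j = 0 \<and> (\<forall>x\<in>S i. Pk (Q \<epsilon> x) (S j) = 0)) \<or>
         ((\<forall>\<epsilon>>0. 0 < Pm \<epsilon> i j) \<and>
          (\<forall>e>0. \<forall>\<^sub>F \<epsilon> in at_right 0. \<forall>x\<in>S i. \<bar>Pk (Q \<epsilon> x) (S j) / Pm \<epsilon> i j - 1\<bar> < e)))"
    and a_sum: "\<forall>\<epsilon>>0. \<forall>i<M. (\<Sum>j\<in>{..<M} - {i}. Pm \<epsilon> i j) = 1"
    and a_comm: "\<forall>i<M. \<forall>j<M. (i, j) \<in> {(i, j). i < M \<and> j < M \<and> i \<noteq> j \<and> (\<exists>\<epsilon>>0. Pm \<epsilon> i j \<noteq> 0)}\<^sup>*"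
    and b_pos: "\<forall>\<epsilon>>0. \<forall>i<M. 0 < tau \<epsilon> i"
    and b_mean: "\<forall>i<M. \<forall>j<M. i \<noteq> j \<and> (\<exists>\<epsilon>>0. Pm \<epsilon> i j \<noteq> 0) \<longrightarrow>
        (\<forall>e>0. \<forall>\<^sub>F \<epsilon> in at_right 0. \<forall>x\<in>S i.
           cmom (Q \<epsilon> x) (S j) 1 < \<top> \<and> \<bar>enn2real (cmom (Q \<epsilon> x) (S j) 1) / tau \<epsilon> i - 1\<bar> < e)"
    and c_var: "\<exists>C \<epsilon>0. 0 < \<epsilon>0 \<and> (\<forall>\<epsilon>. 0 < \<epsilon> \<and> \<epsilon> \<le> \<epsilon>0 \<longrightarrow>
        (\<forall>i<M. \<forall>j<M. i \<noteq> j \<and> (\<exists>\<epsilon>'>0. Pm \<epsilon>' i j \<noteq> 0) \<longrightarrow> (\<forall>x\<in>S i.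
           cmom (Q \<epsilon> x) (S j) 2 < \<top> \<and>
           enn2real (cmom (Q \<epsilon> x) (S j) 2) - (enn2real (cmom (Q \<epsilon> x) (S j) 1))\<^sup>2 \<le> C * (tau \<epsilon> i)\<^sup>2)))"
    and f_lim: "\<forall>n (a::nat \<Rightarrow> nat) (b::nat \<Rightarrow> nat) (d::nat \<Rightarrow> nat) ia ic.
        (\<forall>k\<in>{1..n}. a k < M \<and> b k < M \<and> d k < M \<and> a k \<noteq> b k \<and> a k \<noteq> d k \<and>
                    (\<exists>\<epsilon>>0. Pm \<epsilon> (a k) (d k) \<noteq> 0)) \<and> ia < M \<and> ic < M \<longrightarrow>
        (\<exists>L::ereal. 0 \<le> L \<and>
           ((\<lambda>\<epsilon>. ereal ((\<Prod>k=1..n. Pm \<epsilon> (a k) (b k) / Pm \<epsilon> (a k) (d k)) * tau \<epsilon> ia / tau \<epsilon> ic))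
              \<longlongrightarrow> L) (at_right 0))"
begin

lemma step_kernel_Q: "0 < \<epsilon> \<Longrightarrow> step_kernel (Q \<epsilon>)"
  using kernel by unfold_locales (auto simp: renewal_kernel_def)

text \<open>Independent of the parameter: by (a) an off-diagonal entry vanishes for all \<epsilon>
  or for none.\<close>

definition link :: "nat \<Rightarrow> nat \<Rightarrow> bool" where
  "link i j \<longleftrightarrow> i < M \<and> j < M \<and> i \<noteq> j \<and> (\<exists>\<epsilon>>0. Pm \<epsilon> i j \<noteq> 0)"

lemma link_pos: "link i j \<Longrightarrow> 0 < \<epsilon> \<Longrightarrow> 0 < Pm \<epsilon> i j"
proof -
  assume l: "link i j" and e: "0 < \<epsilon>"
  then have "(\<forall>\<epsilon>>0. Pm \<epsilon> i j = 0) \<or> (\<forall>\<epsilon>>0. 0 < Pm \<epsilon> i j)"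
    using a_offdiag unfolding link_def by blast
  with l e show ?thesis unfolding link_def by blast
qed

lemma not_link: "i < M \<Longrightarrow> j < M \<Longrightarrow> i \<noteq> j \<Longrightarrow> \<not> link i j \<Longrightarrow> 0 < \<epsilon> \<Longrightarrow> Pm \<epsilon> i j = 0"
  unfolding link_def by blast

definition ratio_product :: "(nat \<times> nat \<times> nat) list \<Rightarrow> real \<Rightarrow> real" where
  "ratio_product xs \<epsilon> = prod_list (map (\<lambda>(a, b, d). Pm \<epsilon> a b / Pm \<epsilon> a d) xs)"

text \<open>Both links are required, whereas (f) also admits vanishing numerators. This makes the
  products positive and lets inversion exchange \<open>b\<close> and \<open>d\<close>.\<close>

definition ratio_products :: "(real \<Rightarrow> real) set" where
  "ratio_products = ratio_product ` {xs. \<forall>(a, b, d) \<in> set xs. link a b \<and> link a d}"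

sublocale limit_group ratio_products
proof
  fix m m' :: "real \<Rightarrow> real"
  assume "m \<in> ratio_products"
  then obtain xs where xs: "\<And>a b d. (a, b, d) \<in> set xs \<Longrightarrow> link a b \<and> link a d" and m: "m = ratio_product xs"
    unfolding ratio_products_def by blast
  show "0 < m \<epsilon>" if "0 < \<epsilon>" for \<epsilon>
  proof -
    have "\<forall>z\<in>set xs. case z of (a, b, d) \<Rightarrow> link a b \<and> link a d" using xs by auto
    then show ?thesis unfolding m ratio_product_def
      by (induction xs) (auto intro!: mult_pos_pos divide_pos_pos link_pos that)
  qed
  show "(\<lambda>\<epsilon>. m \<epsilon> * m' \<epsilon>) \<in> ratio_products" if "m' \<in> ratio_products"
  proof -
    obtain ys where "\<And>a b d. (a, b, d) \<in> set ys \<Longrightarrow> link a b \<and> link a d" "m' = ratio_product ys"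
      using \<open>m' \<in> ratio_products\<close> unfolding ratio_products_def by blast
    then show ?thesis using xs m unfolding ratio_products_def
      by (intro image_eqI[of _ _ "xs @ ys"]) (auto simp: ratio_product_def)
  qed
  show "(\<lambda>\<epsilon>. inverse (m \<epsilon>)) \<in> ratio_products"
    unfolding ratio_products_def
  proof (rule image_eqI)
    show "(\<lambda>\<epsilon>. inverse (m \<epsilon>)) = ratio_product (map (\<lambda>(a, b, d). (a, d, b)) xs)"
    proof
      show "inverse (m \<epsilon>) = ratio_product (map (\<lambda>(a, b, d). (a, d, b)) xs) \<epsilon>" for \<epsilon>
        unfolding m ratio_product_def by (induction xs) auto
    qed
  qed (use xs in auto)
  show "\<exists>l. ((\<lambda>\<epsilon>. ereal (m \<epsilon>)) \<longlongrightarrow> l) (at_right 0)"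
  proof -
    define a b d where "a k = fst (xs ! (k - 1))" and "b k = fst (snd (xs ! (k - 1)))"
      and "d k = snd (snd (xs ! (k - 1)))" for k :: nat
    define n where "n = length xs"
    have cond: "\<forall>k\<in>{1..n}. a k < M \<and> b k < M \<and> d k < M \<and> a k \<noteq> b k \<and> a k \<noteq> d k \<and>
                    (\<exists>\<epsilon>>0. Pm \<epsilon> (a k) (d k) \<noteq> 0)"
    proof
      fix k assume "k \<in> {1..n}"
      then have "(a k, b k, d k) \<in> set xs" by (auto simp: a_def b_def d_def n_def)
      then show "a k < M \<and> b k < M \<and> d k < M \<and> a k \<noteq> b k \<and> a k \<noteq> d k \<and> (\<exists>\<epsilon>>0. Pm \<epsilon> (a k) (d k) \<noteq> 0)"
        using xs unfolding link_def by blast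
    qed
    \<comment> \<open>Equal indices for the two holding-time factors remove them from (f).\<close>
    obtain L where "((\<lambda>\<epsilon>. ereal ((\<Prod>k=1..n. Pm \<epsilon> (a k) (b k) / Pm \<epsilon> (a k) (d k)) * tau \<epsilon> 0 / tau \<epsilon> 0))
              \<longlongrightarrow> L) (at_right 0)"
      using f_lim[rule_format, OF conjI[OF cond], of 0 0] M_pos by blast
    moreover have "\<forall>\<^sub>F \<epsilon> in at_right 0. ereal ((\<Prod>k=1..n. Pm \<epsilon> (a k) (b k) / Pm \<epsilon> (a k) (d k)) * tau \<epsilon> 0 / tau \<epsilon> 0)
        = ereal (m \<epsilon>)"
      using at_right_pos
    proof eventually_elim
      case (elim \<epsilon>)
      have "m \<epsilon> = (\<Prod>k<n. Pm \<epsilon> (a (Suc k)) (b (Suc k)) / Pm \<epsilon> (a (Suc k)) (d (Suc k)))"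
        unfolding m ratio_product_def prod.list_conv_set_nth n_def a_def b_def d_def
        by (intro prod.cong) (auto simp: split_beta)
      then show ?case using b_pos[rule_format, of \<epsilon> 0] M_pos elim by (simp add: prod.atLeast1_atMost_eq)
    qed
    ultimately have "((\<lambda>\<epsilon>. ereal (m \<epsilon>)) \<longlongrightarrow> L) (at_right 0)" by (rule Lim_transform_eventually)
    then show ?thesis by blast
  qed
next
  show "(\<lambda>_. 1) \<in> ratio_products"
    unfolding ratio_products_def by (intro image_eqI[of _ _ "[]"]) (auto simp: ratio_product_def)
qed

text \<open>(f) speaks only of ratios within a row. Since the row sums to 1, an entry is the
  reciprocal of the sum of \<open>Pm \<epsilon> i d / Pm \<epsilon> i j\<close> over d, whose terms
  are regular or zero.\<close>

lemma regular_Pm: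
  assumes ij: "link i j"
  shows "regular (\<lambda>\<epsilon>. Pm \<epsilon> i j)"
proof -
  have lt: "i < M" "j < M" "i \<noteq> j" using ij by (auto simp: link_def)
  have ratio: "regular (\<lambda>\<epsilon>. Pm \<epsilon> i d / Pm \<epsilon> i j)" if "link i d" for d
  proof (rule G_regular)
    show "(\<lambda>\<epsilon>. Pm \<epsilon> i d / Pm \<epsilon> i j) \<in> ratio_products"
      unfolding ratio_products_def using that ij
      by (intro image_eqI[of _ _ "[(i, d, j)]"]) (auto simp: ratio_product_def)
  qed
  have "regular (\<lambda>\<epsilon>. \<Sum>d\<in>{..<M} - {i}. Pm \<epsilon> i d / Pm \<epsilon> i j)"
  proof (rule regular_sum[where i=j])
    show "regular (\<lambda>\<epsilon>. Pm \<epsilon> i d / Pm \<epsilon> i j) \<or> (\<forall>\<epsilon>>0. Pm \<epsilon> i d / Pm \<epsilon> i j = 0)" if "d \<in> {..<M} - {i}" for d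
      using ratio[of d] not_link[of i d] that lt by (cases "link i d") auto
  qed (use lt ratio[OF ij] in \<open>auto simp del: divide_self_if\<close>)
  from regular_inverse[OF this] show ?thesis
  proof (rule regular_cong)
    fix \<epsilon> :: real assume "0 < \<epsilon>"
    then show "inverse (\<Sum>d\<in>{..<M} - {i}. Pm \<epsilon> i d / Pm \<epsilon> i j) = Pm \<epsilon> i j"
      using a_sum lt by (simp flip: sum_divide_distrib)
  qed
qed

text \<open>Decides at every rank which transitions vanish identically, in terms of base transitions
  alone; all ranks thereby inherit the dichotomy of (a).\<close>

definition linked :: "nat set \<Rightarrow> nat set \<Rightarrow> bool" where
  "linked K L \<longleftrightarrow> (\<exists>i\<in>K. \<exists>j\<in>L. link i j)"

text \<open>The half of the induction invariant that does not mention the process; it makes the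
  limits defining the next rank exist.\<close>

definition good_level :: "nat set set \<Rightarrow> (real \<Rightarrow> nat set \<Rightarrow> nat set \<Rightarrow> real) \<Rightarrow> bool" where
  "good_level C P \<longleftrightarrow> finite C \<and> \<Union>C = {..<M} \<and> {} \<notin> C \<and>
     (\<forall>K\<in>C. \<forall>L\<in>C. K \<noteq> L \<longrightarrow> K \<inter> L = {}) \<and> (\<forall>\<epsilon>. \<forall>K\<in>C. P \<epsilon> K K = 0) \<and>
     (\<forall>K\<in>C. \<forall>L\<in>C. K \<noteq> L \<longrightarrow>
        (if linked K L then regular (\<lambda>\<epsilon>. P \<epsilon> K L) else \<forall>\<epsilon>>0. P \<epsilon> K L = 0)) \<and>
     (\<forall>\<epsilon>>0. \<forall>K\<in>C. (\<Sum>L\<in>C. P \<epsilon> K L) = 1)"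

text \<open>The half of the invariant that concerns the process. Sure exit is included because the
  strong Markov property at the next rank relies on it.\<close>

definition comparable_at :: "real \<Rightarrow> nat set set \<Rightarrow> (real \<Rightarrow> nat set \<Rightarrow> nat set \<Rightarrow> real) \<Rightarrow> real \<Rightarrow> bool" where
  "comparable_at c C P \<epsilon> \<longleftrightarrow> (\<forall>K\<in>C. \<forall>x\<in>cset S K.
     exit_op (Q \<epsilon>) (cset S K) (\<lambda>_. 1) x = 1 \<and>
     (\<forall>L\<in>C. K \<noteq> L \<longrightarrow>
       ennreal (c * P \<epsilon> K L) \<le> exit_op (Q \<epsilon>) (cset S K) (indicator (cset S L)) x \<and>
       exit_op (Q \<epsilon>) (cset S K) (indicator (cset S L)) x \<le> ennreal (P \<epsilon> K L / c)))"

lemma comparable_atD: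
  assumes "comparable_at c C P \<epsilon>" "K \<in> C" "x \<in> cset S K"
  shows "exit_op (Q \<epsilon>) (cset S K) (\<lambda>_. 1) x = 1"
    and "L \<in> C \<Longrightarrow> K \<noteq> L \<Longrightarrow> ennreal (c * P \<epsilon> K L) \<le> exit_op (Q \<epsilon>) (cset S K) (indicator (cset S L)) x"
    and "L \<in> C \<Longrightarrow> K \<noteq> L \<Longrightarrow> exit_op (Q \<epsilon>) (cset S K) (indicator (cset S L)) x \<le> ennreal (P \<epsilon> K L / c)"
  using assms unfolding comparable_at_def by blast+

definition comparable_level :: "nat set set \<Rightarrow> (real \<Rightarrow> nat set \<Rightarrow> nat set \<Rightarrow> real) \<Rightarrow> bool" where
  "comparable_level C P \<longleftrightarrow> (\<exists>c>0. c \<le> 1 \<and> (\<forall>\<^sub>F \<epsilon> in at_right 0. comparable_at c C P \<epsilon>))"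

lemma good_level_0: "good_level (clusters M Pm 0) (Prank M Pm 0)"
proof -
  have C: "clusters M Pm 0 = (\<lambda>i. {i}) ` {..<M}" by (simp add: clusters_def level_def)
  have P: "Prank M Pm 0 = (\<lambda>\<epsilon> K L. if K = L then 0 else Pm \<epsilon> (the_elem K) (the_elem L))"
    by (simp add: Prank_def level_def)
  have row: "(\<Sum>j<M. if i = j then 0 else Pm \<epsilon> (the_elem {i}) (the_elem {j})) = 1" if "0 < \<epsilon>" "i < M" for \<epsilon> i
  proof -
    have "(\<Sum>j<M. if i = j then 0 else Pm \<epsilon> (the_elem {i}) (the_elem {j}))
        = (\<Sum>j\<in>{..<M} - {i}. if i = j then 0 else Pm \<epsilon> (the_elem {i}) (the_elem {j}))"
      using that by (intro sum.mono_neutral_right) auto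
    also have "\<dots> = (\<Sum>j\<in>{..<M} - {i}. Pm \<epsilon> i j)" by (intro sum.cong) auto
    finally show ?thesis using a_sum that by simp
  qed
  show ?thesis
    unfolding good_level_def C P
    by (auto simp: linked_def regular_Pm not_link sum.reindex row)
qed

text \<open>\<open>Pk\<close> counts only nonnegative holding times, and the kernel charges no
  others.\<close>

lemma step_eq_Pk:
  assumes "0 < \<epsilon>" "i < M"
  shows "step (Q \<epsilon>) (indicator (S i)) x = ennreal (Pk (Q \<epsilon> x) (S i))"
proof -
  interpret step_kernel "Q \<epsilon>" using assms(1) by (rule step_kernel_Q)
  interpret prob_space "Q \<epsilon> x" by (rule prob_q)
  have [measurable]: "S i \<in> sets borel" using S_borel assms by auto
  have pos: "AE z in Q \<epsilon> x. z \<in> UNIV \<times> {0..}"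
    using kernel assms(1) by (intro prob_eq_1[THEN iffD1]) (auto simp: renewal_kernel_def sets_q, simp add: MT_def)
  have "step (Q \<epsilon>) (indicator (S i)) x = (\<integral>\<^sup>+ z. indicator (S i \<times> {0..}) z \<partial>Q \<epsilon> x)"
    unfolding step_def by (intro nn_integral_cong_AE) (use pos in \<open>eventually_elim, auto split: split_indicator\<close>)
  also have "\<dots> = emeasure (Q \<epsilon> x) (S i \<times> {0..})"
    by (intro nn_integral_indicator) (simp add: sets_q MT_def)
  finally show ?thesis by (simp add: Pk_def emeasure_eq_measure)
qed

text \<open>By (a) no jump stays in \<open>S i\<close>, so the exit happens at the first step and
  only the term n = 0 of the series survives.\<close>

lemma exit_op_base:
  assumes "0 < \<epsilon>" "i < M" "x \<in> S i" and f: "\<And>z. f z \<le> 1"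
  shows "exit_op (Q \<epsilon>) (S i) f x = step (Q \<epsilon>) (\<lambda>z. indicator (- S i) z * f z) x"
proof -
  interpret step_kernel "Q \<epsilon>" using assms(1) by (rule step_kernel_Q)
  have [measurable]: "S i \<in> sets borel" using S_borel assms by auto
  define k where "k = killed (Q \<epsilon>) (S i)"
  have zero: "k g y = 0" if "y \<in> S i" "\<And>z. g z \<le> 1" for g y
  proof -
    have "k g y \<le> step (Q \<epsilon>) (indicator (S i)) y"
      unfolding k_def killed_def using that by (intro step_mono) (auto split: split_indicator)
    also have "\<dots> = 0" using assms that a_diag by (simp add: step_eq_Pk)
    finally show ?thesis by simp
  qed
  interpret K: positive_operator k "S i" unfolding k_def by (rule killed_positive) measurable
  define g where "g = step (Q \<epsilon>) (\<lambda>z. indicator (- S i) z * f z)"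
  have g1: "g z \<le> 1" for z
  proof -
    have "g z \<le> step (Q \<epsilon>) (\<lambda>_. 1) z"
      unfolding g_def using f by (intro step_mono) (auto split: split_indicator)
    then show ?thesis by (simp add: step_const)
  qed
  have "(k ^^ Suc n) g y = 0" if "y \<in> S i" for n y
    using that
  proof (induction n arbitrary: y)
    case 0
    then show ?case using zero g1 by simp
  next
    case (Suc n)
    have "(k ^^ Suc (Suc n)) g y = k ((k ^^ Suc n) g) y" by simp
    also have "k ((k ^^ Suc n) g) = k (\<lambda>_. 0)"
      using Suc.IH by (rule K.T_cong)
    also have "k (\<lambda>_. 0) y = 0" using zero Suc.prems by simp
    finally show ?case .
  qed
  then have "(\<Sum>n. (k ^^ n) g x) = (\<Sum>n\<in>{0}. (k ^^ n) g x)"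
    using assms(3) by (intro suminf_finite) (auto simp: gr0_conv_Suc)
  then show ?thesis by (simp add: exit_op_def g_def k_def)
qed

text \<open>Tolerance 1/2 in (a) puts the ratio between 1/2 and 3/2, so the constant 1/2 works in
  both directions.\<close>

lemma comparable_level_0: "comparable_level (clusters M Pm 0) (Prank M Pm 0)"
proof -
  have C: "clusters M Pm 0 = (\<lambda>i. {i}) ` {..<M}" by (simp add: clusters_def level_def)
  have P: "Prank M Pm 0 = (\<lambda>\<epsilon> K L. if K = L then 0 else Pm \<epsilon> (the_elem K) (the_elem L))"
    by (simp add: Prank_def level_def)
  have cset: "cset S {i} = S i" for i by (simp add: cset_def)
  have ev: "\<forall>\<^sub>F \<epsilon> in at_right 0. \<forall>i\<in>{..<M}. \<forall>j\<in>{..<M}. i \<noteq> j \<longrightarrow>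
      (\<forall>x\<in>S i. 1/2 * Pm \<epsilon> i j \<le> Pk (Q \<epsilon> x) (S j) \<and> Pk (Q \<epsilon> x) (S j) \<le> Pm \<epsilon> i j / (1/2))"
  proof (intro eventually_ball_finite ballI finite_lessThan)
    fix i j assume "i \<in> {..<M}" "j \<in> {..<M}"
    then have lt: "i < M" "j < M" by auto
    show "\<forall>\<^sub>F \<epsilon> in at_right 0. i \<noteq> j \<longrightarrow>
      (\<forall>x\<in>S i. 1/2 * Pm \<epsilon> i j \<le> Pk (Q \<epsilon> x) (S j) \<and> Pk (Q \<epsilon> x) (S j) \<le> Pm \<epsilon> i j / (1/2))"
    proof (cases "i \<noteq> j")
      case True
      from a_offdiag lt True have "(\<forall>\<epsilon>>0. Pm \<epsilon> i j = 0 \<and> (\<forall>x\<in>S i. Pk (Q \<epsilon> x) (S j) = 0)) \<or>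
          ((\<forall>\<epsilon>>0. 0 < Pm \<epsilon> i j) \<and>
          (\<forall>e>0. \<forall>\<^sub>F \<epsilon> in at_right 0. \<forall>x\<in>S i. \<bar>Pk (Q \<epsilon> x) (S j) / Pm \<epsilon> i j - 1\<bar> < e))" (is "?A \<or> ?B")
        by blast
      then show ?thesis
      proof
        assume 1: ?A
        from at_right_pos show ?thesis
          by eventually_elim (use 1 in auto)
      next
        assume 2: ?B
        have "\<forall>\<^sub>F \<epsilon> in at_right 0. \<forall>x\<in>S i. \<bar>Pk (Q \<epsilon> x) (S j) / Pm \<epsilon> i j - 1\<bar> < 1/2"
          by (rule 2[THEN conjunct2, rule_format]) simp
        from this at_right_pos show ?thesis
        proof eventually_elim
          case (elim \<epsilon>)
          have p: "0 < Pm \<epsilon> i j" using 2 elim by auto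
          show ?case
          proof (intro impI ballI)
            fix x assume "x \<in> S i"
            then have "\<bar>Pk (Q \<epsilon> x) (S j) / Pm \<epsilon> i j - 1\<bar> < 1/2" using elim(1) by blast
            then have "1/2 < Pk (Q \<epsilon> x) (S j) / Pm \<epsilon> i j" "Pk (Q \<epsilon> x) (S j) / Pm \<epsilon> i j < 2"
              by linarith+
            then show "1/2 * Pm \<epsilon> i j \<le> Pk (Q \<epsilon> x) (S j) \<and> Pk (Q \<epsilon> x) (S j) \<le> Pm \<epsilon> i j / (1/2)"
              using p by (simp add: field_simps)
          qed
        qed
      qed
    qed simp
  qed
  show ?thesis
    unfolding comparable_level_def
  proof (intro exI[of _ "1/2"] conjI)
    show "\<forall>\<^sub>F \<epsilon> in at_right 0. comparable_at (1/2) (clusters M Pm 0) (Prank M Pm 0) \<epsilon>"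
      using ev at_right_pos
    proof eventually_elim
      case (elim \<epsilon>)
      interpret step_kernel "Q \<epsilon>" using elim(2) by (rule step_kernel_Q)
      have one: "exit_op (Q \<epsilon>) (S i) (\<lambda>_. 1) x = 1" if "i < M" "x \<in> S i" for i x
      proof -
        have "S i \<in> sets borel" using S_borel that by auto
        then have "step (Q \<epsilon>) (\<lambda>_. 1) x = step (Q \<epsilon>) (\<lambda>z. indicator (- S i) z * 1) x + killed (Q \<epsilon>) (S i) (\<lambda>_. 1) x"
          by (rule step_split) auto
        moreover have "killed (Q \<epsilon>) (S i) (\<lambda>_. 1) x = 0"
          using step_eq_Pk[OF elim(2) that(1), of x] a_diag elim that by (simp add: killed_def)
        ultimately show ?thesis using exit_op_base[OF elim(2) that, of "\<lambda>_. 1"] by (simp add: step_const)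
      qed
      have two: "exit_op (Q \<epsilon>) (S i) (indicator (S j)) x = ennreal (Pk (Q \<epsilon> x) (S j))"
        if "i < M" "j < M" "i \<noteq> j" "x \<in> S i" for i j x
      proof -
        have "(\<lambda>z. indicator (- S i) z * indicator (S j) z :: ennreal) = indicator (S j)"
          using S_disj that by (intro ext) (auto split: split_indicator)
        then show ?thesis
          using exit_op_base[OF elim(2) that(1,4), of "indicator (S j)"] step_eq_Pk[OF elim(2) that(2), of x]
          by (simp add: indicator_ennreal_le_1)
      qed
      show ?case
        unfolding comparable_at_def C P using elim(1) by (auto simp: cset one two intro!: ennreal_leI)
    qed
  qed auto
qed

end

section \<open>From one rank to the next: limits, blocks, weights and fluxes\<close>

locale level_step = renewal_hierarchy M S Q Pm tau
  for M :: nat and S :: "nat \<Rightarrow> 'a::metric_space set" and Q Pm tau +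
  fixes C :: "nat set set" and P :: "real \<Rightarrow> nat set \<Rightarrow> nat set \<Rightarrow> real"
  assumes good: "good_level C P"
begin

lemma C_fin: "finite C" and C_cover: "\<Union>C = {..<M}" and C_ne: "{} \<notin> C"
  and C_disj: "K \<in> C \<Longrightarrow> L \<in> C \<Longrightarrow> K \<noteq> L \<Longrightarrow> K \<inter> L = {}"
  and P_diag: "K \<in> C \<Longrightarrow> P \<epsilon> K K = 0"
  and P_linked: "K \<in> C \<Longrightarrow> L \<in> C \<Longrightarrow> K \<noteq> L \<Longrightarrow> linked K L \<Longrightarrow> regular (\<lambda>\<epsilon>. P \<epsilon> K L)"
  and P_unlinked: "K \<in> C \<Longrightarrow> L \<in> C \<Longrightarrow> K \<noteq> L \<Longrightarrow> \<not> linked K L \<Longrightarrow> 0 < \<epsilon> \<Longrightarrow> P \<epsilon> K L = 0"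
  and P_row: "0 < \<epsilon> \<Longrightarrow> K \<in> C \<Longrightarrow> (\<Sum>L\<in>C. P \<epsilon> K L) = 1"
proof -
  note g = good[unfolded good_level_def]
  note g1 = g[THEN conjunct2] note g2 = g1[THEN conjunct2] note g3 = g2[THEN conjunct2]
  note g4 = g3[THEN conjunct2] note g5 = g4[THEN conjunct2]
  show "finite C" by (rule g[THEN conjunct1])
  show "\<Union>C = {..<M}" by (rule g1[THEN conjunct1])
  show "{} \<notin> C" by (rule g2[THEN conjunct1])
  show "K \<inter> L = {}" if "K \<in> C" "L \<in> C" "K \<noteq> L" using g3[THEN conjunct1] that by blast
  show "P \<epsilon> K K = 0" if "K \<in> C" using g4[THEN conjunct1] that by blast
  show "(\<Sum>L\<in>C. P \<epsilon> K L) = 1" if "0 < \<epsilon>" "K \<in> C" using g5[THEN conjunct2] that by blast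
  have "if linked K L then regular (\<lambda>\<epsilon>. P \<epsilon> K L) else \<forall>\<epsilon>>0. P \<epsilon> K L = 0"
    if "K \<in> C" "L \<in> C" "K \<noteq> L" using g5[THEN conjunct1] that by blast
  then show "K \<in> C \<Longrightarrow> L \<in> C \<Longrightarrow> K \<noteq> L \<Longrightarrow> linked K L \<Longrightarrow> regular (\<lambda>\<epsilon>. P \<epsilon> K L)"
    "K \<in> C \<Longrightarrow> L \<in> C \<Longrightarrow> K \<noteq> L \<Longrightarrow> \<not> linked K L \<Longrightarrow> 0 < \<epsilon> \<Longrightarrow> P \<epsilon> K L = 0"
    by (auto split: if_splits)
qed

lemma P_nonneg: "K \<in> C \<Longrightarrow> L \<in> C \<Longrightarrow> 0 < \<epsilon> \<Longrightarrow> 0 \<le> P \<epsilon> K L"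
proof -
  assume KL: "K \<in> C" "L \<in> C" and e: "0 < \<epsilon>"
  show ?thesis
  proof (cases "K \<noteq> L \<and> linked K L")
    case True
    then show ?thesis using regular_pos[OF P_linked e] KL by (simp add: less_imp_le)
  next
    case False
    then show ?thesis using P_diag P_unlinked KL e by (cases "K = L") auto
  qed
qed

lemma P_le_1: "K \<in> C \<Longrightarrow> L \<in> C \<Longrightarrow> 0 < \<epsilon> \<Longrightarrow> P \<epsilon> K L \<le> 1"
  using member_le_sum[of L C "P \<epsilon> K"] P_nonneg[of K _ \<epsilon>] P_row[of \<epsilon> K] C_fin by auto

definition P0 :: "nat set \<Rightarrow> nat set \<Rightarrow> real" where "P0 = (\<lambda>K L. lim0 (\<lambda>\<epsilon>. P \<epsilon> K L))"

text \<open>\<open>lim0\<close> selects a limit by definite description, so its existence must be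
  proved: regular entries are bounded by 1 and converge, and the other entries are identically
  0.\<close>

lemma P0_lim: "K \<in> C \<Longrightarrow> L \<in> C \<Longrightarrow> ((\<lambda>\<epsilon>. P \<epsilon> K L) \<longlongrightarrow> P0 K L) (at_right 0)"
  and P0_nonneg: "K \<in> C \<Longrightarrow> L \<in> C \<Longrightarrow> 0 \<le> P0 K L"
proof -
  assume KL: "K \<in> C" "L \<in> C"
  have "\<exists>l\<ge>0. ((\<lambda>\<epsilon>. P \<epsilon> K L) \<longlongrightarrow> l) (at_right 0)"
  proof (cases "K \<noteq> L \<and> linked K L")
    case True
    then show ?thesis using regular_bounded_lim[OF P_linked] KL P_le_1 by auto
  next
    case False
    have "\<forall>\<^sub>F \<epsilon> in at_right 0. P \<epsilon> K L = 0"
      using at_right_pos by eventually_elim (use False P_diag P_unlinked KL in \<open>cases "K = L"; auto\<close>)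
    then show ?thesis by (auto intro!: exI[of _ 0] tendsto_eventually)
  qed
  then obtain l where l: "0 \<le> l" "((\<lambda>\<epsilon>. P \<epsilon> K L) \<longlongrightarrow> l) (at_right 0)" by auto
  then have "P0 K L = l" unfolding P0_def lim0_def by (auto intro!: tendsto_Lim)
  then show "((\<lambda>\<epsilon>. P \<epsilon> K L) \<longlongrightarrow> P0 K L) (at_right 0)" "0 \<le> P0 K L" using l by auto
qed

lemma P0_row: "K \<in> C \<Longrightarrow> (\<Sum>L\<in>C. P0 K L) = 1"
proof -
  assume K: "K \<in> C"
  have "((\<lambda>\<epsilon>. \<Sum>L\<in>C. P \<epsilon> K L) \<longlongrightarrow> (\<Sum>L\<in>C. P0 K L)) (at_right 0)"
    using K by (intro tendsto_sum P0_lim)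
  moreover have "((\<lambda>\<epsilon>. \<Sum>L\<in>C. P \<epsilon> K L) \<longlongrightarrow> 1) (at_right 0)"
    by (intro tendsto_eventually) (use at_right_pos P_row K in \<open>auto elim: eventually_mono\<close>)
  ultimately show ?thesis using tendsto_unique[OF trivial_limit_at_right_real] by blast
qed

definition edge :: "(nat set \<times> nat set) set" where
  "edge = {(K, L). K \<in> C \<and> L \<in> C \<and> P0 K L > 0}"

lemma edge_fin: "finite edge"
  using C_fin by (intro finite_subset[of edge "C \<times> C"]) (auto simp: edge_def)

lemma reach_edge: "reach C P0 K L \<longleftrightarrow> (K, L) \<in> edge\<^sup>*"
  by (simp add: reach_def edge_def)

lemma edge_closed: "(K, L) \<in> edge\<^sup>* \<Longrightarrow> K \<in> C \<Longrightarrow> L \<in> C"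
  by (induction rule: rtrancl_induct) (auto simp: edge_def)

abbreviation "B \<equiv> blocks C P0"

lemma block_cases:
  assumes "E \<in> B"
  obtains K where "ergodic_class C P0 E" "K \<in> C" "E = {L\<in>C. (K, L) \<in> edge\<^sup>*}" "\<And>L. L \<in> E \<Longrightarrow> (L, K) \<in> edge\<^sup>*"
  | K where "\<not> ergodic_class C P0 E" "E = {K}" "transient_state C P0 K" "K \<in> C"
proof (cases "ergodic_class C P0 E")
  case True
  then obtain K where "K \<in> C" "E = {L\<in>C. (K, L) \<in> edge\<^sup>*}" "\<forall>L\<in>E. (L, K) \<in> edge\<^sup>*"
    unfolding ergodic_class_def reach_edge by blast
  with True show ?thesis using that(1) by blast
next
  case False
  then show ?thesis using assms that(2) unfolding blocks_def transient_state_def by auto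
qed

lemma block_sub: "E \<in> B \<Longrightarrow> E \<subseteq> C" and block_ne: "E \<in> B \<Longrightarrow> E \<noteq> {}"
  by (erule block_cases; blast)+

lemma block_Union_ne: "E \<in> B \<Longrightarrow> \<Union>E \<noteq> {}"
proof
  assume E: "E \<in> B" and e: "\<Union>E = {}"
  obtain K where K: "K \<in> E" using block_ne[OF E] by blast
  then have "K = {}" using e by blast
  then show False using K block_sub[OF E] C_ne by blast
qed

lemma Union_disj:
  assumes "E \<subseteq> C" "D \<subseteq> C" "E \<inter> D = {}"
  shows "\<Union>E \<inter> \<Union>D = {}"
proof (rule ccontr)
  assume "\<Union>E \<inter> \<Union>D \<noteq> {}"
  then obtain K L i where "K \<in> E" "L \<in> D" "i \<in> K" "i \<in> L" by blast
  moreover from this have "K \<noteq> L" using assms(3) by blast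
  ultimately show False using C_disj[of K L] assms(1,2) by blast
qed

text \<open>A path between members of an ergodic class stays inside it, since all its states are
  reachable from the representative. For a transient singleton the empty path does.\<close>

lemma block_conn:
  assumes E: "E \<in> B" and KL: "K \<in> E" "L \<in> E"
  shows "(K, L) \<in> (edge \<inter> E \<times> E)\<^sup>*"
  using E
proof (cases rule: block_cases)
  case (1 K0)
  have KK0: "(K, K0) \<in> edge\<^sup>*" and K0L: "(K0, L) \<in> edge\<^sup>*" using 1 KL by auto
  have "(K, L) \<in> edge\<^sup>*" using KK0 K0L by (rule rtrancl_trans)
  then show ?thesis
  proof (induction rule: rtrancl_induct)
    case (step L1 L2)
    have "(K0, K) \<in> edge\<^sup>*" using 1 KL by auto
    then have "(K0, L1) \<in> edge\<^sup>*" "(K0, L2) \<in> edge\<^sup>*" using step(1,2) by auto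
    then have "L1 \<in> E" "L2 \<in> E" using 1 step(2) by (auto simp: edge_def)
    then show ?case using step by (auto intro: rtrancl_into_rtrancl)
  qed simp
next
  case (2 K)
  then show ?thesis using KL by auto
qed

text \<open>Any member can serve as representative, because member and representative reach each
  other.\<close>

lemma ergodic_eq:
  assumes "ergodic_class C P0 E" "L \<in> E"
  shows "E = {L'\<in>C. (L, L') \<in> edge\<^sup>*}"
proof -
  obtain K where K: "K \<in> C" "E = {L\<in>C. (K, L) \<in> edge\<^sup>*}" "\<forall>L\<in>E. (L, K) \<in> edge\<^sup>*"
    using assms(1) unfolding ergodic_class_def reach_edge by blast
  have 1: "(L, K) \<in> edge\<^sup>*" using K assms by blast
  have 2: "(K, L) \<in> edge\<^sup>*" using K assms by blast
  show ?thesis unfolding K(2) using rtrancl_trans[OF 1] rtrancl_trans[OF 2] by blast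
qed

lemma ergodic_not_transient:
  assumes "ergodic_class C P0 E" "L \<in> E"
  shows "\<not> transient_state C P0 L"
proof
  assume t: "transient_state C P0 L"
  then obtain L' where L': "(L, L') \<in> edge\<^sup>*" "(L', L) \<notin> edge\<^sup>*" "L \<in> C"
    unfolding transient_state_def reach_edge by blast
  have "L' \<in> C" using edge_closed L' by blast
  then have "L' \<in> E" using ergodic_eq[OF assms] L' by blast
  then have "E = {L''\<in>C. (L', L'') \<in> edge\<^sup>*}" using ergodic_eq assms(1) by blast
  then show False using assms(2) L' by blast
qed

text \<open>A shared member determines both ergodic classes; an ergodic class contains no transient
  state, which excludes a mixed overlap; and two singletons that meet are equal.\<close>

lemma block_disj:
  assumes "E \<in> B" "E' \<in> B" "E \<noteq> E'"
  shows "E \<inter> E' = {}"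
proof (rule ccontr)
  assume "E \<inter> E' \<noteq> {}"
  then obtain L where L: "L \<in> E" "L \<in> E'" by blast
  have "E = E'"
  proof (cases "ergodic_class C P0 E")
    case True
    have "ergodic_class C P0 E'"
      using assms(2) by (rule block_cases) (use ergodic_not_transient[OF True L(1)] L in auto)
    then show ?thesis using ergodic_eq[OF True L(1)] ergodic_eq[OF _ L(2)] by blast
  next
    case False
    obtain K where K: "E = {K}" "transient_state C P0 K"
      using assms(1) by (rule block_cases) (use False in auto)
    have "\<not> ergodic_class C P0 E'" using ergodic_not_transient[of E' L] K L by auto
    with assms(2) obtain K' where "E' = {K'}" by (metis block_cases)
    then show ?thesis using K L by auto
  qed
  with assms show False by blast
qed

lemma block_cover: "\<Union>B = C"
proof
  show "\<Union>B \<subseteq> C" using block_sub by blast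
  show "C \<subseteq> \<Union>B"
  proof
    fix K assume K: "K \<in> C"
    show "K \<in> \<Union>B"
    proof (cases "transient_state C P0 K")
      case True
      then show ?thesis unfolding blocks_def by blast
    next
      case False
      then have "ergodic_class C P0 {L\<in>C. reach C P0 K L}"
        using K unfolding ergodic_class_def transient_state_def by blast
      moreover have "K \<in> {L\<in>C. reach C P0 K L}" using K by (simp add: reach_edge)
      ultimately show ?thesis unfolding blocks_def by blast
    qed
  qed
qed

lemma B_fin: "finite B"
  using C_fin block_sub by (intro finite_subset[of B "Pow C"]) auto

text \<open>An ergodic class is closed under edges, so the limit matrix restricted to it is
  stochastic and irreducible, and its invariant probability charges every state.\<close>

lemma inv_prob_pos:
  assumes E: "E \<in> B" and K: "K \<in> E"
  shows "0 < inv_prob C P0 E K"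
  using E
proof (cases rule: block_cases)
  case (1 K0)
  have sub: "E \<subseteq> C" using E by (rule block_sub)
  have row: "(\<Sum>L\<in>E. P0 K L) = 1" if "K \<in> E" for K
  proof -
    have "P0 K L = 0" if "L \<in> C - E" for L
    proof (rule ccontr)
      assume "P0 K L \<noteq> 0"
      then have "(K, L) \<in> edge" using \<open>K \<in> E\<close> sub that P0_nonneg[of K L] by (auto simp: edge_def)
      then have "L \<in> E" using ergodic_eq[OF 1(1) \<open>K \<in> E\<close>] that by blast
      then show False using that by blast
    qed
    then have "(\<Sum>L\<in>E. P0 K L) = (\<Sum>L\<in>C. P0 K L)"
      using C_fin sub by (intro sum.mono_neutral_left) auto
    then show ?thesis using P0_row that sub by auto
  qed
  have conn: "(k, l) \<in> {(i, j). i \<in> E \<and> j \<in> E \<and> 0 < P0 i j}\<^sup>*" if "k \<in> E" "l \<in> E" for k l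
  proof -
    have "edge \<inter> E \<times> E \<subseteq> {(i, j). i \<in> E \<and> j \<in> E \<and> 0 < P0 i j}" by (auto simp: edge_def)
    then show ?thesis using block_conn[OF E that] rtrancl_mono by blast
  qed
  have fin: "finite E" "E \<noteq> {}" using C_fin sub finite_subset K by auto
  have nonneg: "0 \<le> P0 i j" if "i \<in> E" "j \<in> E" for i j using P0_nonneg that sub by auto
  have ex: "\<exists>!lam. (\<forall>K. K \<notin> E \<longrightarrow> lam K = 0) \<and> (\<forall>K\<in>E. 0 \<le> lam K) \<and> sum lam E = 1 \<and>
                  (\<forall>L\<in>E. (\<Sum>K\<in>E. lam K * P0 K L) = lam L)"
    by (rule invariant_probability_ex1_pos(1); fact)
  show ?thesis
    unfolding inv_prob_def if_P[OF 1(1)]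
    by (rule invariant_probability_ex1_pos(2)[OF _ _ _ _ _ theI'[OF ex] K]; fact)
next
  case (2 K)
  then show ?thesis using assms(2) by (simp add: inv_prob_def)
qed

text \<open>\<open>next_level\<close> recovers a block from the union of its clusters; this is
  faithful because clusters are disjoint and nonempty.\<close>

lemma inside_eq:
  assumes E: "E \<in> B"
  shows "{K\<in>C. K \<subseteq> \<Union>E} = E"
proof
  show "E \<subseteq> {K\<in>C. K \<subseteq> \<Union>E}" using block_sub[OF E] by auto
  show "{K\<in>C. K \<subseteq> \<Union>E} \<subseteq> E"
  proof
    fix K assume K: "K \<in> {K\<in>C. K \<subseteq> \<Union>E}"
    then obtain i where "i \<in> K" using C_ne by (metis (mono_tags) ex_in_conv mem_Collect_eq)
    then obtain L where "L \<in> E" "i \<in> L" using K by auto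
    then show "K \<in> E" using C_disj[of K L] K \<open>i \<in> K\<close> block_sub[OF E] by blast
  qed
qed

lemma outside_eq: "E \<in> B \<Longrightarrow> {K\<in>C. \<not> K \<subseteq> \<Union>E} = C - E"
  using inside_eq by blast

lemma Union_inj: "inj_on Union B"
proof (rule inj_onI)
  fix E E' assume E: "E \<in> B" "E' \<in> B" and eq: "\<Union>E = \<Union>E'"
  show "E = E'" using inside_eq[OF E(1)] inside_eq[OF E(2)] unfolding eq by simp
qed

text \<open>Numerator and denominator of the next transition matrix both have this form, with
  \<open>D\<close> another block or the complement \<open>C - E\<close>.\<close>

definition flux :: "real \<Rightarrow> nat set set \<Rightarrow> nat set set \<Rightarrow> real" where
  "flux \<epsilon> E D = (\<Sum>K\<in>E. \<Sum>L\<in>D. inv_prob C P0 E K * P \<epsilon> K L)"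

abbreviation "C' \<equiv> fst (next_level (C, P))"
abbreviation "P' \<equiv> snd (next_level (C, P))"

lemma C'_eq: "C' = Union ` B"
  by (simp add: next_level_def Let_def P0_def)

lemma P'_eq: "E \<in> B \<Longrightarrow> E' \<in> B \<Longrightarrow>
    P' \<epsilon> (\<Union>E) (\<Union>E') = (if E = E' then 0 else flux \<epsilon> E E' / flux \<epsilon> E (C - E))"
proof -
  assume E: "E \<in> B" "E' \<in> B"
  have "P' \<epsilon> (\<Union>E) (\<Union>E') = (if \<Union>E = \<Union>E' then 0 else
     (\<Sum>K\<in>{K\<in>C. K \<subseteq> \<Union>E}. \<Sum>L\<in>{L\<in>C. L \<subseteq> \<Union>E'}. inv_prob C P0 {K\<in>C. K \<subseteq> \<Union>E} K * P \<epsilon> K L) /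
     (\<Sum>K\<in>{K\<in>C. K \<subseteq> \<Union>E}. \<Sum>L\<in>{L\<in>C. \<not> L \<subseteq> \<Union>E}. inv_prob C P0 {K\<in>C. K \<subseteq> \<Union>E} K * P \<epsilon> K L))"
    by (simp add: next_level_def Let_def P0_def)
  also have "\<dots> = (if E = E' then 0 else flux \<epsilon> E E' / flux \<epsilon> E (C - E))"
    unfolding inside_eq[OF E(1)] inside_eq[OF E(2)] outside_eq[OF E(1)] flux_def
      inj_on_eq_iff[OF Union_inj E] ..
  finally show ?thesis .
qed

lemma linked_Union: "linked (\<Union>E) (\<Union>D) \<longleftrightarrow> (\<exists>K\<in>E. \<exists>L\<in>D. linked K L)"
  unfolding linked_def by blast

text \<open>The weights are positive constants, so the flux is identically zero exactly when no
  member of \<open>E\<close> is linked to a member of \<open>D\<close>.\<close>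

lemma flux_regular:
  assumes E: "E \<in> B" and D: "D \<subseteq> C - E"
  shows "if linked (\<Union>E) (\<Union>D) then regular (\<lambda>\<epsilon>. flux \<epsilon> E D) else \<forall>\<epsilon>>0. flux \<epsilon> E D = 0"
proof -
  have ne: "K \<in> C" "L \<in> C" "K \<noteq> L" "0 < inv_prob C P0 E K" if "K \<in> E" "L \<in> D" for K L
    using that D block_sub[OF E] inv_prob_pos[OF E] by auto
  show ?thesis
  proof (cases "linked (\<Union>E) (\<Union>D)")
    case True
    then obtain K L where KL: "K \<in> E" "L \<in> D" "linked K L" unfolding linked_Union by auto
    have "regular (\<lambda>\<epsilon>. \<Sum>z\<in>E \<times> D. inv_prob C P0 E (fst z) * P \<epsilon> (fst z) (snd z))"
    proof (rule regular_sum[where i="(K, L)"])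
      show "finite (E \<times> D)" using C_fin block_sub[OF E] D by (auto intro: finite_subset)
      fix z assume z: "z \<in> E \<times> D"
      show "regular (\<lambda>\<epsilon>. inv_prob C P0 E (fst z) * P \<epsilon> (fst z) (snd z)) \<or>
        (\<forall>\<epsilon>>0. inv_prob C P0 E (fst z) * P \<epsilon> (fst z) (snd z) = 0)"
        using z P_unlinked[OF ne(1-3)] regular_mult[OF regular_const[OF ne(4)] P_linked[OF ne(1-3)]]
        by (cases "linked (fst z) (snd z)") auto
    next
      show "regular (\<lambda>\<epsilon>. inv_prob C P0 E (fst (K, L)) * P \<epsilon> (fst (K, L)) (snd (K, L)))"
        using KL regular_mult[OF regular_const[OF ne(4)[OF KL(1,2)]] P_linked[OF ne(1-3)[OF KL(1,2)] KL(3)]]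
        by simp
    qed (use KL in auto)
    then have "regular (\<lambda>\<epsilon>. flux \<epsilon> E D)"
      by (simp add: flux_def sum.cartesian_product split_beta)
    with True show ?thesis by simp
  next
    case False
    then have "P \<epsilon> K L = 0" if "K \<in> E" "L \<in> D" "0 < \<epsilon>" for K L \<epsilon>
      using that P_unlinked[OF ne(1-3)] unfolding linked_Union by blast
    with False show ?thesis by (simp add: flux_def)
  qed
qed

text \<open>There is a second block and the base indices communicate, so a path from
  \<open>\<Union>E\<close> into that block contains a link leaving \<open>\<Union>E\<close>. This
  keeps the denominators of the next rank positive.\<close>

lemma escape_linked:
  assumes E: "E \<in> B" and card: "1 < card C'"
  shows "linked (\<Union>E) (\<Union>(C - E))"
proof -
  obtain E2 where E2: "E2 \<in> B" "E2 \<noteq> E"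
  proof -
    have "card B > 1" using card card_image[OF Union_inj] by (simp add: C'_eq)
    then have "\<not> B \<subseteq> {E}" using card_mono[of "{E}" B] by auto
    then show ?thesis using that by blast
  qed
  obtain i j where ij: "i \<in> \<Union>E" "j \<in> \<Union>E2" using block_Union_ne[OF E] block_Union_ne[OF E2(1)] by blast
  have "E2 \<subseteq> C - E" using block_sub[OF E2(1)] block_disj[OF E2(1) E E2(2)] by blast
  then have out: "j \<in> \<Union>(C - E)" using ij by blast
  have "\<Union>E \<inter> \<Union>(C - E) = {}" using block_sub[OF E] by (intro Union_disj) auto
  then have jE: "j \<notin> \<Union>E" using out by blast
  have lt: "i < M" "j < M" using ij C_cover block_sub E E2 by blast+
  have "(i, j) \<in> {(i, j). link i j}\<^sup>*" using a_comm lt unfolding link_def by blast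
  then have "j \<in> \<Union>E \<or> linked (\<Union>E) (- (\<Union>E))"
  proof (induction rule: rtrancl_induct)
    case base
    then show ?case using ij by blast
  next
    case (step y z)
    then show ?case unfolding linked_def by blast
  qed
  then obtain k l where kl: "k \<in> \<Union>E" "l \<notin> \<Union>E" "link k l" using jE unfolding linked_def by blast
  then have "l \<in> \<Union>C" using C_cover by (auto simp: link_def)
  then have "l \<in> \<Union>(C - E)" using kl by blast
  then show ?thesis using kl unfolding linked_def by blast
qed

lemma other_blocks:
  assumes E: "E \<in> B"
  shows "\<Union>(B - {E}) = C - E"
proof
  show "\<Union>(B - {E}) \<subseteq> C - E" using block_sub block_disj[OF _ E] by blast
  show "C - E \<subseteq> \<Union>(B - {E})" using block_cover by blast
qed

text \<open>The identity behind the row sums of the next rank.\<close>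

lemma flux_escape:
  assumes E: "E \<in> B"
  shows "(\<Sum>E'\<in>B - {E}. flux \<epsilon> E E') = flux \<epsilon> E (C - E)"
proof -
  have "flux \<epsilon> E (C - E) = (\<Sum>K\<in>E. \<Sum>L\<in>\<Union>(B - {E}). inv_prob C P0 E K * P \<epsilon> K L)"
    by (simp add: flux_def other_blocks[OF E])
  also have "\<dots> = (\<Sum>K\<in>E. \<Sum>E'\<in>B - {E}. \<Sum>L\<in>E'. inv_prob C P0 E K * P \<epsilon> K L)"
  proof (intro sum.cong refl)
    fix K
    have fin: "\<forall>E'\<in>B - {E}. finite E'" using block_sub C_fin finite_subset by blast
    have disj: "\<forall>E'\<in>B - {E}. \<forall>E''\<in>B - {E}. E' \<noteq> E'' \<longrightarrow> E' \<inter> E'' = {}" using block_disj by blast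
    show "(\<Sum>L\<in>\<Union>(B - {E}). inv_prob C P0 E K * P \<epsilon> K L) = (\<Sum>E'\<in>B - {E}. \<Sum>L\<in>E'. inv_prob C P0 E K * P \<epsilon> K L)"
      using sum.Union_disjoint[OF fin disj] by simp
  qed
  also have "\<dots> = (\<Sum>E'\<in>B - {E}. flux \<epsilon> E E')"
    unfolding flux_def by (rule sum.swap)
  finally show ?thesis by simp
qed

lemma good_next:
  assumes card: "1 < card C'"
  shows "good_level C' P'"
proof -
  have disj: "\<Union>E \<inter> \<Union>E' = {}" if "E \<in> B" "E' \<in> B" "E \<noteq> E'" for E E'
    using block_disj[OF that] block_sub[OF that(1)] block_sub[OF that(2)] by (intro Union_disj)
  have reg: "if linked (\<Union>E) (\<Union>E') then regular (\<lambda>\<epsilon>. P' \<epsilon> (\<Union>E) (\<Union>E')) else \<forall>\<epsilon>>0. P' \<epsilon> (\<Union>E) (\<Union>E') = 0"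
    if "E \<in> B" "E' \<in> B" "E \<noteq> E'" for E E'
  proof -
    have "E' \<subseteq> C - E" using block_sub block_disj that by blast
    from flux_regular[OF that(1) this] show ?thesis
      using flux_regular[OF that(1), of "C - E"] escape_linked[OF that(1) card] that
      by (auto simp: P'_eq intro: regular_divide)
  qed
  have row: "(\<Sum>L\<in>C'. P' \<epsilon> (\<Union>E) L) = 1" if "0 < \<epsilon>" "E \<in> B" for \<epsilon> E
  proof -
    have pos: "0 < flux \<epsilon> E (C - E)"
      using flux_regular[OF that(2), of "C - E"] escape_linked[OF that(2) card] regular_pos that(1) by auto
    have "(\<Sum>L\<in>C'. P' \<epsilon> (\<Union>E) L) = (\<Sum>E'\<in>B. P' \<epsilon> (\<Union>E) (\<Union>E'))"
      by (simp add: C'_eq sum.reindex[OF Union_inj])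
    also have "\<dots> = (\<Sum>E'\<in>B - {E}. P' \<epsilon> (\<Union>E) (\<Union>E'))"
      using that B_fin by (intro sum.mono_neutral_right) (auto simp: P'_eq)
    also have "\<dots> = (\<Sum>E'\<in>B - {E}. flux \<epsilon> E E' / flux \<epsilon> E (C - E))"
      using that by (intro sum.cong) (auto simp: P'_eq)
    also have "\<dots> = 1" using pos flux_escape[OF that(2)] by (simp flip: sum_divide_distrib)
    finally show ?thesis .
  qed
  show ?thesis
    unfolding good_level_def
  proof (intro conjI ballI allI impI)
    show "finite C'" using B_fin by (simp add: C'_eq)
    have "\<Union>C' = \<Union>(\<Union>B)" unfolding C'_eq by blast
    then show "\<Union>C' = {..<M}" using block_cover C_cover by simp
    show "{} \<notin> C'"
    proof
      assume "{} \<in> C'"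
      then obtain E where "E \<in> B" "\<Union>E = {}" unfolding C'_eq by (metis imageE)
      then show False using block_Union_ne[of E] by simp
    qed
  next
    fix K L assume "K \<in> C'" "L \<in> C'" "K \<noteq> L"
    then obtain E E' where E: "E \<in> B" "E' \<in> B" "E \<noteq> E'" "K = \<Union>E" "L = \<Union>E'" unfolding C'_eq by auto
    show "K \<inter> L = {}" using disj E by blast
    show "if linked K L then regular (\<lambda>\<epsilon>. P' \<epsilon> K L) else \<forall>\<epsilon>>0. P' \<epsilon> K L = 0"
      using reg E by blast
  next
    fix \<epsilon> K assume "K \<in> C'"
    then obtain E where "E \<in> B" "K = \<Union>E" unfolding C'_eq by auto
    then show "P' \<epsilon> K K = 0" by (simp add: P'_eq)
  next
    fix \<epsilon> :: real and K assume "0 < \<epsilon>" "K \<in> C'"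
    then show "(\<Sum>L\<in>C'. P' \<epsilon> K L) = 1" using row unfolding C'_eq by blast
  qed
qed


section \<open>Comparability of exit probabilities at the next rank\<close>

lemma cset_Union: "cset S (\<Union>E) = (\<Union>K\<in>E. cset S K)"
  by (auto simp: cset_def)

lemma cset_borel: "K \<in> C \<Longrightarrow> cset S K \<in> sets borel"
proof -
  assume "K \<in> C"
  then have "K \<subseteq> {..<M}" using C_cover by blast
  then show ?thesis unfolding cset_def
    using S_borel by (intro sets.finite_UN) (auto intro: finite_subset)
qed

lemma cset_disj: "K \<in> C \<Longrightarrow> L \<in> C \<Longrightarrow> K \<noteq> L \<Longrightarrow> cset S K \<inter> cset S L = {}"
proof (rule ccontr)
  assume KL: "K \<in> C" "L \<in> C" "K \<noteq> L" and "cset S K \<inter> cset S L \<noteq> {}"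
  then obtain x i j where x: "i \<in> K" "j \<in> L" "x \<in> S i" "x \<in> S j" by (auto simp: cset_def)
  have "i < M" "j < M" using C_cover KL x by blast+
  moreover have "i \<noteq> j" using C_disj[OF KL] x by blast
  ultimately have "S i \<inter> S j = {}" using S_disj by blast
  then show False using x by blast
qed

lemma cset_cover: "(\<Union>K\<in>C. cset S K) = UNIV"
proof -
  have "(\<Union>K\<in>C. cset S K) = (\<Union>i\<in>\<Union>C. S i)" by (auto simp: cset_def)
  then show ?thesis using S_cover C_cover by (simp add: lessThan_def)
qed

lemma inv_prob_bounds: "\<exists>l0 l1. 0 < l0 \<and> (\<forall>E\<in>B. \<forall>K\<in>E. l0 \<le> inv_prob C P0 E K \<and> inv_prob C P0 E K \<le> l1)"
proof -
  define V where "V = (\<lambda>(E, K). inv_prob C P0 E K) ` (SIGMA E:B. E)"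
  have fin: "finite V"
    unfolding V_def using B_fin block_sub C_fin by (intro finite_imageI finite_SigmaI) (auto intro: finite_subset)
  have pos: "\<forall>v\<in>V. 0 < v" using inv_prob_pos by (auto simp: V_def)
  have mem: "inv_prob C P0 E K \<in> V" if "E \<in> B" "K \<in> E" for E K
    using that by (auto simp: V_def intro!: image_eqI[of _ _ "(E, K)"])
  \<comment> \<open>The value 1 is inserted so that minimum and maximum are over nonempty
    sets.\<close>
  show ?thesis
  proof (rule exI[of _ "Min (insert 1 V)"], rule exI[of _ "Max (insert 1 V)"], intro conjI ballI)
    show "0 < Min (insert 1 V)" using fin pos by simp
  qed (rule Min_le Max_ge; use fin mem in auto)+
qed

lemma edge_lower: "\<exists>\<delta>>0. \<delta> \<le> 1 \<and> (\<forall>\<^sub>F \<epsilon> in at_right 0. \<forall>(K, L)\<in>edge. \<delta> \<le> P \<epsilon> K L)"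
proof -
  note fin = edge_fin
  \<comment> \<open>Half of the smallest positive limit lies strictly below each of them, hence
    eventually below the entries themselves; the cap 1 is imposed by
    \<open>merge_cells\<close>.\<close>
  define \<delta> where "\<delta> = Min (insert 1 ((\<lambda>(K, L). P0 K L / 2) ` edge))"
  have "0 < \<delta>" unfolding \<delta>_def using fin by (auto simp: edge_def)
  moreover have "\<delta> \<le> 1" unfolding \<delta>_def using fin by auto
  moreover have "\<forall>\<^sub>F \<epsilon> in at_right 0. \<forall>z\<in>edge. case z of (K, L) \<Rightarrow> \<delta> \<le> P \<epsilon> K L"
  proof (intro eventually_ball_finite fin ballI)
    fix z assume "z \<in> edge"
    then obtain K L where z: "z = (K, L)" "K \<in> C" "L \<in> C" "0 < P0 K L" "(K, L) \<in> edge" by (auto simp: edge_def)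
    have "\<delta> \<le> P0 K L / 2"
      unfolding \<delta>_def using fin z(5) by (intro Min_le) (auto intro!: image_eqI[of _ _ "(K, L)"])
    then have "\<delta> < P0 K L" using z by linarith
    from order_tendstoD(1)[OF P0_lim[OF z(2,3)] this]
    show "\<forall>\<^sub>F \<epsilon> in at_right 0. case z of (K, L) \<Rightarrow> \<delta> \<le> P \<epsilon> K L"
      unfolding z(1) by (auto elim: eventually_mono)
  qed
  ultimately show ?thesis by blast
qed

lemma comparable_next:
  assumes comp: "comparable_level C P" and card: "1 < card C'"
  shows "comparable_level C' P'"
proof -
  obtain c where c: "0 < c" "c \<le> 1" and ev: "\<forall>\<^sub>F \<epsilon> in at_right 0. comparable_at c C P \<epsilon>"
    using comp unfolding comparable_level_def by blast
  obtain \<delta> where \<delta>: "0 < \<delta>" "\<delta> \<le> 1" and ev\<delta>: "\<forall>\<^sub>F \<epsilon> in at_right 0. \<forall>(K, L)\<in>edge. \<delta> \<le> P \<epsilon> K L"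
    using edge_lower by blast
  obtain l0 l1 where l0: "0 < l0" and l: "\<And>E K. E \<in> B \<Longrightarrow> K \<in> E \<Longrightarrow> l0 \<le> inv_prob C P0 E K \<and> inv_prob C P0 E K \<le> l1"
    using inv_prob_bounds by blast
  obtain E0 where "E0 \<in> B" using card B_fin by (fastforce simp: C'_eq)
  then obtain K0 where "K0 \<in> E0" using block_ne by blast
  then have K0: "K0 \<in> C" and l1: "0 < l1" and l01: "l0 \<le> l1" using l[OF \<open>E0 \<in> B\<close>, of K0] l0 block_sub[OF \<open>E0 \<in> B\<close>] by auto
  \<comment> \<open>A path in a finite relation can be chosen with at most \<open>card edge\<close>
    steps; the successor yields the strict bound in \<open>merge_cells\<close>.\<close>
  define n where "n = Suc (card edge)"
  \<comment> \<open>\<open>card C\<close> in place of the size of a block, so that one constant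
    serves all blocks.\<close>
  define N where "N = real (card C * n)"
  have N: "1 \<le> N"
  proof -
    have "0 < card C" using C_fin K0 by (auto simp: card_gt_0_iff)
    then have "1 \<le> card C * n" by (simp add: n_def)
    then show ?thesis unfolding N_def by linarith
  qed
  define v where "v = (c * \<delta>) ^ n"
  have v: "0 < v" unfolding v_def using c \<delta> by simp
  \<comment> \<open>One factor \<open>c\<close> comes from the lower comparison and one from the
    upper, \<open>v\<close> from the visits, \<open>N\<close> from adding over cells and steps, and
    \<open>l0 / l1\<close> from exchanging weighted fluxes for unweighted ones.\<close>
  define k where "k = c * c * v * l0 / (N * l1)"
  have k: "0 < k" unfolding k_def using c v l0 l1 N by simp
  have k1: "k \<le> 1"
  proof -
    have "v \<le> 1" unfolding v_def using c \<delta> by (intro power_le_one mult_le_one) auto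
    then have "c * c * v \<le> N" using c v mult_le_one[of "c * c" v] mult_le_one[of c c] N by simp
    then have "c * c * v * l0 \<le> N * l1" using l0 l01 N by (intro mult_mono) auto
    then show ?thesis unfolding k_def using N l1 by simp
  qed
  have path: "\<exists>j<n. (K, L) \<in> (edge \<inter> E \<times> E) ^^ j" if "E \<in> B" "K \<in> E" "L \<in> E" for E K L
  proof -
    have fin: "finite (edge \<inter> E \<times> E)" using edge_fin by blast
    have conn: "(K, L) \<in> (edge \<inter> E \<times> E)\<^sup>*" using that by (rule block_conn)
    obtain j where "j \<le> card (edge \<inter> E \<times> E)" "(K, L) \<in> (edge \<inter> E \<times> E) ^^ j"
      using conn unfolding rtrancl_finite_eq_relpow[OF fin] by blast
    moreover have "card (edge \<inter> E \<times> E) \<le> card edge" using edge_fin by (intro card_mono) auto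
    ultimately show ?thesis unfolding n_def by (intro exI[of _ j]) auto
  qed
  have "\<forall>\<^sub>F \<epsilon> in at_right 0. comparable_at k C' P' \<epsilon>"
    using ev ev\<delta> at_right_pos
  proof eventually_elim
    case (elim \<epsilon>)
    have e: "0 < \<epsilon>" by (rule elim(3))
    show ?case
      unfolding comparable_at_def
    proof (intro ballI)
      fix K' x assume "K' \<in> C'" and "x \<in> cset S K'"
      then obtain E where E: "E \<in> B" and K': "K' = \<Union>E" and x: "x \<in> cset S (\<Union>E)" unfolding C'_eq by auto
      note sub = block_sub[OF E]
      have merge: "merge_cells (Q \<epsilon>) C (cset S) (\<lambda>K L. ennreal (P \<epsilon> K L)) (ennreal c) (ennreal (1 / c)) (ennreal \<delta>)
        E (edge \<inter> E \<times> E) n"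
      proof (intro merge_cells.intro merge_cells_axioms.intro)
        show "step_kernel (Q \<epsilon>)" using e by (rule step_kernel_Q)
        show "exit_op (Q \<epsilon>) (cset S K) (\<lambda>_. 1) x = 1" if "K \<in> C" "x \<in> cset S K" for K x
          using comparable_atD(1)[OF elim(1) that] .
        show "ennreal c * ennreal (P \<epsilon> K L) \<le> exit_op (Q \<epsilon>) (cset S K) (indicator (cset S L)) x"
          if "K \<in> C" "L \<in> C" "K \<noteq> L" "x \<in> cset S K" for K L x
          using comparable_atD(2)[OF elim(1) that(1,4,2,3)] c by (simp add: ennreal_mult')
        show "exit_op (Q \<epsilon>) (cset S K) (indicator (cset S L)) x \<le> ennreal (1 / c) * ennreal (P \<epsilon> K L)"
          if "K \<in> C" "L \<in> C" "K \<noteq> L" "x \<in> cset S K" for K L x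
          using comparable_atD(3)[OF elim(1) that(1,4,2,3)] c by (simp flip: ennreal_mult')
        show "K \<in> E \<and> L \<in> E \<and> K \<noteq> L \<and> ennreal \<delta> \<le> ennreal (P \<epsilon> K L)" if KL: "(K, L) \<in> edge \<inter> E \<times> E" for K L
        proof -
          have "\<delta> \<le> P \<epsilon> K L" using elim(2) KL by blast
          \<comment> \<open>The diagonal of \<open>P\<close> is zero, while the entry of an edge is
            at least \<open>\<delta>\<close>.\<close>
          moreover have "K \<noteq> L" using P_diag[of K \<epsilon>] calculation \<delta> KL sub by auto
          ultimately show ?thesis using KL by (auto intro: ennreal_leI)
        qed
        show "\<exists>j<n. (K, L) \<in> (edge \<inter> E \<times> E) ^^ j" if "K \<in> E" "L \<in> E" for K L
          using path[OF E that] .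
      qed (use C_fin cset_borel cset_disj cset_cover sub c \<delta> in \<open>auto\<close>)
      interpret mc: merge_cells "Q \<epsilon>" C "cset S" "\<lambda>K L. ennreal (P \<epsilon> K L)" "ennreal c" "ennreal (1 / c)" "ennreal \<delta>"
        E "edge \<inter> E \<times> E" n by (rule merge)
      have xA: "x \<in> (\<Union>K\<in>E. cset S K)" using x by (simp add: cset_Union)
      \<comment> \<open>The unweighted flux, in which \<open>merged_bounds\<close> is
        expressed.\<close>
      define F where "F D = (\<Sum>K\<in>E. \<Sum>L\<in>D. P \<epsilon> K L)" for D
      have Pnn: "0 \<le> P \<epsilon> K L" if "D \<subseteq> C" "K \<in> E" "L \<in> D" for D K L
        using P_nonneg[of K L \<epsilon>] e that sub by blast
      have F0: "0 \<le> F D" if "D \<subseteq> C" for D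
        unfolding F_def using Pnn[OF that] by (intro sum_nonneg)
      have F_ennreal: "(\<Sum>K\<in>E. \<Sum>L\<in>D. ennreal (P \<epsilon> K L)) = ennreal (F D)" if "D \<subseteq> C" for D
        unfolding F_def using Pnn[OF that] by (simp add: sum_ennreal sum_nonneg)
      have F_flux: "l0 * F D \<le> flux \<epsilon> E D \<and> flux \<epsilon> E D \<le> l1 * F D" if "D \<subseteq> C" for D
        unfolding F_def flux_def sum_distrib_left using l[OF E] Pnn[OF that]
        by (intro conjI sum_mono mult_right_mono) auto
      have esc_pos: "0 < flux \<epsilon> E (C - E)"
        using flux_regular[OF E, of "C - E"] escape_linked[OF E card] regular_pos e by auto
      have esc_F: "0 < F (C - E)"
        using F_flux[of "C - E"] F0[of "C - E"] esc_pos l1 by (cases "F (C - E) = 0") auto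
      have "exit_op (Q \<epsilon>) (\<Union>K\<in>E. cset S K) (\<lambda>_. 1) x = 1"
      proof -
        \<comment> \<open>A positive total escape flux forces one cluster with a positive escape
          rate, to which \<open>exits_merged\<close> applies.\<close>
        obtain K where K: "K \<in> E" "0 < (\<Sum>L\<in>C - E. P \<epsilon> K L)"
        proof (rule ccontr)
          assume "\<not> thesis"
          then have "F (C - E) \<le> 0" unfolding F_def using that by (intro sum_nonpos[of E]) force
          then show False using esc_F by simp
        qed
        have "(\<Sum>L\<in>C - E. ennreal (P \<epsilon> K L)) = ennreal (\<Sum>L\<in>C - E. P \<epsilon> K L)"
          using Pnn[of "C - E"] K by (intro sum_ennreal) auto
        then have "ennreal c * (\<Sum>L\<in>C - E. ennreal (P \<epsilon> K L)) * (ennreal c * ennreal \<delta>) ^ n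
            = ennreal (c * (\<Sum>L\<in>C - E. P \<epsilon> K L) * (c * \<delta>) ^ n)"
          using K c \<delta> by (simp add: ennreal_power flip: ennreal_mult')
        moreover have "0 < c * (\<Sum>L\<in>C - E. P \<epsilon> K L) * (c * \<delta>) ^ n" using K c \<delta> by simp
        ultimately have "ennreal c * (\<Sum>L\<in>C - E. ennreal (P \<epsilon> K L)) * (ennreal c * ennreal \<delta>) ^ n \<noteq> 0"
          by (metis ennreal_eq_0_iff not_less)
        then show ?thesis by (rule mc.exits_merged[OF K(1) _ xA])
      qed
      moreover have "ennreal (k * P' \<epsilon> (\<Union>E) (\<Union>E')) \<le> exit_op (Q \<epsilon>) (\<Union>K\<in>E. cset S K) (indicator (\<Union>K\<in>E'. cset S K)) x \<and>
         exit_op (Q \<epsilon>) (\<Union>K\<in>E. cset S K) (indicator (\<Union>K\<in>E'. cset S K)) x \<le> ennreal (P' \<epsilon> (\<Union>E) (\<Union>E') / k)"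
        if E': "E' \<in> B" "E \<noteq> E'" for E'
      proof -
        have sub': "E' \<subseteq> C" "E' \<inter> E = {}" using block_sub[OF E'(1)] block_disj[OF E'(1) E] E'(2) by auto
        define u where "u = exit_op (Q \<epsilon>) (\<Union>K\<in>E. cset S K) (indicator (\<Union>K\<in>E'. cset S K)) x"
        have "u \<le> 1" unfolding u_def by (rule mc.exit_op_le_1) (auto simp: indicator_ennreal_le_1 mc.A_borel)
        then obtain ur where ur: "u = ennreal ur" "0 \<le> ur" by (cases u) (auto simp: top_unique)
        note mb = mc.merged_bounds[OF sub' xA, folded u_def, unfolded mc.esc_def F_ennreal[OF sub'(1)]]
        have esc_eq: "(\<Sum>K\<in>E. \<Sum>L\<in>C - E. ennreal (P \<epsilon> K L)) = ennreal (F (C - E))" by (rule F_ennreal) auto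
        have "card E \<le> card C" using sub C_fin by (rule card_mono[rotated])
        then have cN: "real (card E * n) \<le> N" unfolding N_def of_nat_le_iff by (rule mult_le_mono1)
        have FE: "0 \<le> F E'" "0 \<le> F (C - E)" using F0 sub' by auto
        have "c * F E' * v \<le> real (card E * n) * (1 / c) * (ur * F (C - E))"
          using mb(1) c \<delta> FE ur unfolding esc_eq v_def
          by (simp add: ennreal_of_nat_eq_real_of_nat ennreal_power flip: ennreal_mult')
        also have "\<dots> \<le> N * (1 / c) * (ur * F (C - E))"
          using cN c ur FE by (intro mult_right_mono) auto
        finally have low: "c * c * v * F E' \<le> N * (ur * F (C - E))"
          using c by (simp add: field_simps)
        have "c * (ur * F (C - E)) * v \<le> real (card E * n) * (1 / c) * F E'"
          using mb(2) c \<delta> FE ur unfolding esc_eq v_def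
          by (simp add: ennreal_of_nat_eq_real_of_nat ennreal_power flip: ennreal_mult')
        also have "\<dots> \<le> N * (1 / c) * F E'"
          using cN c FE by (intro mult_right_mono) auto
        finally have up: "c * c * v * (ur * F (C - E)) \<le> N * F E'"
          using c by (simp add: field_simps)
        have P'_val: "P' \<epsilon> (\<Union>E) (\<Union>E') = flux \<epsilon> E E' / flux \<epsilon> E (C - E)"
          using E E' by (simp add: P'_eq)
        have ff: "l0 * F E' \<le> flux \<epsilon> E E'" "flux \<epsilon> E E' \<le> l1 * F E'"
          "l0 * F (C - E) \<le> flux \<epsilon> E (C - E)" "flux \<epsilon> E (C - E) \<le> l1 * F (C - E)"
          using F_flux[of E'] F_flux[of "C - E"] sub' by auto
        \<comment> \<open>Dropping the weights in the quotient costs at most the factor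
          \<open>l1 / l0\<close>.\<close>
        have "P' \<epsilon> (\<Union>E) (\<Union>E') \<le> (l1 * F E') / (l0 * F (C - E))"
          unfolding P'_val using ff l0 l1 esc_F FE by (intro frac_le) auto
        then have "k * P' \<epsilon> (\<Union>E) (\<Union>E') \<le> k * ((l1 * F E') / (l0 * F (C - E)))"
          using k by (intro mult_left_mono) auto
        also have "\<dots> = c * c * v * F E' / (N * F (C - E))"
          using l0 l1 by (simp add: k_def)
        also have "\<dots> \<le> ur" using low N esc_F by (simp add: pos_divide_le_eq mult_ac)
        finally have "k * P' \<epsilon> (\<Union>E) (\<Union>E') \<le> ur" .
        moreover have "ur \<le> P' \<epsilon> (\<Union>E) (\<Union>E') / k"
        proof -
          have ccv: "0 < c * c * v" using c v by simp
          have "ur \<le> N * F E' / (c * c * v * F (C - E))"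
            using up mult_pos_pos[OF ccv esc_F] by (simp only: pos_le_divide_eq mult_ac)
          also have "\<dots> = ((l0 * F E') / (l1 * F (C - E))) / k"
            using l0 l1 N ccv by (simp add: k_def mult_ac)
          also have "(l0 * F E') / (l1 * F (C - E)) \<le> P' \<epsilon> (\<Union>E) (\<Union>E')"
            unfolding P'_val using ff l1 esc_pos order_trans[OF mult_nonneg_nonneg[of l0 "F E'"] ff(1)] l0 FE
            by (intro frac_le) auto
          finally show ?thesis using k by (simp add: divide_right_mono)
        qed
        ultimately show ?thesis unfolding u_def[symmetric] ur(1) by (auto intro: ennreal_leI)
      qed
      ultimately show "exit_op (Q \<epsilon>) (cset S K') (\<lambda>_. 1) x = 1 \<and>
       (\<forall>L\<in>C'. K' \<noteq> L \<longrightarrow>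
         ennreal (k * P' \<epsilon> K' L) \<le> exit_op (Q \<epsilon>) (cset S K') (indicator (cset S L)) x \<and>
         exit_op (Q \<epsilon>) (cset S K') (indicator (cset S L)) x \<le> ennreal (P' \<epsilon> K' L / k))"
        unfolding K' C'_eq cset_Union by (metis (no_types, lifting) cset_Union imageE)
    qed
  qed
  then show ?thesis unfolding comparable_level_def using k k1 by blast
qed

end

context renewal_hierarchy
begin

lemma good_comparable_level:
  assumes "\<forall>r'\<le>r. 1 < card (clusters M Pm r')"
  shows "good_level (clusters M Pm r) (Prank M Pm r) \<and> comparable_level (clusters M Pm r) (Prank M Pm r)"
  using assms
proof (induction r)
  case 0
  show ?case using good_level_0 comparable_level_0 by blast
next
  case (Suc r)
  define C where "C = clusters M Pm r"
  define P where "P = Prank M Pm r"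
  have IH: "good_level C P" "comparable_level C P" using Suc unfolding C_def P_def by auto
  interpret level_step M S Q Pm tau C P by unfold_locales (rule IH)
  have lev: "level M Pm (Suc r) = next_level (C, P)"
    by (simp add: level_def C_def P_def clusters_def Prank_def)
  have eq: "clusters M Pm (Suc r) = fst (next_level (C, P))" "Prank M Pm (Suc r) = snd (next_level (C, P))"
    unfolding lev[symmetric] clusters_def Prank_def by simp_all
  have "1 < card (fst (next_level (C, P)))" using Suc.prems unfolding eq[symmetric] by blast
  then show ?case unfolding eq using good_next comparable_next IH(2) by blast
qed

end

section \<open>Passing from the process to the kernel\<close>

text \<open>The second component of the argument is the time accumulated so far.\<close>
definition killed_acc :: "('a::metric_space \<Rightarrow> ('a \<times> real) measure) \<Rightarrow> 'a set \<Rightarrow> ('a \<times> real \<Rightarrow> ennreal) \<Rightarrow> 'a \<times> real \<Rightarrow> ennreal" where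
  "killed_acc q A g p = (\<integral>\<^sup>+ z. indicator A (fst z) * g (fst z, snd p + \<bar>snd z\<bar>) \<partial>q (fst p))"

text \<open>For \<open>B\<close> disjoint from \<open>A\<close>, the second moment of the
  accumulated absolute holding time on the event of an exit into \<open>B\<close>, before division
  by its probability. The clock starts at 0.\<close>

definition exit_square :: "('a::metric_space \<Rightarrow> ('a \<times> real) measure) \<Rightarrow> 'a set \<Rightarrow> 'a set \<Rightarrow> 'a \<Rightarrow> ennreal" where
  "exit_square q A B x = (\<Sum>n. (killed_acc q A ^^ n) (killed_acc q B (\<lambda>p. (ennreal (snd p))\<^sup>2)) (x, 0))"

context step_kernel
begin

lemma killed_acc_integrand_meas:
  fixes g :: "'a \<times> real \<Rightarrow> ennreal"
  assumes [measurable]: "A \<in> sets borel" "g \<in> borel_measurable MT"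
  shows "(\<lambda>z. indicator A (fst z) * g (fst z, s + \<bar>snd z\<bar>)) \<in> borel_measurable MT"
proof -
  have "(\<lambda>z. (fst z, s + \<bar>snd z\<bar>)) \<in> (MT :: ('a \<times> real) measure) \<rightarrow>\<^sub>M MT"
    by (subst (2) MT_def) measurable
  from measurable_compose[OF this assms(2)]
  have [measurable]: "(\<lambda>z. g (fst z, s + \<bar>snd z\<bar>)) \<in> borel_measurable MT" .
  show ?thesis by measurable
qed

lemma killed_acc_meas:
  assumes [measurable]: "A \<in> sets borel" "g \<in> borel_measurable MT"
  shows "killed_acc q A g \<in> borel_measurable MT"
proof -
  have [measurable]: "(\<lambda>w. (fst (snd w), snd (fst w) + \<bar>snd (snd w)\<bar>)) \<in> (MT :: ('a \<times> real) measure) \<Otimes>\<^sub>M MT \<rightarrow>\<^sub>M MT"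
    by (subst (3) MT_def) measurable
  have "(\<lambda>p. \<integral>\<^sup>+ z. (\<lambda>w. indicator A (fst (snd w)) * g (fst (snd w), snd (fst w) + \<bar>snd (snd w)\<bar>)) (p, z) \<partial>q (fst p))
      \<in> borel_measurable MT"
    by (rule nn_integral_measurable_subprob_algebra2[where N=MT]) measurable
  then show ?thesis by (simp add: killed_acc_def[abs_def])
qed

lemma killed_acc_iter_meas:
  "A \<in> sets borel \<Longrightarrow> g \<in> borel_measurable MT \<Longrightarrow> (killed_acc q A ^^ n) g \<in> borel_measurable MT"
  by (induction n) (auto intro: killed_acc_meas)

lemma killed_acc_spatial: "killed_acc q A (\<lambda>p. f (fst p)) = (\<lambda>p. killed q A f (fst p))"
  by (auto simp: killed_acc_def killed_def step_def)

lemma killed_acc_iter_spatial: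
  "(killed_acc q A ^^ n) (\<lambda>p. f (fst p)) = (\<lambda>p. (killed q A ^^ n) f (fst p))"
  by (induction n) (auto simp: killed_acc_spatial)

end

locale renewal_process = step_kernel q for q :: "'a::metric_space \<Rightarrow> ('a \<times> real) measure" +
  fixes x :: 'a and \<Omega> :: "'w measure" and X :: "nat \<Rightarrow> 'w \<Rightarrow> 'a" and T :: "nat \<Rightarrow> 'w \<Rightarrow> real"
  assumes mr: "markov_renewal q x \<Omega> X T"
begin

sublocale prob_space \<Omega> using mr by (simp add: markov_renewal_def)

lemma X_meas [measurable]: "X n \<in> \<Omega> \<rightarrow>\<^sub>M borel" and T_meas [measurable]: "T n \<in> \<Omega> \<rightarrow>\<^sub>M borel"
  using mr by (auto simp: markov_renewal_def)

lemma X_0: "\<omega> \<in> space \<Omega> \<Longrightarrow> X 0 \<omega> = x"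
  using mr by (auto simp: markov_renewal_def)

definition hist :: "nat \<Rightarrow> 'w \<Rightarrow> nat \<Rightarrow> 'a \<times> real" where
  "hist n \<omega> = (\<lambda>m\<in>{..n}. (X m \<omega>, T m \<omega>))"

definition nxt :: "nat \<Rightarrow> 'w \<Rightarrow> 'a \<times> real" where
  "nxt n \<omega> = (X (Suc n) \<omega>, T (Suc n) \<omega>)"

abbreviation "H n \<equiv> PiM {..n} (\<lambda>_. MT :: ('a \<times> real) measure)"

lemma XT_meas [measurable]: "(\<lambda>\<omega>. (X n \<omega>, T n \<omega>)) \<in> \<Omega> \<rightarrow>\<^sub>M MT"
  unfolding MT_def by measurable

lemma hist_meas [measurable]: "hist n \<in> \<Omega> \<rightarrow>\<^sub>M H n"
  unfolding hist_def by (rule measurable_restrict) measurable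

lemma nxt_meas [measurable]: "nxt n \<in> \<Omega> \<rightarrow>\<^sub>M MT"
  unfolding nxt_def by measurable

lemma markov_emeasure:
  assumes A: "A \<in> sets (H n)" and B: "B \<in> sets MT"
  shows "emeasure \<Omega> {\<omega>\<in>space \<Omega>. hist n \<omega> \<in> A \<and> nxt n \<omega> \<in> B}
    = (\<integral>\<^sup>+ \<omega>. indicator A (hist n \<omega>) * emeasure (q (X n \<omega>)) B \<partial>\<Omega>)"
proof -
  note [measurable] = A B
  have [measurable]: "(\<lambda>y. measure (q y) B) \<in> borel_measurable borel"
    using measurable_compose[OF q_subprob measurable_emeasure_subprob_algebra[OF B]]
    unfolding measure_def by measurable
  have "measure \<Omega> {\<omega>\<in>space \<Omega>. hist n \<omega> \<in> A \<and> nxt n \<omega> \<in> B}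
      = (\<integral>\<omega>. indicator A (hist n \<omega>) * measure (q (X n \<omega>)) B \<partial>\<Omega>)"
    using mr A B unfolding markov_renewal_def hist_def nxt_def by blast
  also have "ennreal \<dots> = (\<integral>\<^sup>+ \<omega>. ennreal (indicator A (hist n \<omega>) * measure (q (X n \<omega>)) B) \<partial>\<Omega>)"
  proof (rule nn_integral_eq_integral[symmetric])
    show "integrable \<Omega> (\<lambda>\<omega>. indicator A (hist n \<omega>) * measure (q (X n \<omega>)) B)"
      by (rule integrable_const_bound[where B=1])
        (auto simp: prob_space.prob_le_1[OF prob_q] split: split_indicator)
  qed auto
  also have "\<dots> = (\<integral>\<^sup>+ \<omega>. indicator A (hist n \<omega>) * emeasure (q (X n \<omega>)) B \<partial>\<Omega>)"
    by (intro nn_integral_cong) (auto simp: finite_measure.emeasure_eq_measure[OF prob_space.finite_measure[OF prob_q]]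
        split: split_indicator)
  finally show ?thesis by (simp add: emeasure_eq_measure)
qed

text \<open>\<open>markov_renewal\<close> states the Markov property on product sets only. The joint
  law of history and next pair agrees on these sets with the law that draws the next pair from
  \<open>q\<close>; they are stable under intersection and generate the product
  sigma-algebra.\<close>

lemma markov_nn_integral:
  assumes F [measurable]: "F \<in> borel_measurable (H n \<Otimes>\<^sub>M MT)"
  shows "(\<integral>\<^sup>+ \<omega>. F (hist n \<omega>, nxt n \<omega>) \<partial>\<Omega>) = (\<integral>\<^sup>+ \<omega>. (\<integral>\<^sup>+ z. F (hist n \<omega>, z) \<partial>q (X n \<omega>)) \<partial>\<Omega>)"
proof -
  define M1 where "M1 = distr \<Omega> (H n \<Otimes>\<^sub>M MT) (\<lambda>\<omega>. (hist n \<omega>, nxt n \<omega>))"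
  define N where "N \<omega> = distr (q (X n \<omega>)) (H n \<Otimes>\<^sub>M MT) (\<lambda>z. (hist n \<omega>, z))" for \<omega>
  have N [measurable]: "N \<in> \<Omega> \<rightarrow>\<^sub>M subprob_algebra (H n \<Otimes>\<^sub>M MT)"
    unfolding N_def by (rule measurable_distr2[where M=MT]) measurable
  define M2 where "M2 = \<Omega> \<bind> N"
  have ne: "space \<Omega> \<noteq> {}" by (rule not_empty)
  have sets_N: "sets (N \<omega>) = sets (H n \<Otimes>\<^sub>M MT)" for \<omega> by (simp add: N_def)
  have pair [measurable]: "(\<lambda>z. (hist n \<omega>, z)) \<in> q (X n \<omega>) \<rightarrow>\<^sub>M H n \<Otimes>\<^sub>M MT" if "\<omega> \<in> space \<Omega>" for \<omega>
    using measurable_space[OF hist_meas that] by measurable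
  have eq: "M1 = M2"
  proof (rule measure_eqI_generator_eq[where \<Omega>="space (H n) \<times> space MT" and A="\<lambda>_. space (H n) \<times> space MT"])
    show "Int_stable {a \<times> b |a b. a \<in> sets (H n) \<and> b \<in> sets (MT :: ('a \<times> real) measure)}"
      by (rule Int_stable_pair_measure_generator)
    show "{a \<times> b |a b. a \<in> sets (H n) \<and> b \<in> sets (MT :: ('a \<times> real) measure)} \<subseteq> Pow (space (H n) \<times> space MT)"
      by (rule pair_measure_closed)
    show "sets M1 = sigma_sets (space (H n) \<times> space MT) {a \<times> b |a b. a \<in> sets (H n) \<and> b \<in> sets MT}"
      by (simp add: M1_def sets_pair_measure)
    show "sets M2 = sigma_sets (space (H n) \<times> space MT) {a \<times> b |a b. a \<in> sets (H n) \<and> b \<in> sets MT}"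
      unfolding M2_def by (subst sets_bind[OF sets_N ne]) (simp add: sets_pair_measure)
    show "emeasure M1 (space (H n) \<times> space MT) \<noteq> \<infinity>"
    proof -
      interpret M1: prob_space M1 unfolding M1_def by (rule prob_space_distr) measurable
      show ?thesis using M1.emeasure_finite by simp
    qed
    fix Y assume "Y \<in> {a \<times> b |a b. a \<in> sets (H n) \<and> b \<in> sets (MT :: ('a \<times> real) measure)}"
    then obtain A B where Y: "Y = A \<times> B" and [measurable]: "A \<in> sets (H n)" "B \<in> sets MT" by auto
    have "emeasure M1 Y = emeasure \<Omega> ((\<lambda>\<omega>. (hist n \<omega>, nxt n \<omega>)) -` (A \<times> B) \<inter> space \<Omega>)"
      unfolding M1_def Y by (rule emeasure_distr) measurable
    also have "\<dots> = emeasure \<Omega> {\<omega>\<in>space \<Omega>. hist n \<omega> \<in> A \<and> nxt n \<omega> \<in> B}"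
      by (rule arg_cong[where f="emeasure \<Omega>"]) auto
    also have "\<dots> = (\<integral>\<^sup>+ \<omega>. indicator A (hist n \<omega>) * emeasure (q (X n \<omega>)) B \<partial>\<Omega>)"
      by (rule markov_emeasure) measurable
    also have "\<dots> = (\<integral>\<^sup>+ \<omega>. emeasure (N \<omega>) (A \<times> B) \<partial>\<Omega>)"
    proof (rule nn_integral_cong)
      fix \<omega> assume w: "\<omega> \<in> space \<Omega>"
      have "emeasure (N \<omega>) (A \<times> B) = emeasure (q (X n \<omega>)) ((\<lambda>z. (hist n \<omega>, z)) -` (A \<times> B) \<inter> space (q (X n \<omega>)))"
        unfolding N_def by (rule emeasure_distr[OF pair[OF w]]) measurable
      also have "(\<lambda>z. (hist n \<omega>, z)) -` (A \<times> B) \<inter> space (q (X n \<omega>)) = (if hist n \<omega> \<in> A then B else {})"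
        by (auto simp: space_q)
      finally show "indicator A (hist n \<omega>) * emeasure (q (X n \<omega>)) B = emeasure (N \<omega>) (A \<times> B)"
        by (auto split: split_indicator)
    qed
    also have "\<dots> = emeasure M2 Y"
      unfolding M2_def Y by (rule emeasure_bind[OF ne N, symmetric]) measurable
    finally show "emeasure M1 Y = emeasure M2 Y" .
  qed (auto simp: sets.top)
  have "(\<integral>\<^sup>+ \<omega>. F (hist n \<omega>, nxt n \<omega>) \<partial>\<Omega>) = (\<integral>\<^sup>+ w. F w \<partial>M1)"
    unfolding M1_def by (subst nn_integral_distr) auto
  also have "\<dots> = (\<integral>\<^sup>+ \<omega>. (\<integral>\<^sup>+ w. F w \<partial>N \<omega>) \<partial>\<Omega>)"
    unfolding eq M2_def by (rule nn_integral_bind[OF F N])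
  also have "\<dots> = (\<integral>\<^sup>+ \<omega>. (\<integral>\<^sup>+ z. F (hist n \<omega>, z) \<partial>q (X n \<omega>)) \<partial>\<Omega>)"
    unfolding N_def by (intro nn_integral_cong) (subst nn_integral_distr[OF pair], auto)
  finally show ?thesis .
qed

definition acc :: "nat \<Rightarrow> 'w \<Rightarrow> real" where "acc n \<omega> = (\<Sum>m\<in>{1..n}. \<bar>T m \<omega>\<bar>)"

text \<open>Time 0 is left out, matching \<open>exit_at\<close> and \<open>killed\<close>, which
  constrain the chain only from time 1 on.\<close>

definition stays :: "'a set \<Rightarrow> nat \<Rightarrow> 'w \<Rightarrow> bool" where
  "stays A n \<omega> \<longleftrightarrow> (\<forall>m\<in>{1..n}. X m \<omega> \<in> A)"

lemma acc_meas [measurable]: "acc n \<in> borel_measurable \<Omega>"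
  unfolding acc_def[abs_def] by measurable

lemma stays_meas [measurable]:
  assumes [measurable]: "A \<in> sets borel"
  shows "Measurable.pred \<Omega> (stays A n)"
  unfolding stays_def[abs_def] by measurable

text \<open>The history enters only through the survival event and the accumulated time, so
  integrating out the last transition applies the kernel to the pair of position and clock.\<close>

lemma markov_step:
  assumes A [measurable]: "A \<in> sets borel" and B [measurable]: "B \<in> sets borel"
    and g [measurable]: "g \<in> borel_measurable MT"
  shows "(\<integral>\<^sup>+ \<omega>. of_bool (stays A n \<omega>) * (indicator B (X (Suc n) \<omega>) * g (X (Suc n) \<omega>, acc (Suc n) \<omega>)) \<partial>\<Omega>)
    = (\<integral>\<^sup>+ \<omega>. of_bool (stays A n \<omega>) * killed_acc q B g (X n \<omega>, acc n \<omega>) \<partial>\<Omega>)"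
proof -
  define F :: "(nat \<Rightarrow> 'a \<times> real) \<times> ('a \<times> real) \<Rightarrow> ennreal" where
    "F = (\<lambda>(h, z). of_bool (\<forall>m\<in>{1..n}. fst (h m) \<in> A) *
       (indicator B (fst z) * g (fst z, (\<Sum>m\<in>{1..n}. \<bar>snd (h m)\<bar>) + \<bar>snd z\<bar>)))"
  have comp: "(\<lambda>w. fst w m) \<in> H n \<Otimes>\<^sub>M MT \<rightarrow>\<^sub>M MT" if "m \<in> {1..n}" for m
    using that by (intro measurable_compose[OF measurable_fst measurable_component_singleton]) auto
  have [measurable]: "Measurable.pred (H n \<Otimes>\<^sub>M MT) (\<lambda>w. \<forall>m\<in>{1..n}. fst (fst w m) \<in> A)"
    using measurable_compose[OF comp fst_MT] A by (intro pred_intros_finite) (auto intro!: pred_sets2[OF A])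
  have [measurable]: "(\<lambda>w. \<Sum>m\<in>{1..n}. \<bar>snd (fst w m)\<bar>) \<in> borel_measurable (H n \<Otimes>\<^sub>M MT)"
    using measurable_compose[OF comp snd_MT] by (intro borel_measurable_sum borel_measurable_abs)
  have [measurable]: "(\<lambda>w. (fst (snd w), (\<Sum>m\<in>{1..n}. \<bar>snd (fst w m)\<bar>) + \<bar>snd (snd w)\<bar>)) \<in> H n \<Otimes>\<^sub>M MT \<rightarrow>\<^sub>M MT"
    by (subst (3) MT_def) measurable
  have F: "F \<in> borel_measurable (H n \<Otimes>\<^sub>M MT)"
    unfolding F_def split_beta' by measurable
  have h: "hist n \<omega> m = (X m \<omega>, T m \<omega>)" if "m \<in> {1..n}" for m \<omega> using that by (simp add: hist_def)
  have sum: "(\<Sum>m\<in>{1..n}. \<bar>snd (hist n \<omega> m)\<bar>) = acc n \<omega>" for \<omega>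
    unfolding acc_def by (intro sum.cong) (auto simp: h)
  have st: "(\<forall>m\<in>{1..n}. fst (hist n \<omega> m) \<in> A) \<longleftrightarrow> stays A n \<omega>" for \<omega>
    unfolding stays_def by (auto simp: h)
  have acc_Suc: "acc (Suc n) \<omega> = acc n \<omega> + \<bar>T (Suc n) \<omega>\<bar>" for \<omega> by (simp add: acc_def)
  have "(\<integral>\<^sup>+ \<omega>. of_bool (stays A n \<omega>) * (indicator B (X (Suc n) \<omega>) * g (X (Suc n) \<omega>, acc (Suc n) \<omega>)) \<partial>\<Omega>)
      = (\<integral>\<^sup>+ \<omega>. F (hist n \<omega>, nxt n \<omega>) \<partial>\<Omega>)"
    by (simp only: F_def nxt_def sum st acc_Suc prod.case fst_conv snd_conv)
  also have "\<dots> = (\<integral>\<^sup>+ \<omega>. (\<integral>\<^sup>+ z. F (hist n \<omega>, z) \<partial>q (X n \<omega>)) \<partial>\<Omega>)"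
    by (rule markov_nn_integral[OF F])
  also have "\<dots> = (\<integral>\<^sup>+ \<omega>. of_bool (stays A n \<omega>) * killed_acc q B g (X n \<omega>, acc n \<omega>) \<partial>\<Omega>)"
  proof (rule nn_integral_cong)
    fix \<omega>
    have "(\<lambda>z. indicator B (fst z) * g (fst z, acc n \<omega> + \<bar>snd z\<bar>)) \<in> borel_measurable (q (X n \<omega>))"
      using killed_acc_integrand_meas[OF B g] by (simp cong: measurable_cong_sets add: sets_q)
    then show "(\<integral>\<^sup>+ z. F (hist n \<omega>, z) \<partial>q (X n \<omega>)) = of_bool (stays A n \<omega>) * killed_acc q B g (X n \<omega>, acc n \<omega>)"
      by (simp only: F_def sum st killed_acc_def nn_integral_cmult prod.case fst_conv snd_conv)
  qed
  finally show ?thesis .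
qed

text \<open>The last transition is absorbed into the test function, which is why \<open>g\<close> is
  generalized in the induction.\<close>

lemma markov_iter:
  assumes A [measurable]: "A \<in> sets borel" and g: "g \<in> borel_measurable MT"
  shows "(\<integral>\<^sup>+ \<omega>. of_bool (stays A n \<omega>) * g (X n \<omega>, acc n \<omega>) \<partial>\<Omega>) = (killed_acc q A ^^ n) g (x, 0)"
  using g
proof (induction n arbitrary: g)
  case 0
  have "(\<integral>\<^sup>+ \<omega>. of_bool (stays A 0 \<omega>) * g (X 0 \<omega>, acc 0 \<omega>) \<partial>\<Omega>) = (\<integral>\<^sup>+ \<omega>. g (x, 0) \<partial>\<Omega>)"
    by (intro nn_integral_cong) (simp add: stays_def acc_def X_0)
  then show ?case by (simp add: emeasure_space_1)
next
  case (Suc n)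
  have "stays A (Suc n) \<omega> \<longleftrightarrow> stays A n \<omega> \<and> X (Suc n) \<omega> \<in> A" for \<omega>
    by (auto simp: stays_def atLeastAtMostSuc_conv)
  then have "(\<integral>\<^sup>+ \<omega>. of_bool (stays A (Suc n) \<omega>) * g (X (Suc n) \<omega>, acc (Suc n) \<omega>) \<partial>\<Omega>)
    = (\<integral>\<^sup>+ \<omega>. of_bool (stays A n \<omega>) * (indicator A (X (Suc n) \<omega>) * g (X (Suc n) \<omega>, acc (Suc n) \<omega>)) \<partial>\<Omega>)"
    by (intro nn_integral_cong) (auto split: split_indicator)
  also have "\<dots> = (\<integral>\<^sup>+ \<omega>. of_bool (stays A n \<omega>) * killed_acc q A g (X n \<omega>, acc n \<omega>) \<partial>\<Omega>)"
    by (rule markov_step[OF A A Suc.prems])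
  also have "\<dots> = (killed_acc q A ^^ n) (killed_acc q A g) (x, 0)"
    by (rule Suc.IH[OF killed_acc_meas[OF A Suc.prems]])
  finally show ?case by (simp add: funpow_swap1)
qed

text \<open>\<open>visits\<close> also inspects the exit time itself, but that position lies outside
  \<open>A\<close>. As \<open>B \<subseteq> A\<close>, a counted visit at time n entails survival up
  to and including n.\<close>

lemma nn_integral_visits:
  assumes A [measurable]: "A \<in> sets borel" and B [measurable]: "B \<in> sets borel" and sub: "B \<subseteq> A"
  shows "(\<integral>\<^sup>+ \<omega>. visits A B X \<omega> \<partial>\<Omega>) = (\<Sum>n. (killed q A ^^ n) (indicator B) x)"
proof -
  have "(if \<forall>m. 0 < m \<and> m < n \<longrightarrow> X m \<omega> \<in> A then ennreal (indicator B (X n \<omega>)) else 0)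
      = of_bool (stays A n \<omega>) * indicator B (X n \<omega>)" if "\<omega> \<in> space \<Omega>" for n \<omega>
  proof (cases "X n \<omega> \<in> B")
    case True
    then have "X n \<omega> \<in> A" using sub by auto
    then have "stays A n \<omega> \<longleftrightarrow> (\<forall>m. 0 < m \<and> m < n \<longrightarrow> X m \<omega> \<in> A)"
      unfolding stays_def by (metis Suc_le_eq atLeastAtMost_iff le_neq_implies_less less_imp_le One_nat_def)
    then show ?thesis using True by simp
  qed simp
  then have "(\<integral>\<^sup>+ \<omega>. visits A B X \<omega> \<partial>\<Omega>) = (\<integral>\<^sup>+ \<omega>. (\<Sum>n. of_bool (stays A n \<omega>) * indicator B (X n \<omega>)) \<partial>\<Omega>)"
    unfolding visits_def by (intro nn_integral_cong suminf_cong) blast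
  also have "\<dots> = (\<Sum>n. \<integral>\<^sup>+ \<omega>. of_bool (stays A n \<omega>) * indicator B (X n \<omega>) \<partial>\<Omega>)"
    by (rule nn_integral_suminf) measurable
  also have "\<dots> = (\<Sum>n. (killed q A ^^ n) (indicator B) x)"
  proof (rule suminf_cong)
    fix n
    have "(\<lambda>p. indicator B (fst p) :: ennreal) \<in> borel_measurable MT" by measurable
    from markov_iter[OF A this, of n]
    show "(\<integral>\<^sup>+ \<omega>. of_bool (stays A n \<omega>) * indicator B (X n \<omega>) \<partial>\<Omega>) = (killed q A ^^ n) (indicator B) x"
      by (simp add: killed_acc_iter_spatial)
  qed
  finally show ?thesis .
qed

lemma exit_at_Suc:
  assumes "A \<inter> B = {}"
  shows "exit_at A X (Suc n) \<omega> \<and> X (Suc n) \<omega> \<in> B \<longleftrightarrow> stays A n \<omega> \<and> X (Suc n) \<omega> \<in> B"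
  using assms unfolding exit_at_def stays_def by (auto simp: less_Suc_eq_le Suc_le_eq)

lemma exit_markov:
  assumes A [measurable]: "A \<in> sets borel" and B [measurable]: "B \<in> sets borel" and disj: "A \<inter> B = {}"
    and g: "g \<in> borel_measurable MT"
  shows "(\<integral>\<^sup>+ \<omega>. of_bool (exit_at A X (Suc n) \<omega> \<and> X (Suc n) \<omega> \<in> B) * g (X (Suc n) \<omega>, acc (Suc n) \<omega>) \<partial>\<Omega>)
    = (killed_acc q A ^^ n) (killed_acc q B g) (x, 0)"
proof -
  have "(\<integral>\<^sup>+ \<omega>. of_bool (exit_at A X (Suc n) \<omega> \<and> X (Suc n) \<omega> \<in> B) * g (X (Suc n) \<omega>, acc (Suc n) \<omega>) \<partial>\<Omega>)
    = (\<integral>\<^sup>+ \<omega>. of_bool (stays A n \<omega>) * (indicator B (X (Suc n) \<omega>) * g (X (Suc n) \<omega>, acc (Suc n) \<omega>)) \<partial>\<Omega>)"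
    unfolding exit_at_Suc[OF disj] by (intro nn_integral_cong) (auto split: split_indicator)
  also have "\<dots> = (\<integral>\<^sup>+ \<omega>. of_bool (stays A n \<omega>) * killed_acc q B g (X n \<omega>, acc n \<omega>) \<partial>\<Omega>)"
    by (rule markov_step[OF A B g])
  also have "\<dots> = (killed_acc q A ^^ n) (killed_acc q B g) (x, 0)"
    by (rule markov_iter[OF A killed_acc_meas[OF B g]])
  finally show ?thesis .
qed

lemma exit_meas [measurable]:
  assumes [measurable]: "A \<in> sets borel" "B \<in> sets borel"
  shows "Measurable.pred \<Omega> (\<lambda>\<omega>. exit_at A X n \<omega> \<and> X n \<omega> \<in> B)"
  unfolding exit_at_def by measurable

text \<open>The exit time is unique, so the event is a disjoint union over its values, whose
  probabilities are the terms of the series in \<open>exit_op\<close>.\<close>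

lemma emeasure_exit:
  assumes A [measurable]: "A \<in> sets borel" and B [measurable]: "B \<in> sets borel" and disj: "A \<inter> B = {}"
  shows "emeasure \<Omega> {\<omega>\<in>space \<Omega>. \<exists>n. exit_at A X n \<omega> \<and> X n \<omega> \<in> B} = exit_op q A (indicator B) x"
proof -
  define Ev where "Ev n = {\<omega>\<in>space \<Omega>. exit_at A X (Suc n) \<omega> \<and> X (Suc n) \<omega> \<in> B}" for n
  have [measurable]: "Ev n \<in> sets \<Omega>" for n unfolding Ev_def by measurable
  have uniq: "m = n" if "exit_at A X m \<omega>" "exit_at A X n \<omega>" for m n \<omega>
    using that unfolding exit_at_def by (metis nat_neq_iff)
  have "{\<omega>\<in>space \<Omega>. \<exists>n. exit_at A X n \<omega> \<and> X n \<omega> \<in> B} = (\<Union>n. Ev n)"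
    unfolding Ev_def by (auto simp: exit_at_def gr0_conv_Suc)
  also have "emeasure \<Omega> (\<Union>n. Ev n) = (\<Sum>n. emeasure \<Omega> (Ev n))"
    by (rule suminf_emeasure[symmetric]) (use uniq in \<open>fastforce simp: disjoint_family_on_def Ev_def\<close>)+
  also have "\<dots> = (\<Sum>n. (killed q A ^^ n) (step q (\<lambda>z. indicator (- A) z * indicator B z)) x)"
  proof (rule suminf_cong)
    fix n
    have "emeasure \<Omega> (Ev n) = (\<integral>\<^sup>+ \<omega>. of_bool (exit_at A X (Suc n) \<omega> \<and> X (Suc n) \<omega> \<in> B) * 1 \<partial>\<Omega>)"
      unfolding nn_integral_indicator[of "Ev n" \<Omega>, symmetric, OF \<open>Ev n \<in> sets \<Omega>\<close>]
      by (intro nn_integral_cong) (auto simp: Ev_def split: split_indicator)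
    also have "\<dots> = (killed_acc q A ^^ n) (killed_acc q B (\<lambda>_. 1)) (x, 0)"
      using exit_markov[OF A B disj, of "\<lambda>_. 1" n] by simp
    also have "\<dots> = (killed q A ^^ n) (killed q B (\<lambda>_. 1)) x"
      using killed_acc_spatial[of B "\<lambda>_. 1"] by (simp add: killed_acc_iter_spatial)
    also have "killed q B (\<lambda>_. 1) = step q (\<lambda>z. indicator (- A) z * indicator B z)"
      unfolding killed_def using disj by (intro arg_cong[where f="step q"] ext) (auto split: split_indicator)
    finally show "emeasure \<Omega> (Ev n) = (killed q A ^^ n) (step q (\<lambda>z. indicator (- A) z * indicator B z)) x" .
  qed
  finally show ?thesis by (simp add: exit_op_def)
qed

lemma exit_mom2_le:
  assumes A [measurable]: "A \<in> sets borel" and B [measurable]: "B \<in> sets borel" and disj: "A \<inter> B = {}"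
  shows "exit_mom2 A B \<Omega> X T \<le>
    exit_square q A B x / exit_op q A (indicator B) x"
proof -
  have sq [measurable]: "(\<lambda>p. (ennreal (snd p))\<^sup>2) \<in> borel_measurable (MT :: ('a \<times> real) measure)" by measurable
  define f where "f n \<omega> = of_bool (exit_at A X n \<omega> \<and> X n \<omega> \<in> B) * (ennreal (acc n \<omega>))\<^sup>2" for n \<omega>
  have [measurable]: "f n \<in> borel_measurable \<Omega>" for n unfolding f_def[abs_def] by measurable
  \<comment> \<open>Replacing holding times by their absolute values can only enlarge the square of
    the sum.\<close>
  have le: "(if exit_at A X n \<omega> \<and> X n \<omega> \<in> B then ennreal ((\<Sum>m\<in>{1..n}. T m \<omega>) ^ 2) else 0) \<le> f n \<omega>" for n \<omega>
  proof -
    have "\<bar>\<Sum>m\<in>{1..n}. T m \<omega>\<bar> \<le> acc n \<omega>" unfolding acc_def by (rule sum_abs)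
    then have "(\<Sum>m\<in>{1..n}. T m \<omega>)\<^sup>2 \<le> (acc n \<omega>)\<^sup>2" by (metis abs_ge_zero power2_abs power_mono)
    moreover have "0 \<le> acc n \<omega>" unfolding acc_def by (rule sum_nonneg) simp
    ultimately show ?thesis by (auto simp: f_def ennreal_power intro!: ennreal_leI)
  qed
  have "(\<integral>\<^sup>+ \<omega>. (\<Sum>n. if exit_at A X n \<omega> \<and> X n \<omega> \<in> B then ennreal ((\<Sum>m\<in>{1..n}. T m \<omega>) ^ 2) else 0) \<partial>\<Omega>)
      \<le> (\<integral>\<^sup>+ \<omega>. (\<Sum>n. f n \<omega>) \<partial>\<Omega>)"
    by (intro nn_integral_mono suminf_le summableI le)
  also have "\<dots> = (\<integral>\<^sup>+ \<omega>. (\<Sum>n. f (Suc n) \<omega>) \<partial>\<Omega>)"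
  proof (intro nn_integral_cong)
    fix \<omega>
    have "f 0 \<omega> = 0" by (simp add: f_def exit_at_def)
    then show "(\<Sum>n. f n \<omega>) = (\<Sum>n. f (Suc n) \<omega>)"
      using suminf_offset[of "\<lambda>n. f n \<omega>" 1] by (simp add: summableI)
  qed
  also have "\<dots> = (\<Sum>n. \<integral>\<^sup>+ \<omega>. f (Suc n) \<omega> \<partial>\<Omega>)"
    by (rule nn_integral_suminf) measurable
  also have "\<dots> = exit_square q A B x"
    unfolding f_def exit_square_def using exit_markov[OF A B disj sq] by simp
  finally show ?thesis
    unfolding exit_mom2_def emeasure_exit[OF A B disj] by (rule divide_right_mono_ennreal)
qed

end

section \<open>Second moments of the exit time\<close>

text \<open>Left unnormalized so that moments add up over disjoint targets and stay meaningful when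
  \<open>D\<close> has probability 0.\<close>

definition moment :: "('a::metric_space \<Rightarrow> ('a \<times> real) measure) \<Rightarrow> nat \<Rightarrow> 'a set \<Rightarrow> 'a \<Rightarrow> ennreal" where
  "moment q k D y = (\<integral>\<^sup>+ z. indicator D (fst z) * ennreal \<bar>snd z\<bar> ^ k \<partial>q y)"

context step_kernel
begin

text \<open>The clock only advances, so comparison at times t \<ge> s suffices; this keeps the clock
  nonnegative in later inductions.\<close>

lemma killed_acc_mono:
  "(\<And>y t. y \<in> A \<Longrightarrow> s \<le> t \<Longrightarrow> f (y, t) \<le> g (y, t)) \<Longrightarrow> killed_acc q A f (x, s) \<le> killed_acc q A g (x, s)"
  unfolding killed_acc_def by (intro nn_integral_mono) (auto split: split_indicator)

lemma killed_acc_partial_sums: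
  assumes A: "A \<in> sets borel" and g: "g \<in> borel_measurable MT"
  shows "(\<Sum>n<Suc N. (killed_acc q A ^^ n) g p) = g p + killed_acc q A (\<lambda>p. \<Sum>n<N. (killed_acc q A ^^ n) g p) p"
proof -
  define f where "f n z = indicator A (fst z) * (killed_acc q A ^^ n) g (fst z, snd p + \<bar>snd z\<bar>)" for n z
  have "f n \<in> borel_measurable MT" for n
    unfolding f_def by (intro killed_acc_integrand_meas A killed_acc_iter_meas g)
  then have f: "f n \<in> borel_measurable (q (fst p))" for n
    by (simp cong: measurable_cong_sets add: sets_q)
  have "killed_acc q A (\<lambda>p. \<Sum>n<N. (killed_acc q A ^^ n) g p) p = (\<integral>\<^sup>+ z. (\<Sum>n<N. f n z) \<partial>q (fst p))"
    by (simp add: killed_acc_def f_def sum_distrib_left)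
  also have "\<dots> = (\<Sum>n<N. killed_acc q A ((killed_acc q A ^^ n) g) p)"
    using f by (subst nn_integral_sum) (auto simp: killed_acc_def f_def[abs_def])
  finally have "killed_acc q A (\<lambda>p. \<Sum>n<N. (killed_acc q A ^^ n) g p) p
      = (\<Sum>n<N. killed_acc q A ((killed_acc q A ^^ n) g) p)" .
  then show ?thesis by (simp add: sum.lessThan_Suc_shift del: sum.lessThan_Suc)
qed

lemmas semiring_expand = one_add_one[symmetric] ring_distribs mult_1_left mult_1_right mult_ac add_ac

lemma second_moment_bound:
  fixes t \<Gamma> u :: "'a \<Rightarrow> ennreal" and k h b :: ennreal
  assumes A [measurable]: "A \<in> sets borel" and B [measurable]: "B \<in> sets borel"
    and [measurable]: "u \<in> borel_measurable borel" "\<Gamma> \<in> borel_measurable borel"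
    and u_eq: "\<And>y. y \<in> A \<Longrightarrow> u y = step q (indicator B) y + killed q A u y"
    and u_le: "\<And>y. y \<in> A \<Longrightarrow> u y \<le> h"
    and \<Gamma>_eq: "\<And>y. y \<in> A \<Longrightarrow> \<Gamma> y = t y + killed q A \<Gamma> y"
    and \<Gamma>_le: "\<And>y. y \<in> A \<Longrightarrow> \<Gamma> y \<le> b"
    and mom: "\<And>y D j. y \<in> A \<Longrightarrow> D \<in> {A, B} \<Longrightarrow> j \<in> {1, 2} \<Longrightarrow> moment q j D y \<le> k * t y ^ j * step q (indicator D) y"
    and x: "x \<in> A"
  shows "exit_square q A B x \<le> (2 * k + 4 * k\<^sup>2) * h * b\<^sup>2"
proof -
  \<comment> \<open>Both constants come from matching powers of s. In the coefficient of 2 s, a step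
    that exits and a step that stays each cost at most \<open>k * h * t\<close>. In the constant
    term, squared holding times cost \<open>2 * k * h * b * t\<close>, using t^2 \<le> t b, and the
    cross term 2 a b k t supplies the part with k^2.\<close>
  define a where "a = 2 * k * h"
  define d where "d = (2 * k + 4 * k\<^sup>2) * h * b"
  define \<Psi> where "\<Psi> p = (ennreal (snd p))\<^sup>2 * u (fst p) + 2 * ennreal (snd p) * (a * \<Gamma> (fst p)) + d * \<Gamma> (fst p)" for p :: "'a \<times> real"
  define g where "g = killed_acc q B (\<lambda>p. (ennreal (snd p))\<^sup>2)"
  have sq: "(\<lambda>p. (ennreal (snd p))\<^sup>2) \<in> borel_measurable (MT :: ('a \<times> real) measure)" by measurable
  have g_meas: "g \<in> borel_measurable MT" unfolding g_def by (rule killed_acc_meas[OF B sq])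
  have super: "g (y, s) + killed_acc q A \<Psi> (y, s) \<le> \<Psi> (y, s)" if y: "y \<in> A" and s: "0 \<le> s" for y s
  proof -
    define S where "S = ennreal s"
    \<comment> \<open>These collect the coefficients of S^2, 2 S and 1. Where \<open>u\<close> and
      \<open>\<Gamma>\<close> multiply no holding time they are kept exact, to be closed by their
      first-step equations.\<close>
    define I1 I2 I3 :: "'a \<times> real \<Rightarrow> ennreal" where
      "I1 z = indicator B (fst z) + indicator A (fst z) * u (fst z)"
      and "I2 z = indicator B (fst z) * ennreal \<bar>snd z\<bar> ^ 1 + h * (indicator A (fst z) * ennreal \<bar>snd z\<bar> ^ 1)
          + a * (indicator A (fst z) * \<Gamma> (fst z))"
      and "I3 z = indicator B (fst z) * ennreal \<bar>snd z\<bar> ^ 2 + h * (indicator A (fst z) * ennreal \<bar>snd z\<bar> ^ 2)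
          + 2 * a * b * (indicator A (fst z) * ennreal \<bar>snd z\<bar> ^ 1) + d * (indicator A (fst z) * \<Gamma> (fst z))" for z
    have meas [measurable]: "I1 \<in> borel_measurable MT" "I2 \<in> borel_measurable MT" "I3 \<in> borel_measurable MT"
      unfolding I1_def[abs_def] I2_def[abs_def] I3_def[abs_def] by measurable
    have "g (y, s) + killed_acc q A \<Psi> (y, s)
        = (\<integral>\<^sup>+ z. indicator B (fst z) * (ennreal (s + \<bar>snd z\<bar>))\<^sup>2 + indicator A (fst z) * \<Psi> (fst z, s + \<bar>snd z\<bar>) \<partial>q y)"
    proof -
      have "(\<lambda>p. \<Psi> p) \<in> borel_measurable MT" unfolding \<Psi>_def by measurable
      from killed_acc_integrand_meas[OF A this, of s] killed_acc_integrand_meas[OF B sq, of s]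
      show ?thesis unfolding g_def killed_acc_def
        by (subst nn_integral_add) (auto cong: measurable_cong_sets simp: sets_q)
    qed
    also have "\<dots> \<le> (\<integral>\<^sup>+ z. S\<^sup>2 * I1 z + 2 * S * I2 z + I3 z \<partial>q y)"
    proof (rule nn_integral_mono)
      fix z :: "'a \<times> real"
      define r where "r = ennreal \<bar>snd z\<bar>"
      have sum: "ennreal (s + \<bar>snd z\<bar>) = S + r" using s by (simp add: S_def r_def)
      show "indicator B (fst z) * (ennreal (s + \<bar>snd z\<bar>))\<^sup>2 + indicator A (fst z) * \<Psi> (fst z, s + \<bar>snd z\<bar>)
        \<le> S\<^sup>2 * I1 z + 2 * S * I2 z + I3 z"
      proof (cases "fst z \<in> A")
        case True
        define U where "U = u (fst z)"
        define V where "V = \<Gamma> (fst z)"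
        have "indicator B (fst z) * (S + r)\<^sup>2 + ((S + r)\<^sup>2 * U + 2 * (S + r) * (a * V) + d * V)
          = S\<^sup>2 * (indicator B (fst z) + U) + 2 * S * (indicator B (fst z) * r + r * U + a * V)
            + (indicator B (fst z) * r\<^sup>2 + r\<^sup>2 * U + 2 * a * (r * V) + d * V)"
          unfolding power2_eq_square by (simp only: semiring_expand)
        \<comment> \<open>Only factors multiplied by the holding time \<open>r\<close> are enlarged,
          to \<open>h\<close> and \<open>b\<close>, which leaves moments of \<open>r\<close>
          alone.\<close>
        also have "\<dots> \<le> S\<^sup>2 * (indicator B (fst z) + U) + 2 * S * (indicator B (fst z) * r + r * h + a * V)
            + (indicator B (fst z) * r\<^sup>2 + r\<^sup>2 * h + 2 * a * (r * b) + d * V)"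
          using u_le[OF True] \<Gamma>_le[OF True] unfolding U_def V_def by (intro add_mono mult_left_mono) auto
        finally show ?thesis
          using True unfolding sum \<Psi>_def I1_def I2_def I3_def
          by (simp add: sum U_def V_def r_def mult_ac)
      next
        case False
        have "(S + r)\<^sup>2 = S\<^sup>2 + 2 * S * r + r\<^sup>2"
          unfolding power2_eq_square by (simp only: semiring_expand)
        then show ?thesis
          using False unfolding sum I1_def I2_def I3_def by (simp add: r_def split: split_indicator)
      qed
    qed
    also have "\<dots> = S\<^sup>2 * (\<integral>\<^sup>+ z. I1 z \<partial>q y) + 2 * S * (\<integral>\<^sup>+ z. I2 z \<partial>q y) + (\<integral>\<^sup>+ z. I3 z \<partial>q y)"
      by (simp add: nn_integral_add nn_integral_cmult)
    also have "\<dots> \<le> S\<^sup>2 * u y + 2 * S * (a * \<Gamma> y) + d * \<Gamma> y"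
    proof (intro add_mono mult_left_mono)
      have step_B: "step q (indicator B) y \<le> h" using u_eq[OF y] u_le[OF y] by (auto intro: order_trans[of _ "u y"])
      have step_A: "step q (indicator A) y \<le> 1"
        using step_mono[of "indicator A" "\<lambda>_. 1" y] by (simp add: step_const indicator_ennreal_le_1)
      have t_le: "t y \<le> b" using \<Gamma>_eq[OF y] \<Gamma>_le[OF y] by (auto intro: order_trans[of _ "\<Gamma> y"])
      have mB: "moment q j B y \<le> k * t y ^ j * h" if "j \<in> {1, 2}" for j
        using mom[OF y _ that, of B] mult_left_mono[OF step_B, of "k * t y ^ j"] by (auto intro: order_trans)
      have mA: "moment q j A y \<le> k * t y ^ j" if "j \<in> {1, 2}" for j
        using mom[OF y _ that, of A] mult_left_mono[OF step_A, of "k * t y ^ j"] by (auto intro: order_trans)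
      show "(\<integral>\<^sup>+ z. I1 z \<partial>q y) \<le> u y"
        unfolding u_eq[OF y] I1_def step_def killed_def by (simp add: nn_integral_add)
      have "(\<integral>\<^sup>+ z. I2 z \<partial>q y) = moment q 1 B y + h * moment q 1 A y + a * killed q A \<Gamma> y"
        unfolding I2_def moment_def killed_def step_def by (simp add: nn_integral_add nn_integral_cmult)
      also have "\<dots> \<le> k * t y ^ 1 * h + h * (k * t y ^ 1) + a * killed q A \<Gamma> y"
        using mB[of 1] mA[of 1] by (intro add_mono mult_left_mono) auto
      also have "\<dots> = a * \<Gamma> y"
        unfolding \<Gamma>_eq[OF y] a_def power_one_right
        by (simp only: semiring_expand)
      finally show "(\<integral>\<^sup>+ z. I2 z \<partial>q y) \<le> a * \<Gamma> y" .
      have "(\<integral>\<^sup>+ z. I3 z \<partial>q y) = moment q 2 B y + h * moment q 2 A y + 2 * a * b * moment q 1 A y + d * killed q A \<Gamma> y"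
        unfolding I3_def moment_def killed_def step_def by (simp add: nn_integral_add nn_integral_cmult)
      also have "\<dots> \<le> k * t y ^ 2 * h + h * (k * t y ^ 2) + 2 * a * b * (k * t y ^ 1) + d * killed q A \<Gamma> y"
        using mB[of 2] mA[of 2] mA[of 1] by (intro add_mono mult_left_mono) auto
      also have "\<dots> \<le> k * (t y * b) * h + h * (k * (t y * b)) + 2 * a * b * (k * t y) + d * killed q A \<Gamma> y"
        unfolding power2_eq_square power_one_right
        by (intro add_mono mult_left_mono mult_right_mono t_le order_refl) auto
      also have "\<dots> = d * t y + d * killed q A \<Gamma> y"
      proof -
        have four: "(4 :: ennreal) = (1 + 1) * (1 + 1)" by simp
        show ?thesis unfolding a_def d_def power2_eq_square four
          by (simp only: semiring_expand)
      qed
      also have "\<dots> = d * \<Gamma> y" unfolding \<Gamma>_eq[OF y] by (simp add: ring_distribs)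
      finally show "(\<integral>\<^sup>+ z. I3 z \<partial>q y) \<le> d * \<Gamma> y" .
    qed auto
    also have "\<dots> = \<Psi> (y, s)" by (simp add: \<Psi>_def S_def)
    finally show ?thesis .
  qed
  \<comment> \<open>The partial sums iterate the recursion from zero, so they stay below every
    supersolution.\<close>
  have partial: "(\<Sum>n<N. (killed_acc q A ^^ n) g (y, s)) \<le> \<Psi> (y, s)" if "y \<in> A" "0 \<le> s" for N y s
    using that
  proof (induction N arbitrary: y s)
    case (Suc N)
    have "(\<Sum>n<Suc N. (killed_acc q A ^^ n) g (y, s))
        = g (y, s) + killed_acc q A (\<lambda>p. \<Sum>n<N. (killed_acc q A ^^ n) g p) (y, s)"
      by (rule killed_acc_partial_sums[OF A g_meas])
    also have "\<dots> \<le> g (y, s) + killed_acc q A \<Psi> (y, s)"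
      using Suc by (intro add_left_mono killed_acc_mono) auto
    also have "\<dots> \<le> \<Psi> (y, s)" using super Suc.prems by blast
    finally show ?case .
  qed simp
  have "(\<Sum>n. (killed_acc q A ^^ n) g (x, 0)) \<le> \<Psi> (x, 0)"
    using partial[OF x order_refl] by (intro suminf_le_const summableI)
  also have "\<dots> \<le> d * b" using \<Gamma>_le[OF x] by (simp add: \<Psi>_def mult_left_mono)
  finally show ?thesis unfolding exit_square_def g_def d_def by (simp add: power2_eq_square mult_ac)
qed

end

section \<open>Moments of a single holding time\<close>

context renewal_hierarchy
begin

text \<open>Undoes the normalization in \<open>cmom\<close>. If the transition has probability 0,
  both sides vanish; otherwise the cells are linked and the bound on \<open>cmom\<close> is
  available.\<close>

lemma moment_cell:
  assumes e: "0 < \<epsilon>" and ij: "i < M" "j < M" and y: "y \<in> S i" and n: "n \<in> {1, 2}"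
    and cm: "link i j \<Longrightarrow> cmom (Q \<epsilon> y) (S j) n \<le> ennreal (k * tau \<epsilon> i ^ n)" and k: "0 \<le> k"
  shows "moment (Q \<epsilon>) n (S j) y \<le> ennreal k * ennreal (tau \<epsilon> i) ^ n * step (Q \<epsilon>) (indicator (S j)) y"
proof -
  interpret step_kernel "Q \<epsilon>" using e by (rule step_kernel_Q)
  interpret prob_space "Q \<epsilon> y" by (rule prob_q)
  have [measurable]: "S j \<in> sets borel" using S_borel ij by auto
  define R where "R = S j \<times> {0::real..}"
  have R [measurable]: "R \<in> sets (Q \<epsilon> y)" unfolding R_def by (simp add: sets_q MT_def)
  have pos: "AE z in Q \<epsilon> y. z \<in> UNIV \<times> {0..}"
    using kernel e by (intro prob_eq_1[THEN iffD1]) (auto simp: renewal_kernel_def sets_q, simp add: MT_def)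
  define I where "I = (\<integral>\<^sup>+ z. indicator R z * ennreal (snd z ^ n) \<partial>Q \<epsilon> y)"
  have mom: "moment (Q \<epsilon>) n (S j) y = I"
    unfolding moment_def I_def R_def
    by (intro nn_integral_cong_AE) (use pos in \<open>eventually_elim, auto simp: ennreal_power split: split_indicator\<close>)
  have st: "step (Q \<epsilon>) (indicator (S j)) y = emeasure (Q \<epsilon> y) R"
    using step_eq_Pk[OF e ij(2), of y] by (simp add: Pk_def R_def emeasure_eq_measure)
  show ?thesis
  proof (cases "emeasure (Q \<epsilon> y) R = 0")
    case True
    then have null: "AE z in Q \<epsilon> y. z \<notin> R" using R by (intro AE_not_in) auto
    have "I = (\<integral>\<^sup>+ z. 0 \<partial>Q \<epsilon> y)"
      unfolding I_def by (intro nn_integral_cong_AE) (use null in \<open>eventually_elim, auto\<close>)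
    then show ?thesis using mom by simp
  next
    case False
    have "link i j"
    proof (rule ccontr)
      assume nl: "\<not> link i j"
      have "Pk (Q \<epsilon> y) (S j) = 0"
      proof (cases "i = j")
        case True
        then show ?thesis using a_diag e ij y by auto
      next
        case False
        have "(\<forall>\<epsilon>>0. Pm \<epsilon> i j = 0 \<and> (\<forall>x\<in>S i. Pk (Q \<epsilon> x) (S j) = 0)) \<or> (\<forall>\<epsilon>>0. 0 < Pm \<epsilon> i j)"
          using a_offdiag ij False by blast
        moreover have "Pm \<epsilon> i j = 0" using not_link ij False nl e by blast
        ultimately show ?thesis using e y by (metis less_irrefl)
      qed
      then show False using False by (simp add: Pk_def R_def emeasure_eq_measure)
    qed
    then have "I / emeasure (Q \<epsilon> y) R \<le> ennreal (k * tau \<epsilon> i ^ n)"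
      using cm by (simp add: cmom_def I_def R_def)
    then have "I / emeasure (Q \<epsilon> y) R * emeasure (Q \<epsilon> y) R \<le> ennreal (k * tau \<epsilon> i ^ n) * emeasure (Q \<epsilon> y) R"
      by (rule mult_right_mono) simp
    moreover have "I / emeasure (Q \<epsilon> y) R * emeasure (Q \<epsilon> y) R = I"
    proof -
      have "emeasure (Q \<epsilon> y) R / emeasure (Q \<epsilon> y) R = 1"
        using False emeasure_finite[of R] by (intro ennreal_divide_self) (auto simp only: less_top not_False_eq_True)
      then show ?thesis by (simp add: ennreal_divide_times)
    qed
    moreover have "ennreal (k * tau \<epsilon> i ^ n) = ennreal k * ennreal (tau \<epsilon> i) ^ n"
      using k b_pos e ij by (simp add: ennreal_mult' ennreal_power less_imp_le)
    ultimately show ?thesis using mom st by simp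
  qed
qed

lemma moment_cset:
  assumes e: "0 < \<epsilon>" and K: "K \<subseteq> {..<M}"
    and le: "\<And>j. j \<in> K \<Longrightarrow> moment (Q \<epsilon>) n (S j) y \<le> a * step (Q \<epsilon>) (indicator (S j)) y"
  shows "moment (Q \<epsilon>) n (cset S K) y \<le> a * step (Q \<epsilon>) (indicator (cset S K)) y"
proof -
  interpret step_kernel "Q \<epsilon>" using e by (rule step_kernel_Q)
  have fin: "finite K" using K finite_subset by blast
  have [measurable]: "S j \<in> sets borel" if "j \<in> K" for j using S_borel K that by auto
  have ind: "indicator (cset S K) z = (\<Sum>j\<in>K. indicator (S j) z :: ennreal)" for z
    unfolding cset_def using S_disj K
    by (intro indicator_UN_disjoint[OF fin]) (auto simp: disjoint_family_on_def)
  have "moment (Q \<epsilon>) n (cset S K) y = (\<Sum>j\<in>K. moment (Q \<epsilon>) n (S j) y)"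
    unfolding moment_def ind sum_distrib_right by (rule nn_integral_sum) measurable
  also have "\<dots> \<le> (\<Sum>j\<in>K. a * step (Q \<epsilon>) (indicator (S j)) y)"
    using le by (rule sum_mono)
  also have "\<dots> = a * (\<Sum>j\<in>K. step (Q \<epsilon>) (indicator (S j)) y)" by (simp add: sum_distrib_left)
  also have "(\<Sum>j\<in>K. step (Q \<epsilon>) (indicator (S j)) y) = step (Q \<epsilon>) (indicator (cset S K)) y"
    unfolding step_def ind by (rule nn_integral_sum[symmetric]) measurable
  finally show ?thesis .
qed

definition moments_le :: "real \<Rightarrow> real \<Rightarrow> bool" where
  "moments_le k \<epsilon> \<longleftrightarrow> (\<forall>i<M. \<forall>y\<in>S i. \<forall>K. K \<subseteq> {..<M} \<longrightarrow> (\<forall>n\<in>{1, 2}.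
    moment (Q \<epsilon>) n (cset S K) y \<le> ennreal k * ennreal (tau \<epsilon> i) ^ n * step (Q \<epsilon>) (indicator (cset S K)) y))"

lemma moment_bound:
  shows "\<exists>k>0. \<forall>\<^sub>F \<epsilon> in at_right 0. moments_le k \<epsilon>"
proof -
  obtain C \<epsilon>0 where \<epsilon>0: "0 < \<epsilon>0" and raw: "\<forall>\<epsilon>. 0 < \<epsilon> \<and> \<epsilon> \<le> \<epsilon>0 \<longrightarrow>
        (\<forall>i<M. \<forall>j<M. i \<noteq> j \<and> (\<exists>\<epsilon>'>0. Pm \<epsilon>' i j \<noteq> 0) \<longrightarrow> (\<forall>x\<in>S i.
           cmom (Q \<epsilon> x) (S j) 2 < \<top> \<and>
           enn2real (cmom (Q \<epsilon> x) (S j) 2) - (enn2real (cmom (Q \<epsilon> x) (S j) 1))\<^sup>2 \<le> C * (tau \<epsilon> i)\<^sup>2))"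
    using c_var by (elim exE conjE)
  have var: "\<And>\<epsilon> i j x. 0 < \<epsilon> \<Longrightarrow> \<epsilon> \<le> \<epsilon>0 \<Longrightarrow> link i j \<Longrightarrow> x \<in> S i \<Longrightarrow>
      cmom (Q \<epsilon> x) (S j) 2 < \<top> \<and>
      enn2real (cmom (Q \<epsilon> x) (S j) 2) - (enn2real (cmom (Q \<epsilon> x) (S j) 1))\<^sup>2 \<le> C * (tau \<epsilon> i)\<^sup>2"
    using raw unfolding link_def by blast
  \<comment> \<open>Second moment = variance + squared mean: tolerance 1 in (b) bounds the mean by 2
    tau, hence its square by 4 tau^2. The absolute value covers a negative \<open>C\<close>.\<close>
  define k where "k = \<bar>C\<bar> + 4"
  have k: "4 \<le> k" by (simp add: k_def)
  have "\<forall>\<^sub>F \<epsilon> in at_right 0. \<forall>i\<in>{..<M}. \<forall>j\<in>{..<M}. link i j \<longrightarrow> (\<forall>x\<in>S i.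
      cmom (Q \<epsilon> x) (S j) 1 < \<top> \<and> \<bar>enn2real (cmom (Q \<epsilon> x) (S j) 1) / tau \<epsilon> i - 1\<bar> < 1)"
  proof (intro eventually_ball_finite ballI finite_lessThan)
    fix i j assume "i \<in> {..<M}" "j \<in> {..<M}"
    show "\<forall>\<^sub>F \<epsilon> in at_right 0. link i j \<longrightarrow> (\<forall>x\<in>S i.
      cmom (Q \<epsilon> x) (S j) 1 < \<top> \<and> \<bar>enn2real (cmom (Q \<epsilon> x) (S j) 1) / tau \<epsilon> i - 1\<bar> < 1)"
    proof (cases "link i j")
      case True
      then show ?thesis using b_mean[rule_format, of i j 1] unfolding link_def by simp
    qed simp
  qed
  moreover have "\<forall>\<^sub>F \<epsilon> in at_right 0. \<epsilon> \<le> \<epsilon>0"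
    unfolding eventually_at_right_field using \<epsilon>0 by (intro exI[of _ \<epsilon>0]) auto
  ultimately have "\<forall>\<^sub>F \<epsilon> in at_right 0. moments_le k \<epsilon>"
    using at_right_pos
  proof eventually_elim
    case (elim \<epsilon>)
    have cm: "cmom (Q \<epsilon> y) (S j) n \<le> ennreal (k * tau \<epsilon> i ^ n)" if l: "link i j" and y: "y \<in> S i" and n: "n \<in> {1, 2}" for i j y n
    proof -
      have ij: "i < M" "j < M" using l by (auto simp: link_def)
      have t: "0 < tau \<epsilon> i" using b_pos ij elim by auto
      define m1 where "m1 = enn2real (cmom (Q \<epsilon> y) (S j) 1)"
      define m2 where "m2 = enn2real (cmom (Q \<epsilon> y) (S j) 2)"
      have c1: "cmom (Q \<epsilon> y) (S j) 1 < \<top>" "\<bar>m1 / tau \<epsilon> i - 1\<bar> < 1" using elim(1) ij l y unfolding m1_def by auto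
      have c2: "cmom (Q \<epsilon> y) (S j) 2 < \<top>" "m2 - m1\<^sup>2 \<le> C * (tau \<epsilon> i)\<^sup>2"
        using var[OF elim(3,2) l y] unfolding m1_def m2_def by auto
      have m1_0: "0 \<le> m1" by (simp add: m1_def)
      have "m1 / tau \<epsilon> i < 2" using c1(2) by linarith
      then have m1: "m1 \<le> 2 * tau \<epsilon> i" using t by (simp add: field_simps)
      have "m1\<^sup>2 \<le> (2 * tau \<epsilon> i)\<^sup>2" using m1 m1_0 by (rule power_mono)
      then have "m2 \<le> (C + 4) * (tau \<epsilon> i)\<^sup>2" using c2(2) by (simp add: power_mult_distrib algebra_simps)
      also have "\<dots> \<le> k * (tau \<epsilon> i)\<^sup>2" unfolding k_def by (intro mult_right_mono) auto
      finally have m2: "m2 \<le> k * (tau \<epsilon> i)\<^sup>2" .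
      have m1': "m1 \<le> k * tau \<epsilon> i" using m1 mult_right_mono[of 2 k "tau \<epsilon> i"] k t by linarith
      have e1: "cmom (Q \<epsilon> y) (S j) 1 = ennreal m1" "cmom (Q \<epsilon> y) (S j) 2 = ennreal m2"
        using c1(1) c2(1) unfolding m1_def m2_def by simp_all
      show ?thesis using n e1 m1' m2 by (auto intro!: ennreal_leI)
    qed
    show ?case
      unfolding moments_le_def
    proof (intro allI impI ballI)
      fix i y K n assume *: "i < M" "y \<in> S i" "K \<subseteq> {..<M}" "n \<in> {1, 2::nat}"
      show "moment (Q \<epsilon>) n (cset S K) y \<le> ennreal k * ennreal (tau \<epsilon> i) ^ n * step (Q \<epsilon>) (indicator (cset S K)) y"
      proof (rule moment_cset[OF elim(3) *(3)])
        fix j assume "j \<in> K"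
        then have j: "j < M" using * by auto
        show "moment (Q \<epsilon>) n (S j) y \<le> ennreal k * ennreal (tau \<epsilon> i) ^ n * step (Q \<epsilon>) (indicator (S j)) y"
          by (rule moment_cell[OF elim(3) *(1) j *(2,4)]) (use cm * k in auto)
      qed
    qed
  qed
  then show ?thesis using k by (intro exI[of _ k]) auto
qed

end

lemma eventually_at_right_0_le:
  assumes "\<forall>\<^sub>F \<epsilon> in at_right (0::real). Pr \<epsilon>"
  shows "\<exists>\<epsilon>0>0. \<forall>\<epsilon>. 0 < \<epsilon> \<and> \<epsilon> \<le> \<epsilon>0 \<longrightarrow> Pr \<epsilon>"
proof -
  obtain b where "0 < b" "\<And>y. 0 < y \<Longrightarrow> y < b \<Longrightarrow> Pr y"
    using assms unfolding eventually_at_right_field by blast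
  then show ?thesis by (intro exI[of _ "b / 2"]) auto
qed

theorem theorem6p3:
  fixes M :: nat
    and S :: "nat \<Rightarrow> 'a::metric_space set"
    and Q :: "real \<Rightarrow> 'a \<Rightarrow> ('a \<times> real) measure"
    and Pm :: "real \<Rightarrow> nat \<Rightarrow> nat \<Rightarrow> real"
    and tau :: "real \<Rightarrow> nat \<Rightarrow> real"
    and \<Omega> :: "real \<Rightarrow> 'a \<Rightarrow> 'w measure"
    and X :: "real \<Rightarrow> 'a \<Rightarrow> nat \<Rightarrow> 'w \<Rightarrow> 'a"
    and T :: "real \<Rightarrow> 'a \<Rightarrow> nat \<Rightarrow> 'w \<Rightarrow> real"
    and r :: nat
    and K :: "nat set"
    and tauR :: "real \<Rightarrow> real"
  assumes S_borel: "\<forall>i<M. S i \<in> sets borel"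
    and S_disj: "\<forall>i<M. \<forall>j<M. i \<noteq> j \<longrightarrow> S i \<inter> S j = {}"
    and S_cover: "(\<Union>i<M. S i) = UNIV"
    and kernel: "\<forall>\<epsilon>>0. renewal_kernel (Q \<epsilon>)"
    and process: "\<forall>\<epsilon>>0. \<forall>x. markov_renewal (Q \<epsilon>) x (\<Omega> \<epsilon> x) (X \<epsilon> x) (T \<epsilon> x)"
    and a_diag: "\<forall>\<epsilon>>0. \<forall>i<M. \<forall>x\<in>S i. Pk (Q \<epsilon> x) (S i) = 0"
    and a_offdiag: "\<forall>i<M. \<forall>j<M. i \<noteq> j \<longrightarrow>
        ((\<forall>\<epsilon>>0. Pm \<epsilon> i j = 0 \<and> (\<forall>x\<in>S i. Pk (Q \<epsilon> x) (S j) = 0)) \<or>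
         ((\<forall>\<epsilon>>0. 0 < Pm \<epsilon> i j) \<and>
          (\<forall>e>0. \<forall>\<^sub>F \<epsilon> in at_right 0. \<forall>x\<in>S i. \<bar>Pk (Q \<epsilon> x) (S j) / Pm \<epsilon> i j - 1\<bar> < e)))"
    and a_sum: "\<forall>\<epsilon>>0. \<forall>i<M. (\<Sum>j\<in>{..<M} - {i}. Pm \<epsilon> i j) = 1"
    and a_comm: "\<forall>i<M. \<forall>j<M. (i, j) \<in> {(i, j). i < M \<and> j < M \<and> i \<noteq> j \<and> (\<exists>\<epsilon>>0. Pm \<epsilon> i j \<noteq> 0)}\<^sup>*"
    and b_pos: "\<forall>\<epsilon>>0. \<forall>i<M. 0 < tau \<epsilon> i"
    and b_mean: "\<forall>i<M. \<forall>j<M. i \<noteq> j \<and> (\<exists>\<epsilon>>0. Pm \<epsilon> i j \<noteq> 0) \<longrightarrow>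
        (\<forall>e>0. \<forall>\<^sub>F \<epsilon> in at_right 0. \<forall>x\<in>S i.
           cmom (Q \<epsilon> x) (S j) 1 < \<top> \<and> \<bar>enn2real (cmom (Q \<epsilon> x) (S j) 1) / tau \<epsilon> i - 1\<bar> < e)"
    and c_var: "\<exists>C \<epsilon>0. 0 < \<epsilon>0 \<and> (\<forall>\<epsilon>. 0 < \<epsilon> \<and> \<epsilon> \<le> \<epsilon>0 \<longrightarrow>
        (\<forall>i<M. \<forall>j<M. i \<noteq> j \<and> (\<exists>\<epsilon>'>0. Pm \<epsilon>' i j \<noteq> 0) \<longrightarrow> (\<forall>x\<in>S i.
           cmom (Q \<epsilon> x) (S j) 2 < \<top> \<and>
           enn2real (cmom (Q \<epsilon> x) (S j) 2) - (enn2real (cmom (Q \<epsilon> x) (S j) 1))\<^sup>2 \<le> C * (tau \<epsilon> i)\<^sup>2)))"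
    and f_lim: "\<forall>n (a::nat \<Rightarrow> nat) (b::nat \<Rightarrow> nat) (d::nat \<Rightarrow> nat) ia ic.
        (\<forall>k\<in>{1..n}. a k < M \<and> b k < M \<and> d k < M \<and> a k \<noteq> b k \<and> a k \<noteq> d k \<and>
                    (\<exists>\<epsilon>>0. Pm \<epsilon> (a k) (d k) \<noteq> 0)) \<and> ia < M \<and> ic < M \<longrightarrow>
        (\<exists>L::ereal. 0 \<le> L \<and>
           ((\<lambda>\<epsilon>. ereal ((\<Prod>k=1..n. Pm \<epsilon> (a k) (b k) / Pm \<epsilon> (a k) (d k)) * tau \<epsilon> ia / tau \<epsilon> ic))
              \<longlongrightarrow> L) (at_right 0))"
    and r_lt_R: "\<forall>r'\<le>r. 1 < card (clusters M Pm r')"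
    and K_cl: "K \<in> clusters M Pm r"
    and tauR_pos: "\<forall>\<epsilon>>0. 0 < tauR \<epsilon>"
    and tauR_asym: "\<forall>e>0. \<forall>\<^sub>F \<epsilon> in at_right 0. \<forall>x\<in>cset S K.
        (\<Sum>i\<in>K. ennreal (tau \<epsilon> i) * (\<integral>\<^sup>+ \<omega>. visits (cset S K) (S i) (X \<epsilon> x) \<omega> \<partial>(\<Omega> \<epsilon> x))) < \<top> \<and>
        \<bar>enn2real (\<Sum>i\<in>K. ennreal (tau \<epsilon> i) * (\<integral>\<^sup>+ \<omega>. visits (cset S K) (S i) (X \<epsilon> x) \<omega> \<partial>(\<Omega> \<epsilon> x)))
           / tauR \<epsilon> - 1\<bar> < e"
  shows "\<exists>C \<epsilon>0. 0 < C \<and> 0 < \<epsilon>0 \<and> (\<forall>\<epsilon>. 0 < \<epsilon> \<and> \<epsilon> \<le> \<epsilon>0 \<longrightarrow>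
           (\<forall>x\<in>cset S K. \<forall>L\<in>clusters M Pm r. (\<exists>\<epsilon>'>0. Prank M Pm r \<epsilon>' K L \<noteq> 0) \<longrightarrow>
              exit_mom2 (cset S K) (cset S L) (\<Omega> \<epsilon> x) (X \<epsilon> x) (T \<epsilon> x) \<le> ennreal (C * (tauR \<epsilon>)\<^sup>2)))"
proof -
  \<comment> \<open>Without base indices there would be no clusters at rank 0, against r <
    R.\<close>
  have M_pos: "0 < M"
  proof (rule ccontr)
    assume "\<not> 0 < M"
    then have "clusters M Pm 0 = {}" by (simp add: clusters_def level_def)
    then show False using r_lt_R by force
  qed
  interpret renewal_hierarchy M S Q Pm tau
    by unfold_locales (fact M_pos S_borel S_disj S_cover kernel a_diag a_offdiag a_sum a_comm b_pos b_mean c_var f_lim)+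
  define C where "C = clusters M Pm r"
  define P where "P = Prank M Pm r"
  have lev: "good_level C P" "comparable_level C P"
    using good_comparable_level[OF r_lt_R] by (auto simp: C_def P_def)
  interpret level_step M S Q Pm tau C P by unfold_locales (rule lev(1))
  have KC: "K \<in> C" using K_cl by (simp add: C_def)
  have K_sub: "K \<subseteq> {..<M}" using KC C_cover by blast
  have K_fin: "finite K" using K_sub finite_subset by blast
  define A where "A = cset S K"
  have A [measurable]: "A \<in> sets borel" unfolding A_def by (rule cset_borel[OF KC])
  obtain c where c: "0 < c" "c \<le> 1" and ev1: "\<forall>\<^sub>F \<epsilon> in at_right 0. comparable_at c C P \<epsilon>"
    using lev(2) unfolding comparable_level_def by blast
  obtain k where k: "0 < k" and ev2: "\<forall>\<^sub>F \<epsilon> in at_right 0. moments_le k \<epsilon>"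
    using moment_bound by blast
  \<comment> \<open>With h = P / c and b = 2 tauR the numerator is at most (2 k + 4 k^2) (P / c) 4
    tauR^2; dividing by the lower bound c P of the exit probability leaves this constant times
    tauR^2.\<close>
  define C0 where "C0 = (2 * k + 4 * k\<^sup>2) * 4 / (c * c)"
  have C0: "0 < C0" unfolding C0_def using k c by (simp add: add_pos_pos)
  have "\<forall>\<^sub>F \<epsilon> in at_right 0. \<forall>x\<in>cset S K. \<forall>L\<in>C. (\<exists>\<epsilon>'>0. P \<epsilon>' K L \<noteq> 0) \<longrightarrow>
      exit_mom2 (cset S K) (cset S L) (\<Omega> \<epsilon> x) (X \<epsilon> x) (T \<epsilon> x) \<le> ennreal (C0 * (tauR \<epsilon>)\<^sup>2)"
    using ev1 ev2 tauR_asym[rule_format, OF zero_less_one] at_right_pos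
  proof eventually_elim
    case (elim \<epsilon>)
    have e: "0 < \<epsilon>" by (rule elim(4))
    interpret step_kernel "Q \<epsilon>" using e by (rule step_kernel_Q)
    interpret Kop: positive_operator "killed (Q \<epsilon>) A" UNIV by (rule killed_positive_UNIV[OF A])
    have proc: "renewal_process (Q \<epsilon>) y (\<Omega> \<epsilon> y) (X \<epsilon> y) (T \<epsilon> y)" for y
      using process e by unfold_locales auto
    \<comment> \<open>The expected number of visits to \<open>S i\<close> before the exit, written
      as a Green function: this form is measurable in the starting point and obeys a first-step
      equation.\<close>
    define g where "g i y = (\<Sum>n. (killed (Q \<epsilon>) A ^^ n) (indicator (S i)) y)" for i y
    have S_meas: "S i \<in> sets borel" if "i \<in> K" for i using S_borel K_sub that by auto
    have g_meas: "g i \<in> borel_measurable borel" if "i \<in> K" for i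
    proof -
      have [measurable]: "(killed (Q \<epsilon>) A ^^ n) (indicator (S i)) \<in> borel_measurable borel" for n
        by (rule Kop.iter_meas[OF borel_measurable_indicator[OF S_meas[OF that]]])
      show ?thesis unfolding g_def[abs_def] by measurable
    qed
    define t where "t y = (\<Sum>i\<in>K. ennreal (tau \<epsilon> i) * indicator (S i) y)" for y
    define \<Gamma> where "\<Gamma> y = (\<Sum>i\<in>K. ennreal (tau \<epsilon> i) * g i y)" for y
    have \<Gamma>_meas: "\<Gamma> \<in> borel_measurable borel"
      unfolding \<Gamma>_def[abs_def] using g_meas by (intro borel_measurable_sum borel_measurable_times) auto
    have \<Gamma>_eq: "\<Gamma> y = t y + killed (Q \<epsilon>) A \<Gamma> y" for y
    proof -
      have "killed (Q \<epsilon>) A \<Gamma> y = (\<Sum>i\<in>K. ennreal (tau \<epsilon> i) * killed (Q \<epsilon>) A (g i) y)"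
        unfolding \<Gamma>_def[abs_def] by (rule Kop.T_sum[OF K_fin g_meas])
      moreover have "g i y = indicator (S i) y + killed (Q \<epsilon>) A (g i) y" if "i \<in> K" for i
        unfolding g_def[abs_def] by (rule green_eq[OF A borel_measurable_indicator[OF S_meas[OF that]]])
      ultimately show ?thesis by (simp add: \<Gamma>_def t_def ring_distribs sum.distrib)
    qed
    have \<Gamma>_visits: "\<Gamma> y = (\<Sum>i\<in>K. ennreal (tau \<epsilon> i) * (\<integral>\<^sup>+ \<omega>. visits A (S i) (X \<epsilon> y) \<omega> \<partial>(\<Omega> \<epsilon> y)))" for y
    proof -
      interpret renewal_process "Q \<epsilon>" y "\<Omega> \<epsilon> y" "X \<epsilon> y" "T \<epsilon> y" by (rule proc)
      have "(\<integral>\<^sup>+ \<omega>. visits A (S i) (X \<epsilon> y) \<omega> \<partial>(\<Omega> \<epsilon> y)) = g i y" if "i \<in> K" for i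
        unfolding g_def using that S_meas[OF that] by (intro nn_integral_visits A) (auto simp: A_def cset_def)
      then show ?thesis by (simp add: \<Gamma>_def)
    qed
    have tR: "0 < tauR \<epsilon>" using tauR_pos e by blast
    \<comment> \<open>The factor 2 comes from tolerance 1 in \<open>tauR_asym\<close>.\<close>
    have \<Gamma>_le: "\<Gamma> y \<le> ennreal (2 * tauR \<epsilon>)" if "y \<in> A" for y
    proof -
      have fin: "\<Gamma> y < \<top>" and ab: "\<bar>enn2real (\<Gamma> y) / tauR \<epsilon> - 1\<bar> < 1"
        using elim(3) that unfolding \<Gamma>_visits A_def by blast+
      have "enn2real (\<Gamma> y) / tauR \<epsilon> < 2" using ab by linarith
      then have "enn2real (\<Gamma> y) \<le> 2 * tauR \<epsilon>" using tR by (simp add: field_simps)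
      then have "ennreal (enn2real (\<Gamma> y)) \<le> ennreal (2 * tauR \<epsilon>)" by (rule ennreal_leI)
      then show ?thesis using fin by simp
    qed
    have t_val: "t y = ennreal (tau \<epsilon> i)" if "i \<in> K" "y \<in> S i" for i y
    proof -
      have "indicator (S j) y = (if j = i then 1 else 0 :: ennreal)" if "j \<in> K" for j
      proof -
        have "i < M" "j < M" using K_sub \<open>i \<in> K\<close> \<open>j \<in> K\<close> by auto
        then show ?thesis using S_disj \<open>y \<in> S i\<close> by (auto split: split_indicator)
      qed
      then have "t y = (\<Sum>j\<in>K. if j = i then ennreal (tau \<epsilon> i) else 0)"
        unfolding t_def by (intro sum.cong) auto
      then show ?thesis using K_fin that by simp
    qed
    show ?case
    proof (intro ballI impI)
      fix x L assume x: "x \<in> cset S K" and L: "L \<in> C" and nz: "\<exists>\<epsilon>'>0. P \<epsilon>' K L \<noteq> 0"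
      have KL: "K \<noteq> L" using nz P_diag[OF KC] by blast
      \<comment> \<open>Nonvanishing at one parameter forces a base link, and linked entries are
        positive at all parameters; hence the conditioning event has positive probability at this
        \<epsilon>.\<close>
      have "linked K L" using nz P_unlinked[OF KC L KL] by blast
      then have p: "0 < P \<epsilon> K L" using P_linked[OF KC L KL] regular_pos e by blast
      define B where "B = cset S L"
      have B [measurable]: "B \<in> sets borel" unfolding B_def by (rule cset_borel[OF L])
      have disj: "A \<inter> B = {}" unfolding A_def B_def by (rule cset_disj[OF KC L KL])
      have L_sub: "L \<subseteq> {..<M}" using L C_cover by blast
      define u where "u = exit_op (Q \<epsilon>) A (indicator B)"
      have u_meas: "u \<in> borel_measurable borel" unfolding u_def by measurable
      have u_lower: "ennreal (c * P \<epsilon> K L) \<le> u y" and u_upper: "u y \<le> ennreal (P \<epsilon> K L / c)" if "y \<in> A" for y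
        using comparable_atD(2,3)[OF elim(1) KC _ L KL] that unfolding u_def A_def B_def by blast+
      have "exit_square (Q \<epsilon>) A B x
          \<le> (2 * ennreal k + 4 * (ennreal k)\<^sup>2) * ennreal (P \<epsilon> K L / c) * (ennreal (2 * tauR \<epsilon>))\<^sup>2"
      proof (rule second_moment_bound[OF A B u_meas \<Gamma>_meas _ u_upper \<Gamma>_eq \<Gamma>_le])
        show "u y = step (Q \<epsilon>) (indicator B) y + killed (Q \<epsilon>) A u y" for y
        proof -
          have "(\<lambda>z. indicator (- A) z * indicator B z :: ennreal) = indicator B"
            using disj by (intro ext) (auto split: split_indicator)
          then show ?thesis unfolding u_def using exit_op_first_step[OF A, of "indicator B" y] B by simp
        qed
        show "moment (Q \<epsilon>) j D y \<le> ennreal k * t y ^ j * step (Q \<epsilon>) (indicator D) y"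
          if y: "y \<in> A" and D: "D \<in> {A, B}" and j: "j \<in> {1, 2}" for y D j
        proof -
          obtain i where i: "i \<in> K" "y \<in> S i" using y by (auto simp: A_def cset_def)
          have iM: "i < M" using i K_sub by auto
          have "moment (Q \<epsilon>) j (cset S K') y \<le> ennreal k * ennreal (tau \<epsilon> i) ^ j * step (Q \<epsilon>) (indicator (cset S K')) y"
            if "K' \<subseteq> {..<M}" for K'
            using elim(2) iM i that j unfolding moments_le_def by blast
          from this[OF K_sub] this[OF L_sub] show ?thesis
            unfolding t_val[OF i] using D by (auto simp: A_def B_def)
        qed
        show "x \<in> A" using x by (simp add: A_def)
      qed
      \<comment> \<open>The factor \<open>c * P \<epsilon> K L\<close> is split off in order to be
        exchanged for the exit probability at \<open>x\<close>.\<close>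
      also have "\<dots> = ennreal (c * P \<epsilon> K L) * ennreal (C0 * (tauR \<epsilon>)\<^sup>2)"
      proof -
        have "(2 * ennreal k + 4 * (ennreal k)\<^sup>2) * ennreal (P \<epsilon> K L / c) * (ennreal (2 * tauR \<epsilon>))\<^sup>2
          = ennreal ((2 * k + 4 * k\<^sup>2) * (P \<epsilon> K L / c) * (2 * tauR \<epsilon>)\<^sup>2)"
        proof -
          have "2 * ennreal k + 4 * (ennreal k)\<^sup>2 = ennreal (2 * k + 4 * k\<^sup>2)"
            using k by (simp add: ennreal_power ennreal_mult')
          moreover have "(ennreal (2 * tauR \<epsilon>))\<^sup>2 = ennreal ((2 * tauR \<epsilon>)\<^sup>2)"
            using tR by (intro ennreal_power) simp
          moreover have "ennreal v * ennreal w * ennreal z = ennreal (v * w * z)" if "0 \<le> v" "0 \<le> w" for v w z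
            using that by (simp add: ennreal_mult')
          ultimately show ?thesis using k p c by (simp only: add_nonneg_nonneg mult_nonneg_nonneg
                divide_nonneg_nonneg less_imp_le zero_le_power2 zero_le_numeral)
        qed
        also have "(2 * k + 4 * k\<^sup>2) * (P \<epsilon> K L / c) * (2 * tauR \<epsilon>)\<^sup>2 = c * P \<epsilon> K L * (C0 * (tauR \<epsilon>)\<^sup>2)"
          unfolding C0_def using c by (simp add: power_mult_distrib)
        finally show ?thesis using p c by (simp add: ennreal_mult')
      qed
      also have "\<dots> \<le> u x * ennreal (C0 * (tauR \<epsilon>)\<^sup>2)"
        using u_lower x by (intro mult_right_mono) (auto simp: A_def)
      finally have num: "exit_square (Q \<epsilon>) A B x
          \<le> u x * ennreal (C0 * (tauR \<epsilon>)\<^sup>2)" .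
      have "0 < ennreal (c * P \<epsilon> K L)" using p c by simp
      moreover have "ennreal (c * P \<epsilon> K L) \<le> u x" using u_lower x by (simp add: A_def)
      ultimately have "0 < u x" by (rule less_le_trans)
      interpret renewal_process "Q \<epsilon>" x "\<Omega> \<epsilon> x" "X \<epsilon> x" "T \<epsilon> x" by (rule proc)
      have "exit_mom2 A B (\<Omega> \<epsilon> x) (X \<epsilon> x) (T \<epsilon> x) \<le>
        exit_square (Q \<epsilon>) A B x / u x"
        unfolding u_def by (rule exit_mom2_le[OF A B disj])
      also have "\<dots> \<le> ennreal (C0 * (tauR \<epsilon>)\<^sup>2)"
        by (rule divide_le_posI_ennreal[OF \<open>0 < u x\<close> num])
      finally show "exit_mom2 (cset S K) (cset S L) (\<Omega> \<epsilon> x) (X \<epsilon> x) (T \<epsilon> x) \<le> ennreal (C0 * (tauR \<epsilon>)\<^sup>2)"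
        unfolding A_def B_def .
    qed
  qed
  from eventually_at_right_0_le[OF this] C0 show ?thesis unfolding C_def P_def by blast
qed

end
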